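(* Let $C=V(F)\subset\mathbb{P}^2$ be an irreducible plane algebraic curve over $\mathbb{C}$ of degree $d\ge 3$, with $F\in\mathbb{C}[x,y,z]_d$, and let $H=\det\operatorname{Hess}(F)$ be the defining polynomial of the Hessian curve to $C$. Then there exists a curve of degree $12d-27$ given as the zero set of $$\begin{aligned} H_2=H_2(F)=\;&(12d^2-54d+57)\,H\,\operatorname{Jac}(F,H,\Omega_{\bar H})\\ &+(d-2)(12d-27)\,H\,\operatorname{Jac}(F,H,\Omega_{\bar F})\\ &-20(d-2)^2\operatorname{Jac}(F,H,\Psi),\end{aligned}$$ such that the intersection points between $C$ and this curve are the singular points, the higher order inflection points, and the sextactic points of $C$.
   Context: Notation for points: $(C\cdot C')_p$ is the intersection multiplicity of $C$ and $C'$ at $p$. A point of $C$ is singular if all partial derivatives of $F$ vanish there, and smooth otherwise. For a smooth point $p$, $T_p$ is the tangent line and $l_p=(T_p\cdot C)_p\ge 2$. A smooth point is an inflection point if $l_p>2$; its order is $v_p=l_p-2$; it is simple if $v_p=1$ and of higher order if $v_p\geq 2$. For a smooth point $p$ that is not an inflection point there is a unique conic $O_p$ (the osculating conic) with $c_p=(O_p\cdot C)_p\ge5$; $p$ is called a sextactic point if $c_p\ge 6$. Notation for polynomials: Subscripts $x,y,z$ denote partial derivatives. $\operatorname{Hess}(F)$ denotes the $3\times3$ matrix of second order partial derivatives of $F$. Write $a=F_{xx},\ b=F_{yy},\ c=F_{zz},\ f=F_{yz},\ g=F_{xz},\ h=F_{xy}$ and $a'=H_{xx},\ b'=H_{yy},\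 c'=H_{zz},\ f'=H_{yz},\ g'=H_{xz},\ h'=H_{xy}$. Let $$\mathcal{A}=bc-f^2,\ \mathcal{B}=ac-g^2,\ \mathcal{C}=ab-h^2,\ \mathcal{F}=hg-af,\ \mathcal{G}=hf-bg,\ \mathcal{H}=fg-hc .$$ Define $$\partial_x\Omega_{\bar H}=\mathcal{A}_x a'+\mathcal{B}_x b'+\mathcal{C}_x c'+2\mathcal{F}_x f'+2\mathcal{G}_x g'+2\mathcal{H}_x h',$$ $$\partial_x\Omega_{\bar F}=\mathcal{A} a'_x+\mathcal{B} b'_x+\mathcal{C} c'_x+2\mathcal{F} f'_x+2\mathcal{G} g'_x+2\mathcal{H} h'_x,$$ and define $\partial_y\Omega_{\bar H},\partial_z\Omega_{\bar H},\partial_y\Omega_{\bar F},\partial_z\Omega_{\bar F}$ by replacing the differentiation with respect to $x$ in the subscripts by $y$, respectively $z$. (These are just symbols for the displayed polynomials, not derivatives of polynomials $\Omega_{\bar H}$, $\Omega_{\bar F}$.) Put $$\operatorname{Jac}(F,H,\Omega_{\bar H})=\begin{vmatrix}F_x&F_y&F_z\\H_x&H_y&H_z\\ \partial_x\Omega_{\bar H}&\partial_y\Omega_{\bar H}&\partial_z\Omega_{\bar H}\end{vmatrix},\qquad \operatorname{Jac}(F,H,\Omega_{\bar F})=\begin{vmatrix}F_x&F_y&F_z\\H_x&H_y&H_z\\ \partial_x\Omega_{\bar F}&\partial_y\Omega_{\bar F}&\partial_z\Omega_{\bar F}\end{vmatrix}.$$ Finally let $$\Psi=\mathcal{A}H_x^2+\mathcal{B}H_y^2+\mathcal{C}H_z^2+2\mathcal{F}H_yH_z+2\mathcal{G}H_xH_z+2\mathcal{H}H_xH_y,\qquad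 \operatorname{Jac}(F,H,\Psi)=\begin{vmatrix}F_x&F_y&F_z\\H_x&H_y&H_z\\ \Psi_x&\Psi_y&\Psi_z\end{vmatrix}.$$ *)

theory Defs
  imports
    "HOL-Analysis.Determinants"
    "HOL-Library.Extended_Nat"
    "HOL-Computational_Algebra.Fraction_Field"
    "HOL-Computational_Algebra.Polynomial_Factorial"
begin

section \<open>Polynomials in three variables and points of the projective plane\<close>

text \<open>
  The ring \<open>\<complex>[x,y,z]\<close> is \<open>\<complex>[z][y][x]\<close>: the coefficient of \<open>x^i y^j z^k\<close> in \<open>G\<close> is
  \<open>coeff (coeff (coeff G i) j) k\<close>.
  A point of the projective plane is given by homogeneous coordinates, i.e. by a nonzero
  triple; for forms, all notions below are invariant under scaling of the triple.
\<close>

type_synonym cpoly3 = "complex poly poly poly"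
type_synonym coords = "complex \<times> complex \<times> complex"

definition const3 :: "complex \<Rightarrow> cpoly3" where
  "const3 c = [:[:[:c:]:]:]"

definition X :: cpoly3 where "X = [:0, 1:]"
definition Y :: cpoly3 where "Y = [:[:0, 1:]:]"
definition Z :: cpoly3 where "Z = [:[:[:0, 1:]:]:]"

fun eval3 :: "cpoly3 \<Rightarrow> coords \<Rightarrow> complex" where
  "eval3 G (u, v, w) = poly (poly (poly G [:[:u:]:]) [:v:]) w"

definition dx :: "cpoly3 \<Rightarrow> cpoly3" where "dx G = pderiv G"
definition dy :: "cpoly3 \<Rightarrow> cpoly3" where "dy G = map_poly pderiv G"
definition dz :: "cpoly3 \<Rightarrow> cpoly3" where "dz G = map_poly (map_poly pderiv) G"

text \<open>As usual, the zero polynomial is a form of every degree.\<close>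

definition form :: "nat \<Rightarrow> cpoly3 \<Rightarrow> bool" where
  "form n G \<longleftrightarrow> (\<forall>i j k. coeff (coeff (coeff G i) j) k \<noteq> 0 \<longrightarrow> i + j + k = n)"

definition plane_curve :: "nat \<Rightarrow> cpoly3 \<Rightarrow> bool" where
  "plane_curve n G \<longleftrightarrow> form n G \<and> G \<noteq> 0"

definition V :: "cpoly3 \<Rightarrow> coords set" where
  "V G = {p. p \<noteq> (0, 0, 0) \<and> eval3 G p = 0}"


section \<open>Intersection multiplicity\<close>

text \<open>
  The local ring of the projective plane at \<open>p\<close> consists of the quotients of forms of equal
  degree whose denominator does not vanish at \<open>p\<close>. The ideal of the curve \<open>V(G)\<close> in it consists
  of those quotients whose numerator is a multiple of \<open>G\<close>; it is generated by \<open>G / L^n\<close>, for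
  \<open>n\<close> the degree of \<open>G\<close> and \<open>L\<close> any linear form with \<open>L(p) \<noteq> 0\<close>.
\<close>

definition local_ring :: "coords \<Rightarrow> cpoly3 fract set" where
  "local_ring p = {Fract A S | A S n. form n A \<and> form n S \<and> eval3 S p \<noteq> 0}"

definition local_ideal :: "cpoly3 \<Rightarrow> coords \<Rightarrow> cpoly3 fract set" where
  "local_ideal G p = {Fract A S | A S n. form n A \<and> form n S \<and> eval3 S p \<noteq> 0 \<and> G dvd A}"

text \<open>
  The dimension of the complex vector space \<open>R/I\<close>, possibly infinite, as the supremum of the
  sizes of the finite subsets of \<open>R\<close> that are linearly independent modulo \<open>I\<close>.
\<close>

definition quotient_dim :: "cpoly3 fract set \<Rightarrow> cpoly3 fract set \<Rightarrow> enat" where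
  "quotient_dim R I = Sup {enat (card B) | B. finite B \<and> B \<subseteq> R \<and>
     (\<forall>c. (\<Sum>b\<in>B. Fract (const3 (c b)) 1 * b) \<in> I \<longrightarrow> (\<forall>b\<in>B. c b = 0))}"

definition inter_mult :: "cpoly3 \<Rightarrow> cpoly3 \<Rightarrow> coords \<Rightarrow> enat" where
  "inter_mult G G' p =
     quotient_dim (local_ring p) {u + v | u v. u \<in> local_ideal G p \<and> v \<in> local_ideal G' p}"


section \<open>Singular points, inflection points and sextactic points\<close>

definition singular_points :: "cpoly3 \<Rightarrow> coords set" where
  "singular_points F = {p \<in> V F. eval3 (dx F) p = 0 \<and> eval3 (dy F) p = 0 \<and> eval3 (dz F) p = 0}"

definition smooth_points :: "cpoly3 \<Rightarrow> coords set" where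
  "smooth_points F = V F - singular_points F"

definition tangent_line :: "cpoly3 \<Rightarrow> coords \<Rightarrow> cpoly3" where
  "tangent_line F p =
     const3 (eval3 (dx F) p) * X + const3 (eval3 (dy F) p) * Y + const3 (eval3 (dz F) p) * Z"

definition tangent_mult :: "cpoly3 \<Rightarrow> coords \<Rightarrow> enat" where
  "tangent_mult F p = inter_mult (tangent_line F p) F p"

definition inflection_points :: "cpoly3 \<Rightarrow> coords set" where
  "inflection_points F = {p \<in> smooth_points F. tangent_mult F p > 2}"

definition inflection_order :: "cpoly3 \<Rightarrow> coords \<Rightarrow> enat" where
  "inflection_order F p = tangent_mult F p - 2"

definition higher_order_inflection_points :: "cpoly3 \<Rightarrow> coords set" where
  "higher_order_inflection_points F = {p \<in> inflection_points F. inflection_order F p \<ge> 2}"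

text \<open>
  At a smooth point that is not an inflection point, the osculating conic is unique up to a
  nonzero scalar factor of its equation.
\<close>

definition osculating_conic :: "cpoly3 \<Rightarrow> coords \<Rightarrow> cpoly3 \<Rightarrow> bool" where
  "osculating_conic F p Q \<longleftrightarrow> plane_curve 2 Q \<and> inter_mult Q F p \<ge> 5"

definition sextactic_points :: "cpoly3 \<Rightarrow> coords set" where
  "sextactic_points F = {p \<in> smooth_points F - inflection_points F.
     \<exists>Q. osculating_conic F p Q \<and> inter_mult Q F p \<ge> 6}"


section \<open>The Hessian and the 2-Hessian\<close>

definition Hess :: "cpoly3 \<Rightarrow> cpoly3^3^3" where
  "Hess F = vector
     [vector [dx (dx F), dy (dx F), dz (dx F)],
      vector [dx (dy F), dy (dy F), dz (dy F)],
      vector [dx (dz F), dy (dz F), dz (dz F)]]"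

definition hessian :: "cpoly3 \<Rightarrow> cpoly3" where
  "hessian F = det (Hess F)"

text \<open>The six entries \<open>bc - f\<^sup>2\<close>, ..., \<open>fg - hc\<close> of the adjugate of the Hessian matrix.\<close>

definition adjA :: "cpoly3 \<Rightarrow> cpoly3" where
  "adjA F = dy (dy F) * dz (dz F) - (dz (dy F))\<^sup>2"
definition adjB :: "cpoly3 \<Rightarrow> cpoly3" where
  "adjB F = dx (dx F) * dz (dz F) - (dz (dx F))\<^sup>2"
definition adjC :: "cpoly3 \<Rightarrow> cpoly3" where
  "adjC F = dx (dx F) * dy (dy F) - (dy (dx F))\<^sup>2"
definition adjF :: "cpoly3 \<Rightarrow> cpoly3" where
  "adjF F = dy (dx F) * dz (dx F) - dx (dx F) * dz (dy F)"
definition adjG :: "cpoly3 \<Rightarrow> cpoly3" where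
  "adjG F = dy (dx F) * dz (dy F) - dy (dy F) * dz (dx F)"
definition adjH :: "cpoly3 \<Rightarrow> cpoly3" where
  "adjH F = dz (dy F) * dz (dx F) - dy (dx F) * dz (dz F)"

text \<open>
  In the next two definitions \<open>D\<close> is one of \<open>dx\<close>, \<open>dy\<close>, \<open>dz\<close>. The first differentiates only the
  adjugate entries of \<open>Hess F\<close>, the second only the second derivatives of \<open>H\<close>.
\<close>

definition dOmega_H :: "(cpoly3 \<Rightarrow> cpoly3) \<Rightarrow> cpoly3 \<Rightarrow> cpoly3" where
  "dOmega_H D F = (let H = hessian F in
     D (adjA F) * dx (dx H) + D (adjB F) * dy (dy H) + D (adjC F) * dz (dz H)
     + 2 * D (adjF F) * dz (dy H) + 2 * D (adjG F) * dz (dx H) + 2 * D (adjH F) * dy (dx H))"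

definition dOmega_F :: "(cpoly3 \<Rightarrow> cpoly3) \<Rightarrow> cpoly3 \<Rightarrow> cpoly3" where
  "dOmega_F D F = (let H = hessian F in
     adjA F * D (dx (dx H)) + adjB F * D (dy (dy H)) + adjC F * D (dz (dz H))
     + 2 * adjF F * D (dz (dy H)) + 2 * adjG F * D (dz (dx H)) + 2 * adjH F * D (dy (dx H)))"

definition Psi :: "cpoly3 \<Rightarrow> cpoly3" where
  "Psi F = (let H = hessian F in
     adjA F * (dx H)\<^sup>2 + adjB F * (dy H)\<^sup>2 + adjC F * (dz H)\<^sup>2
     + 2 * adjF F * dy H * dz H + 2 * adjG F * dx H * dz H + 2 * adjH F * dx H * dy H)"

definition grad :: "cpoly3 \<Rightarrow> cpoly3^3" where
  "grad G = vector [dx G, dy G, dz G]"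

definition Jac_Omega_H :: "cpoly3 \<Rightarrow> cpoly3" where
  "Jac_Omega_H F = det (vector
     [grad F, grad (hessian F), vector [dOmega_H dx F, dOmega_H dy F, dOmega_H dz F]]
     :: cpoly3^3^3)"

definition Jac_Omega_F :: "cpoly3 \<Rightarrow> cpoly3" where
  "Jac_Omega_F F = det (vector
     [grad F, grad (hessian F), vector [dOmega_F dx F, dOmega_F dy F, dOmega_F dz F]]
     :: cpoly3^3^3)"

definition Jac_Psi :: "cpoly3 \<Rightarrow> cpoly3" where
  "Jac_Psi F = det (vector [grad F, grad (hessian F), grad (Psi F)] :: cpoly3^3^3)"

text \<open>The argument \<open>d\<close> is the degree of \<open>F\<close>; subtraction takes place in the polynomial ring.\<close>

definition H2 :: "nat \<Rightarrow> cpoly3 \<Rightarrow> cpoly3" where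
  "H2 d F =
     (12 * (of_nat d)\<^sup>2 - 54 * of_nat d + 57) * hessian F * Jac_Omega_H F
     + (of_nat d - 2) * (12 * of_nat d - 27) * hessian F * Jac_Omega_F F
     - 20 * (of_nat d - 2)\<^sup>2 * Jac_Psi F"

end

(*
  At a smooth point p choose a basis (a, b, c) of C^3 of determinant 1 with a = p, b tangent and c
  transversal to the curve; the branch at p is a + t b + y(t) c with y in t^2 C[[t]]. Intersection
  multiplicities at p with F are orders of vanishing along the branch. Hence p is an inflection point
  iff y''(0) = 0, of higher order iff also y'''(0) = 0, and otherwise p is sextactic iff the Monge
  expression 9 u^2 u''' - 45 u u' u'' + 40 u'^3, u = y'', vanishes at 0. At inflection points the
  Monge expression is 40 u'(0)^3, so it vanishes exactly at the higher order ones, too.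

  The 2-Hessian restricted to the branch is
    - (d-1)^8 (d-2)^2 (4d-9) phi^12 (9 u^2 u''' - 45 u u' u'' + 40 u'^3),
  where phi, the derivative of F in the direction c, is a unit. To see this, write all contractions
  with the adjugate of the Hessian matrix as mixed discriminants and express them in the moving frame
  (gamma, gamma', c) of determinant 1. Euler's identity and differentiation along the branch give all
  entries in terms of phi, y, mu = F_cc and h = H restricted to the branch; mu cancels in H_2.

  If H_2 were 0, the Monge expression would vanish identically on some branch, which would then lie
  on a line or on a conic; that curve would divide F.
*)

theory Submission
  imports
    Defs
    "HOL-Computational_Algebra.Formal_Power_Series"
    "HOL-Computational_Algebra.Field_as_Ring"
    "HOL-Computational_Algebra.Fundamental_Theorem_Algebra"
begin


section \<open>Polynomials and forms in three variables\<close>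

text \<open>The expressions \<open>dOmega_H\<close> and \<open>dOmega_F\<close> are not gradients,
  so neither Euler's identity nor differentiation along the branch applies to them singly. But their
  sum is the gradient of \<open>Omega\<close>, and the contraction of \<open>dOmega_H\<close> with
  the point of the curve is a multiple of \<open>Omega\<close>. So only the contraction of
  \<open>dOmega_H\<close> with the tangent vector \<open>b\<close> has to be expanded explicitly,
  and third derivatives of the Hessian polynomial are never computed. The expansion closes up
  because the Hessian matrix of \<open>F\<close> has first row \<open>(0, 0, k * \<phi>)\<close> in
  the moving frame: the relevant cofactor of the slot \<open>c, c\<close> vanishes, which removes
  the third derivative of \<open>F\<close> and the second derivative of \<open>hessian F\<close>
  taken purely in direction \<open>c\<close>. Multiplicities are defined as dimensions over the
  local ring of the plane; the passage to orders eliminates one coordinate by means of the equation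
  of the curve, which is possible since its transversal derivative is a unit. That \<open>H2\<close>
  is nonzero needs some branch, hence a smooth point. It comes from a Bezout identity between an
  irreducible polynomial and its derivative whose right side is a nonzero element of the coefficient
  ring.\<close>

lemma poly_generators_induct [case_names const var add mult]:
  fixes p :: "'a::comm_semiring_1 poly"
  assumes "\<And>a. P [:a:]" and "P [:0, 1:]"
    and "\<And>p q. P p \<Longrightarrow> P q \<Longrightarrow> P (p + q)" and "\<And>p q. P p \<Longrightarrow> P q \<Longrightarrow> P (p * q)"
  shows "P p"
proof (induction p)
  case 0
  show ?case using assms(1)[of 0] by simp
next
  case (pCons a p)
  have "pCons a p = [:a:] + [:0, 1:] * p" by simp
  then show ?case using assms pCons.IH by metis
qed

text \<open>Hides the nesting of the three polynomial rings: constants and variables generate, so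
  identities for evaluations and derivatives reduce to generators and to closure under sums and
  products.\<close>

lemma cpoly3_induct [case_names const X Y Z add mult]:
  assumes "\<And>c. P (const3 c)" and "P X" and "P Y" and "P Z"
    and "\<And>A B. P A \<Longrightarrow> P B \<Longrightarrow> P (A + B)" and "\<And>A B. P A \<Longrightarrow> P B \<Longrightarrow> P (A * B)"
  shows "P G"
proof (induction G rule: poly_generators_induct)
  case (const a)
  show ?case
  proof (induction a rule: poly_generators_induct)
    case (const a)
    show ?case
    proof (induction a rule: poly_generators_induct)
      case (const a)
      show ?case using assms(1)[of a] by (simp add: const3_def)
    next
      case (add p q)
      then show ?case using assms(5)[of "[:[:p:]:]" "[:[:q:]:]"] by simp
    next
      case (mult p q)
      then show ?case using assms(6)[of "[:[:p:]:]" "[:[:q:]:]"] by (simp add: mult.commute)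
    qed (use assms(4) in \<open>simp add: Z_def\<close>)
  next
    case (add p q)
    then show ?case using assms(5)[of "[:p:]" "[:q:]"] by simp
  next
    case (mult p q)
    then show ?case using assms(6)[of "[:p:]" "[:q:]"] by (simp add: mult.commute)
  qed (use assms(3) in \<open>simp add: Y_def\<close>)
qed (use assms(2,5,6) in \<open>simp_all add: X_def\<close>)

lemma X_mult: "X * G = pCons 0 G"
  by (simp add: X_def)

lemma Y_mult: "Y * G = smult [:0, 1:] G"
  by (simp add: Y_def)

lemma Z_mult: "Z * G = smult [:[:0, 1:]:] G"
  by (simp add: Z_def)

lemma const3_mult: "const3 c * G = smult [:[:c:]:] G"
  by (simp add: const3_def)

lemma const3_simps [simp]:
  "const3 0 = 0" "const3 1 = 1"
  "const3 (a + b) = const3 a + const3 b" "const3 (a - b) = const3 a - const3 b"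
  "const3 (- a) = - const3 a" "const3 (a * b) = const3 a * const3 b"
  by (simp_all add: const3_def one_pCons mult.commute)

lemma const3_of_nat: "const3 (of_nat n) = of_nat n"
  by (simp add: const3_def of_nat_poly)

declare eval3.simps [simp del]

lemma eval3_simps [simp]:
  "eval3 (const3 c) p = c" "eval3 0 p = 0" "eval3 1 p = 1"
  "eval3 (A + B) p = eval3 A p + eval3 B p" "eval3 (A - B) p = eval3 A p - eval3 B p"
  "eval3 (- A) p = - eval3 A p"
  "eval3 (A * B) p = eval3 A p * eval3 B p"
  "eval3 (A ^ n) p = eval3 A p ^ n"
  by (cases p; simp add: const3_def eval3.simps poly_power)+

lemma eval3_vars [simp]:
  "eval3 X (u, v, w) = u" "eval3 Y (u, v, w) = v" "eval3 Z (u, v, w) = w"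
  by (simp_all add: X_def Y_def Z_def eval3.simps)


subsection \<open>Partial derivatives\<close>

lemma map_poly_additive:
  assumes "\<And>a b. f (a + b) = f a + f b" and "f 0 = 0"
  shows "map_poly f (p + q) = map_poly f p + map_poly f q"
  by (intro poly_eqI) (simp add: coeff_map_poly assms)

text \<open>\<open>dy\<close> and \<open>dz\<close> act on coefficients only, so their product rules
  come from lifting \<open>pderiv\<close> on an inner ring once and twice.\<close>

lemma map_poly_Leibniz:
  fixes \<delta> :: "'a::comm_ring_1 \<Rightarrow> 'a"
  assumes add: "\<And>a b. \<delta> (a + b) = \<delta> a + \<delta> b" and mult: "\<And>a b. \<delta> (a * b) = \<delta> a * b + a * \<delta> b"
  shows "map_poly \<delta> (p * q) = map_poly \<delta> p * q + p * map_poly \<delta> q"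
proof -
  have 0: "\<delta> 0 = 0" using add[of 0 0] by simp
  have smult: "map_poly \<delta> (smult a q) = smult (\<delta> a) q + smult a (map_poly \<delta> q)" for a
    by (intro poly_eqI) (simp add: coeff_map_poly 0 mult)
  show ?thesis
    by (induction p)
      (simp_all add: 0 map_poly_pCons map_poly_additive[OF add 0] smult algebra_simps)
qed

lemma dx_simps [simp]:
  "dx 0 = 0" "dx (const3 c) = 0" "dx X = 1" "dx Y = 0" "dx Z = 0"
  "dx (A + B) = dx A + dx B" "dx (A * B) = dx A * B + A * dx B"
  by (simp_all add: dx_def const3_def X_def Y_def Z_def pderiv_add pderiv_mult pderiv_pCons
      one_pCons mult.commute add.commute)

lemma dy_simps [simp]:
  "dy 0 = 0" "dy (const3 c) = 0" "dy X = 0" "dy Y = 1" "dy Z = 0"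
  "dy (A + B) = dy A + dy B" "dy (A * B) = dy A * B + A * dy B"
proof -
  show "dy (A * B) = dy A * B + A * dy B"
    unfolding dy_def by (rule map_poly_Leibniz) (simp_all add: pderiv_add pderiv_mult)
  show "dy (A + B) = dy A + dy B"
    unfolding dy_def by (rule map_poly_additive) (simp_all add: pderiv_add)
qed (simp_all add: dy_def const3_def X_def Y_def Z_def map_poly_pCons pderiv_pCons one_pCons)

lemma dz_simps [simp]:
  "dz 0 = 0" "dz (const3 c) = 0" "dz X = 0" "dz Y = 0" "dz Z = 1"
  "dz (A + B) = dz A + dz B" "dz (A * B) = dz A * B + A * dz B"
proof -
  have add: "map_poly pderiv (A + B) = map_poly pderiv A + map_poly pderiv B"
    for A B :: "complex poly poly"
    by (rule map_poly_additive) (simp_all add: pderiv_add)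
  show "dz (A * B) = dz A * B + A * dz B"
    unfolding dz_def
    by (intro map_poly_Leibniz add) (simp_all add: pderiv_add pderiv_mult)
  show "dz (A + B) = dz A + dz B"
    unfolding dz_def by (rule map_poly_additive) (simp_all add: add)
qed (simp_all add: dz_def const3_def X_def Y_def Z_def map_poly_pCons pderiv_pCons one_pCons)

lemma d_1 [simp]: "dx 1 = 0" "dy 1 = 0" "dz 1 = 0"
  using dx_simps(2)[of 1] dy_simps(2)[of 1] dz_simps(2)[of 1] by simp_all

lemma d_uminus [simp]: "dx (- A) = - dx A" "dy (- A) = - dy A" "dz (- A) = - dz A"
proof -
  have "- A = const3 (-1) * A" by simp
  then have "dx (-A) = const3 (-1) * dx A" "dy (-A) = const3 (-1) * dy A" "dz (-A) = const3 (-1) * dz A"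
    by (simp_all only: dx_simps dy_simps dz_simps) simp_all
  then show "dx (- A) = - dx A" "dy (- A) = - dy A" "dz (- A) = - dz A"
    by simp_all
qed

lemma d_diff [simp]:
  "dx (A - B) = dx A - dx B" "dy (A - B) = dy A - dy B" "dz (A - B) = dz A - dz B"
  by (simp_all only: diff_conv_add_uminus dx_simps dy_simps dz_simps d_uminus)

lemma d_numeral [simp]: "dx (numeral n) = 0" "dy (numeral n) = 0" "dz (numeral n) = 0"
  by (metis const3_of_nat of_nat_numeral dx_simps(2) dy_simps(2) dz_simps(2))+

lemma d_commute:
  "dx (dy G) = dy (dx G)" "dx (dz G) = dz (dx G)" "dy (dz G) = dz (dy G)"
proof -
  show "dx (dy G) = dy (dx G)" by (induction G rule: cpoly3_induct) (simp_all add: algebra_simps)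
  show "dx (dz G) = dz (dx G)" by (induction G rule: cpoly3_induct) (simp_all add: algebra_simps)
  show "dy (dz G) = dz (dy G)" by (induction G rule: cpoly3_induct) (simp_all add: algebra_simps)
qed


subsection \<open>Forms\<close>

lemma form_0 [simp]: "form n 0"
  by (simp add: form_def)

lemma form_add: "form n A \<Longrightarrow> form n B \<Longrightarrow> form n (A + B)"
  unfolding form_def by (metis add.right_neutral coeff_add)

lemma form_uminus: "form n A \<Longrightarrow> form n (- A)"
  unfolding form_def by simp

lemma form_diff: "form n A \<Longrightarrow> form n B \<Longrightarrow> form n (A - B)"
  using form_add[of n A "- B"] form_uminus by simp

lemma form_const3: "form 0 (const3 c)"
  by (auto simp: form_def const3_def coeff_pCons split: nat.splits if_splits)

lemma form_X_mult: "form n A \<Longrightarrow> form (Suc n) (X * A)"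
  by (auto simp: form_def X_mult coeff_pCons split: nat.splits)

lemma form_Y_mult: "form n A \<Longrightarrow> form (Suc n) (Y * A)"
  by (auto simp: form_def Y_mult coeff_pCons split: nat.splits)

lemma form_Z_mult: "form n A \<Longrightarrow> form (Suc n) (Z * A)"
  by (auto simp: form_def Z_mult coeff_pCons split: nat.splits)

lemma form_const3_mult: "form n A \<Longrightarrow> form n (const3 c * A)"
  by (auto simp: form_def const3_mult)

lemma form_0_obtain_const:
  assumes "form 0 A" obtains c where "A = const3 c"
proof
  show "A = const3 (coeff (coeff (coeff A 0) 0) 0)"
    using assms unfolding form_def const3_def
    by (intro poly_eqI) (auto simp: coeff_pCons split: nat.splits)
qed

text \<open>Each monomial of positive degree goes to the first of x, y, z that occurs in it; taking
  \<open>pCons\<close> apart on the three levels performs this split.\<close>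

lemma form_Suc_decompose:
  assumes "form (Suc n) A"
  obtains A1 A2 A3 where "form n A1" "form n A2" "form n A3" "A = X * A1 + Y * A2 + Z * A3"
proof -
  obtain a A1 where A: "A = pCons a A1" by (cases A)
  obtain b a1 where a: "a = pCons b a1" by (cases a)
  obtain c b1 where b: "b = pCons c b1" by (cases b)
  have cf: "coeff (coeff (coeff A i) j) k \<noteq> 0 \<Longrightarrow> i + j + k = Suc n" for i j k
    using assms by (simp add: form_def)
  have "c = 0" using cf[of 0 0 0] by (auto simp: A a b)
  then have "A = X * A1 + Y * [:a1:] + Z * [:[:b1:]:]"
    by (simp add: A a b X_def Y_def Z_def)
  moreover have "form n A1"
    unfolding form_def using cf[of "Suc _"] by (auto simp: A)
  moreover have "form n [:a1:]"
    unfolding form_def using cf[of 0 "Suc _"]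
    by (auto simp: A a coeff_pCons split: nat.splits)
  moreover have "form n [:[:b1:]:]"
    unfolding form_def using cf[of 0 0 "Suc _"]
    by (auto simp: A a b coeff_pCons split: nat.splits)
  ultimately show ?thesis using that by blast
qed

lemma form_induct [consumes 1, case_names const step]:
  assumes "form n A" and "\<And>c. P 0 (const3 c)"
    and "\<And>n A B C. form n A \<Longrightarrow> form n B \<Longrightarrow> form n C \<Longrightarrow> P n A \<Longrightarrow> P n B \<Longrightarrow> P n C \<Longrightarrow>
      P (Suc n) (X * A + Y * B + Z * C)"
  shows "P n A"
  using assms(1)
proof (induction n arbitrary: A)
  case 0
  then show ?case using form_0_obtain_const assms(2) by metis
next
  case (Suc n)
  then show ?case using form_Suc_decompose assms(3) by metis
qed

lemma form_mult: "form m A \<Longrightarrow> form n B \<Longrightarrow> k = m + n \<Longrightarrow> form k (A * B)"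
proof (induction m A arbitrary: k rule: form_induct)
  case (const c)
  then show ?case by (simp add: form_const3_mult)
next
  case (step m A1 A2 A3)
  have "(X * A1 + Y * A2 + Z * A3) * B = X * (A1 * B) + Y * (A2 * B) + Z * (A3 * B)"
    by (simp add: algebra_simps)
  then show ?case
    using step by (simp add: form_add form_X_mult form_Y_mult form_Z_mult)
qed

lemma form_1: "form 0 1"
  using form_const3[of 1] by simp

lemma form_vars: "form 1 X" "form 1 Y" "form 1 Z"
  using form_X_mult[OF form_1] form_Y_mult[OF form_1] form_Z_mult[OF form_1] by simp_all

lemma form_power: "form m A \<Longrightarrow> k = n * m \<Longrightarrow> form k (A ^ n)"
  by (induction n arbitrary: k) (auto intro: form_1 form_mult)

lemma coeff_of_nat_mult: "coeff (of_nat m * p) k = of_nat m * coeff p k"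
  by (simp add: of_nat_poly)

lemma form_partial:
  assumes "form n A"
  shows "form (n - 1) (dx A)" "form (n - 1) (dy A)" "form (n - 1) (dz A)"
proof -
  have *: "coeff (coeff (coeff A i) j) k \<noteq> 0 \<Longrightarrow> i + j + k = n" for i j k
    using assms by (simp add: form_def)
  show "form (n - 1) (dx A)"
    using *[of "Suc _"]
    by (fastforce simp: form_def dx_def coeff_pderiv coeff_of_nat_mult simp del: of_nat_Suc)
  show "form (n - 1) (dy A)"
    using *[of _ "Suc _"]
    by (fastforce simp: form_def dy_def coeff_map_poly coeff_pderiv coeff_of_nat_mult simp del: of_nat_Suc)
  show "form (n - 1) (dz A)"
    using *[of _ _ "Suc _"]
    by (fastforce simp: form_def dz_def coeff_map_poly coeff_pderiv simp del: of_nat_Suc)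
qed

lemma form_degree_unique: "form m A \<Longrightarrow> form n A \<Longrightarrow> A \<noteq> 0 \<Longrightarrow> m = n"
  unfolding form_def by (metis leading_coeff_neq_0)

lemma Euler:
  assumes "form n A" shows "X * dx A + Y * dy A + Z * dz A = of_nat n * A"
  using assms
proof (induction n A rule: form_induct)
  case (const c)
  show ?case by simp
next
  case (step n A B C)
  have "X * dx (X * A + Y * B + Z * C) + Y * dy (X * A + Y * B + Z * C) + Z * dz (X * A + Y * B + Z * C)
     = (X * A + Y * B + Z * C) + X * (X * dx A + Y * dy A + Z * dz A)
        + Y * (X * dx B + Y * dy B + Z * dz B) + Z * (X * dx C + Y * dy C + Z * dz C)"
    by (simp add: algebra_simps)
  then show ?case
    by (simp only: step.IH of_nat_Suc) (simp add: algebra_simps)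
qed


subsection \<open>Evaluation at a triple of power series\<close>

text \<open>Evaluation along a coefficient map \<open>h\<close>. Nested three times it gives
  \<open>ev\<close>; with \<open>h\<close> a point evaluation it specialises all variables but the
  outermost, as in the search for smooth points.\<close>

definition hom_poly :: "('a::comm_ring_1 \<Rightarrow> 'b::comm_ring_1) \<Rightarrow> 'b \<Rightarrow> 'a poly \<Rightarrow> 'b" where
  "hom_poly h u p = poly (map_poly h p) u"

lemma hom_poly_pCons: "h 0 = 0 \<Longrightarrow> hom_poly h u (pCons a p) = h a + u * hom_poly h u p"
  by (simp add: hom_poly_def map_poly_pCons)

lemma hom_poly_add:
  assumes "\<And>a b. h (a + b) = h a + h b" and "h 0 = 0"
  shows "hom_poly h u (p + q) = hom_poly h u p + hom_poly h u q"
  by (simp add: hom_poly_def map_poly_additive[OF assms])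

lemma hom_poly_mult:
  assumes add: "\<And>a b. h (a + b) = h a + h b" and 0: "h 0 = 0" and mult: "\<And>a b. h (a * b) = h a * h b"
  shows "hom_poly h u (p * q) = hom_poly h u p * hom_poly h u q"
proof -
  have smult: "hom_poly h u (smult a q) = h a * hom_poly h u q" for a
    by (induction q) (simp_all add: hom_poly_pCons 0 mult algebra_simps, simp add: hom_poly_def)
  show ?thesis
  proof (induction p)
    case 0
    show ?case by (simp add: hom_poly_def)
  next
    case (pCons a p)
    then show ?case by (simp add: hom_poly_pCons 0 hom_poly_add[OF add 0] smult algebra_simps)
  qed
qed

definition ev :: "complex fps ^ 3 \<Rightarrow> cpoly3 \<Rightarrow> complex fps" where
  "ev g = hom_poly (hom_poly (hom_poly fps_const (g $ 3)) (g $ 2)) (g $ 1)"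

lemma ev_simps [simp]:
  "ev g (const3 c) = fps_const c" "ev g 0 = 0" "ev g 1 = 1"
  "ev g (A + B) = ev g A + ev g B" "ev g (A * B) = ev g A * ev g B"
  "ev g X = g $ 1" "ev g Y = g $ 2" "ev g Z = g $ 3"
proof -
  let ?h1 = "hom_poly fps_const (g $ 3)"
  let ?h2 = "hom_poly ?h1 (g $ 2)"
  have 0: "?h1 0 = 0" "?h2 0 = 0" by (simp_all add: hom_poly_def)
  have a1: "?h1 (a + b) = ?h1 a + ?h1 b" for a b
    by (rule hom_poly_add) simp_all
  have a2: "?h2 (a + b) = ?h2 a + ?h2 b" for a b
    by (intro hom_poly_add a1 0)
  have m1: "?h1 (a * b) = ?h1 a * ?h1 b" for a b
    by (rule hom_poly_mult) simp_all
  have m2: "?h2 (a * b) = ?h2 a * ?h2 b" for a b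
    by (intro hom_poly_mult a1 m1 0)
  show "ev g (A + B) = ev g A + ev g B"
    unfolding ev_def by (intro hom_poly_add a2 0)
  show "ev g (A * B) = ev g A * ev g B"
    unfolding ev_def by (intro hom_poly_mult a2 m2 0)
  have c: "hom_poly h u [:a:] = h a" if "h 0 = 0" for h :: "'x::comm_ring_1 \<Rightarrow> complex fps" and u a
    using that by (simp add: hom_poly_def map_poly_pCons)
  show "ev g (const3 c) = fps_const c" for c by (simp add: ev_def const3_def c 0)
  from this[of 0] this[of 1] show "ev g 0 = 0" "ev g 1 = 1" by simp_all
  show "ev g X = g $ 1" "ev g Y = g $ 2" "ev g Z = g $ 3"
    unfolding ev_def X_def Y_def Z_def
    by (simp_all add: hom_poly_pCons 0 c one_pCons) (simp_all add: hom_poly_def map_poly_pCons one_pCons)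
qed

lemma ev_uminus [simp]: "ev g (- A) = - ev g A"
  using ev_simps(4)[of g A "- A"] by (simp add: eq_neg_iff_add_eq_0 add.commute)

lemma ev_diff [simp]: "ev g (A - B) = ev g A - ev g B"
  by (simp only: diff_conv_add_uminus ev_simps ev_uminus)

lemma ev_power [simp]: "ev g (A ^ n) = ev g A ^ n"
  by (induction n) simp_all

lemma ev_of_nat [simp]: "ev g (of_nat n) = of_nat n"
  by (induction n) simp_all

lemma ev_numeral [simp]: "ev g (numeral n) = numeral n"
  using ev_of_nat[of g "numeral n"] by simp

lemma ev_sum: "ev g (sum f S) = (\<Sum>i\<in>S. ev g (f i))"
  by (induction S rule: infinite_finite_induct) simp_all

lemma ev_nth_0: "fps_nth (ev g A) 0 = eval3 A (fps_nth (g $ 1) 0, fps_nth (g $ 2) 0, fps_nth (g $ 3) 0)"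
  by (induction A rule: cpoly3_induct) simp_all

lemma ev_chain_rule:
  "fps_deriv (ev g A) = ev g (dx A) * fps_deriv (g $ 1) + ev g (dy A) * fps_deriv (g $ 2)
     + ev g (dz A) * fps_deriv (g $ 3)"
  by (induction A rule: cpoly3_induct) (simp_all add: algebra_simps)


section \<open>Mixed discriminants\<close>

text \<open>The polarisation of the determinant, a cubic form: symmetric and trilinear, with
  \<open>mdisc A A A = 6 * det A\<close>. Being built from determinants alone, it inherits their
  behaviour under congruence.\<close>

definition mdisc :: "'a::comm_ring_1^3^3 \<Rightarrow> 'a^3^3 \<Rightarrow> 'a^3^3 \<Rightarrow> 'a" where
  "mdisc A B C = det (A + B + C) - det (A + B) - det (B + C) - det (A + C) + det A + det B + det C"

lemma mdisc_congruence:
  assumes "det Q = 1"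
  shows "mdisc (Q ** A ** transpose Q) (Q ** B ** transpose Q) (Q ** C ** transpose Q) = mdisc A B C"
proof -
  have *: "det (Q ** M ** transpose Q) = det M" for M
    using assms by (simp add: det_mul)
  have "Q ** A ** transpose Q + Q ** B ** transpose Q = Q ** (A + B) ** transpose Q" for A B
    by (simp add: matrix_matrix_mult_def vec_eq_iff sum_3 algebra_simps)
  then show ?thesis
    unfolding mdisc_def by (simp only: *)
qed

text \<open>The letters are those of the second derivatives of \<open>F\<close>: \<open>f\<close>,
  \<open>g\<close>, \<open>h\<close> are the yz-, xz- and xy-entries.\<close>

definition symm :: "'a \<Rightarrow> 'a \<Rightarrow> 'a \<Rightarrow> 'a \<Rightarrow> 'a \<Rightarrow> 'a \<Rightarrow> 'a::comm_ring_1^3^3" where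
  "symm a b c f g h = vector [vector [a, h, g], vector [h, b, f], vector [g, f, c]]"

lemma det_symm: "det (symm a b c f g h) = a * b * c + 2 * f * g * h - a * f * f - b * g * g - c * h * h"
  by (simp add: det_3 symm_def algebra_simps)

lemma symm_add:
  "symm a1 b1 c1 f1 g1 h1 + symm a2 b2 c2 f2 g2 h2
     = symm (a1 + a2) (b1 + b2) (c1 + c2) (f1 + f2) (g1 + g2) (h1 + h2)"
  by (simp add: vec_eq_iff forall_3 symm_def)

lemma mdisc_symm:
  "mdisc (symm a1 b1 c1 f1 g1 h1) (symm a2 b2 c2 f2 g2 h2) (symm a3 b3 c3 f3 g3 h3) =
     (b1*c2 + c1*b2 - 2*f1*f2)*a3 + (a1*c2 + c1*a2 - 2*g1*g2)*b3 + (a1*b2 + b1*a2 - 2*h1*h2)*c3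
     + 2*(h1*g2 + g1*h2 - a1*f2 - f1*a2)*f3 + 2*(h1*f2 + f1*h2 - b1*g2 - g1*b2)*g3
     + 2*(f1*g2 + g1*f2 - h1*c2 - c1*h2)*h3"
  unfolding mdisc_def symm_add det_symm by (simp add: algebra_simps)

text \<open>The symmetric bilinear form of the matrix \<open>symm a b c f g h\<close>.\<close>

definition quad :: "'a::comm_ring_1 \<Rightarrow> 'a \<Rightarrow> 'a \<Rightarrow> 'a \<Rightarrow> 'a \<Rightarrow> 'a \<Rightarrow> 'a^3 \<Rightarrow> 'a^3 \<Rightarrow> 'a" where
  "quad a b c f g h u v = a * (u$1 * v$1) + b * (u$2 * v$2) + c * (u$3 * v$3)
     + f * (u$2 * v$3 + u$3 * v$2) + g * (u$1 * v$3 + u$3 * v$1) + h * (u$1 * v$2 + u$2 * v$1)"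

lemma symm_congruence:
  fixes u v w :: "'a::comm_ring_1^3"
  shows "vector [u, v, w] ** symm a b c f g h ** transpose (vector [u, v, w]) =
     symm (quad a b c f g h u u) (quad a b c f g h v v) (quad a b c f g h w w)
       (quad a b c f g h v w) (quad a b c f g h u w) (quad a b c f g h u v)"
  unfolding symm_def
  by (simp add: vec_eq_iff forall_3 matrix_matrix_mult_def sum_3 transpose_def quad_def algebra_simps)

text \<open>Lets contractions with the adjugate be computed from derivatives in the directions of a
  unimodular frame instead of coordinate derivatives.\<close>

lemma mdisc_frame:
  fixes u v w :: "'a::comm_ring_1^3"
  assumes "det (vector [u, v, w] :: 'a^3^3) = 1"
  shows "mdisc (symm a1 b1 c1 f1 g1 h1) (symm a2 b2 c2 f2 g2 h2) (symm a3 b3 c3 f3 g3 h3) =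
    (let q1 = quad a1 b1 c1 f1 g1 h1; q2 = quad a2 b2 c2 f2 g2 h2; q3 = quad a3 b3 c3 f3 g3 h3 in
     mdisc (symm (q1 u u) (q1 v v) (q1 w w) (q1 v w) (q1 u w) (q1 u v))
           (symm (q2 u u) (q2 v v) (q2 w w) (q2 v w) (q2 u w) (q2 u v))
           (symm (q3 u u) (q3 v v) (q3 w w) (q3 v w) (q3 u w) (q3 u v)))"
  using mdisc_congruence[OF assms, of "symm a1 b1 c1 f1 g1 h1" "symm a2 b2 c2 f2 g2 h2" "symm a3 b3 c3 f3 g3 h3"]
  by (simp add: symm_congruence Let_def)

text \<open>The counterpart for Jacobians: multiplying by the transposed frame, of determinant 1,
  pairs each row with the frame vectors.\<close>

lemma det_frame:
  fixes u v w :: "'a::comm_ring_1^3"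
  assumes "det (vector [u, v, w] :: 'a^3^3) = 1"
  shows "det (vector [vector [p1, p2, p3], vector [q1, q2, q3], vector [r1, r2, r3]] :: 'a^3^3) =
    (let dot = (\<lambda>x y z t. t$1 * x + t$2 * y + t$3 * z) in
     det (vector [vector [dot p1 p2 p3 u, dot p1 p2 p3 v, dot p1 p2 p3 w],
       vector [dot q1 q2 q3 u, dot q1 q2 q3 v, dot q1 q2 q3 w],
       vector [dot r1 r2 r3 u, dot r1 r2 r3 v, dot r1 r2 r3 w]] :: 'a^3^3))"
    (is "det ?R = _")
proof -
  have "det ?R = det (?R ** transpose (vector [u, v, w]))"
    by (simp add: det_mul assms)
  also have "?R ** transpose (vector [u, v, w] :: 'a^3^3) =
      (let dot = (\<lambda>x y z t. t$1 * x + t$2 * y + t$3 * z) in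
       vector [vector [dot p1 p2 p3 u, dot p1 p2 p3 v, dot p1 p2 p3 w],
       vector [dot q1 q2 q3 u, dot q1 q2 q3 v, dot q1 q2 q3 w],
       vector [dot r1 r2 r3 u, dot r1 r2 r3 v, dot r1 r2 r3 w]])"
    unfolding Let_def
    by (simp add: vec_eq_iff forall_3 matrix_matrix_mult_def sum_3 transpose_def mult.commute)
  finally show ?thesis by (simp add: Let_def)
qed


section \<open>Derivatives along a curve\<close>

text \<open>The derivative forms of \<open>G\<close> at the moving point \<open>g\<close>. The
  direction vectors may vary along the curve but are not themselves differentiated.\<close>

definition D1 :: "complex fps^3 \<Rightarrow> cpoly3 \<Rightarrow> complex fps^3 \<Rightarrow> complex fps" where
  "D1 g G u = u$1 * ev g (dx G) + u$2 * ev g (dy G) + u$3 * ev g (dz G)"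

definition D2 :: "complex fps^3 \<Rightarrow> cpoly3 \<Rightarrow> complex fps^3 \<Rightarrow> complex fps^3 \<Rightarrow> complex fps" where
  "D2 g G u v = v$1 * D1 g (dx G) u + v$2 * D1 g (dy G) u + v$3 * D1 g (dz G) u"

definition D3 :: "complex fps^3 \<Rightarrow> cpoly3 \<Rightarrow> complex fps^3 \<Rightarrow> complex fps^3 \<Rightarrow> complex fps^3 \<Rightarrow> complex fps"
  where "D3 g G u v w = w$1 * D2 g (dx G) u v + w$2 * D2 g (dy G) u v + w$3 * D2 g (dz G) u v"

definition deriv_vec :: "complex fps^3 \<Rightarrow> complex fps^3" where
  "deriv_vec u = (\<chi> i. fps_deriv (u $ i))"

lemma deriv_vec_nth [simp]: "deriv_vec u $ i = fps_deriv (u $ i)"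
  by (simp add: deriv_vec_def)

lemma D2_commute: "D2 g G u v = D2 g G v u"
  by (simp add: D2_def D1_def d_commute algebra_simps)

lemma D3_commute12: "D3 g G u v w = D3 g G v u w"
  unfolding D3_def by (simp only: D2_commute[of g _ u v])

lemma D3_commute23: "D3 g G u v w = D3 g G u w v"
  by (simp add: D3_def D2_def D1_def d_commute algebra_simps)

lemma D1_scale: "D1 g G (k *s u) = k * D1 g G u"
  by (simp add: D1_def algebra_simps)

lemma D2_scale: "D2 g G (k *s u) v = k * D2 g G u v"
  by (simp add: D2_def D1_scale algebra_simps)

lemma D_zero [simp]: "D1 g G 0 = 0" "D2 g G 0 v = 0" "D2 g G v 0 = 0"
  by (simp_all add: D2_def D1_def)

lemma D1_Euler: "form n G \<Longrightarrow> D1 g G g = of_nat n * ev g G"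
  using arg_cong[OF Euler, of n G "ev g"] by (simp add: D1_def)

lemma D2_Euler:
  assumes "form n G" shows "D2 g G g v = of_nat (n - 1) * D1 g G v"
  unfolding D2_def D1_Euler[OF form_partial(1)[OF assms]] D1_Euler[OF form_partial(2)[OF assms]]
    D1_Euler[OF form_partial(3)[OF assms]]
  by (simp add: D1_def algebra_simps)

lemma D3_Euler:
  assumes "form n G" shows "D3 g G g u v = of_nat (n - 2) * D2 g G u v"
  unfolding D3_def D2_Euler[OF form_partial(1)[OF assms]] D2_Euler[OF form_partial(2)[OF assms]]
    D2_Euler[OF form_partial(3)[OF assms]]
  by (simp add: D2_def numeral_2_eq_2 algebra_simps)

lemma deriv_ev: "fps_deriv (ev g G) = D1 g G (deriv_vec g)"
  by (simp add: ev_chain_rule D1_def)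

text \<open>Besides the variation of \<open>u\<close>, the motion of the base point adds a slot
  filled with \<open>deriv_vec g\<close>. Read backwards, this expresses forms with a tangent slot
  by derivatives of forms of lower order.\<close>

lemma deriv_D1: "fps_deriv (D1 g G u) = D1 g G (deriv_vec u) + D2 g G (deriv_vec g) u"
  by (simp add: D1_def D2_def ev_chain_rule algebra_simps)

lemma deriv_D2:
  "fps_deriv (D2 g G u v) = D2 g G (deriv_vec u) v + D2 g G u (deriv_vec v) + D3 g G (deriv_vec g) u v"
  by (simp add: D2_def D3_def deriv_D1 algebra_simps)

definition hess_matrix :: "complex fps^3 \<Rightarrow> cpoly3 \<Rightarrow> complex fps^3^3" where
  "hess_matrix g G = symm (ev g (dx (dx G))) (ev g (dy (dy G))) (ev g (dz (dz G)))
     (ev g (dz (dy G))) (ev g (dz (dx G))) (ev g (dy (dx G)))"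

text \<open>The derivative of the Hessian matrix in direction \<open>w\<close>.\<close>

definition third_matrix :: "complex fps^3 \<Rightarrow> cpoly3 \<Rightarrow> complex fps^3 \<Rightarrow> complex fps^3^3" where
  "third_matrix g G w = symm (D1 g (dx (dx G)) w) (D1 g (dy (dy G)) w) (D1 g (dz (dz G)) w)
     (D1 g (dz (dy G)) w) (D1 g (dz (dx G)) w) (D1 g (dy (dx G)) w)"

text \<open>The rank-one matrix formed by the products of the entries of the gradient.\<close>

definition square_matrix :: "complex fps^3 \<Rightarrow> cpoly3 \<Rightarrow> complex fps^3^3" where
  "square_matrix g G = symm ((ev g (dx G))\<^sup>2) ((ev g (dy G))\<^sup>2) ((ev g (dz G))\<^sup>2)
     (ev g (dy G) * ev g (dz G)) (ev g (dx G) * ev g (dz G)) (ev g (dx G) * ev g (dy G))"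

lemma hess_matrix_quad:
  "quad (ev g (dx (dx G))) (ev g (dy (dy G))) (ev g (dz (dz G)))
     (ev g (dz (dy G))) (ev g (dz (dx G))) (ev g (dy (dx G))) u v = D2 g G u v"
  by (simp add: quad_def D2_def D1_def d_commute algebra_simps)

lemma third_matrix_quad:
  "quad (D1 g (dx (dx G)) w) (D1 g (dy (dy G)) w) (D1 g (dz (dz G)) w)
     (D1 g (dz (dy G)) w) (D1 g (dz (dx G)) w) (D1 g (dy (dx G)) w) u v = D3 g G w u v"
  by (simp add: quad_def D3_def D2_def D1_def d_commute algebra_simps)

lemma square_matrix_quad:
  "quad ((ev g (dx G))\<^sup>2) ((ev g (dy G))\<^sup>2) ((ev g (dz G))\<^sup>2)
     (ev g (dy G) * ev g (dz G)) (ev g (dx G) * ev g (dz G)) (ev g (dx G) * ev g (dy G)) u v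
   = D1 g G u * D1 g G v"
  by (simp add: quad_def D1_def power2_eq_square algebra_simps)

lemma hessian_expand:
  "hessian F = dx (dx F) * dy (dy F) * dz (dz F) + 2 * dz (dy F) * dz (dx F) * dy (dx F)
     - dx (dx F) * dz (dy F) * dz (dy F) - dy (dy F) * dz (dx F) * dz (dx F)
     - dz (dz F) * dy (dx F) * dy (dx F)"
  by (simp add: hessian_def Hess_def det_3 d_commute algebra_simps)

lemma hessian_mdisc: "6 * ev g (hessian F) = mdisc (hess_matrix g F) (hess_matrix g F) (hess_matrix g F)"
  unfolding hessian_expand hess_matrix_def mdisc_symm by (simp add: algebra_simps)

text \<open>Differentiating \<open>6 * det\<close> hits three equal slots of \<open>mdisc\<close>;
  cancelling 3 leaves the factor 2.\<close>

lemma D1_hessian_mdisc: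
  "2 * D1 g (hessian F) w = mdisc (hess_matrix g F) (hess_matrix g F) (third_matrix g F w)"
  unfolding hessian_expand hess_matrix_def third_matrix_def mdisc_symm D1_def
  by (simp add: algebra_simps)

text \<open>By the product rule its partial derivatives split into the two displayed families,
  according to whether the adjugate or the second derivatives of the Hessian are
  differentiated.\<close>

definition Omega :: "cpoly3 \<Rightarrow> cpoly3" where
  "Omega F = (let H = hessian F in
     adjA F * dx (dx H) + adjB F * dy (dy H) + adjC F * dz (dz H)
     + 2 * adjF F * dz (dy H) + 2 * adjG F * dz (dx H) + 2 * adjH F * dy (dx H))"

lemma d_Omega:
  "dx (Omega F) = dOmega_H dx F + dOmega_F dx F"
  "dy (Omega F) = dOmega_H dy F + dOmega_F dy F"
  "dz (Omega F) = dOmega_H dz F + dOmega_F dz F"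
  by (simp_all add: Omega_def dOmega_H_def dOmega_F_def Let_def algebra_simps)

lemmas adj_defs = adjA_def adjB_def adjC_def adjF_def adjG_def adjH_def

lemma Omega_mdisc:
  "2 * ev g (Omega F) = mdisc (hess_matrix g F) (hess_matrix g F) (hess_matrix g (hessian F))"
  unfolding Omega_def Let_def hess_matrix_def mdisc_symm adj_defs
  by (simp add: power2_eq_square algebra_simps)

lemma Psi_mdisc:
  "2 * ev g (Psi F) = mdisc (hess_matrix g F) (hess_matrix g F) (square_matrix g (hessian F))"
  unfolding Psi_def Let_def hess_matrix_def square_matrix_def mdisc_symm adj_defs
  by (simp add: power2_eq_square algebra_simps)

text \<open>In \<open>2 * Omega\<close> only the two slots that hold the Hessian matrix of
  \<open>F\<close> are differentiated; by symmetry they contribute equally and the factor 2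
  cancels.\<close>

lemma dOmega_H_mdisc:
  "w$1 * ev g (dOmega_H dx F) + w$2 * ev g (dOmega_H dy F) + w$3 * ev g (dOmega_H dz F)
     = mdisc (hess_matrix g F) (third_matrix g F w) (hess_matrix g (hessian F))"
  unfolding dOmega_H_def Let_def hess_matrix_def third_matrix_def mdisc_symm adj_defs D1_def
  by (simp add: power2_eq_square algebra_simps)


section \<open>The 2-Hessian along a curve\<close>

lemma form_second_partials:
  assumes "form (n + 2) G"
  shows "form n (dx (dx G))" "form n (dy (dx G))" "form n (dz (dx G))"
    "form n (dy (dy G))" "form n (dz (dy G))" "form n (dz (dz G))"
  using form_partial[OF form_partial(1)[OF assms]] form_partial[OF form_partial(2)[OF assms]]
    form_partial[OF form_partial(3)[OF assms]] by simp_all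

lemma form_hessian:
  assumes "form (e + 3) F" shows "form (3 * e + 3) (hessian F)"
proof -
  have 2: "form (e + 1) (dx (dx F))" "form (e + 1) (dy (dx F))" "form (e + 1) (dz (dx F))"
    "form (e + 1) (dy (dy F))" "form (e + 1) (dz (dy F))" "form (e + 1) (dz (dz F))"
    using form_second_partials[of "e + 1" F] assms by (simp_all add: numeral_3_eq_3)
  have 3: "form (3 * e + 3) (A * B * C)" if "form (e + 1) A" "form (e + 1) B" "form (e + 1) C" for A B C
    by (rule form_mult[OF form_mult[OF that(1,2) refl] that(3)]) simp
  have n: "form (3 * e + 3) (2 * A * B * C)" if "form (e + 1) A" "form (e + 1) B" "form (e + 1) C" for A B C
    using form_add[OF 3[OF that] 3[OF that]] by (simp add: algebra_simps)
  show ?thesis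
    unfolding hessian_expand by (intro form_add form_diff 3 n 2)
qed

lemma form_numeral_mult: "form n A \<Longrightarrow> form n (numeral m * A)"
  using form_const3_mult[of n A "of_nat (numeral m)"] unfolding const3_of_nat by simp

lemma form_of_nat: "form 0 (of_nat m)"
  using form_const3[of "of_nat m"] by (simp add: const3_of_nat)

lemma form_numeral: "form 0 (numeral m)"
  using form_of_nat[of "numeral m"] by simp

lemma form_adj:
  assumes "form (e + 3) F"
  shows "form (2 * e + 2) (adjA F)" "form (2 * e + 2) (adjB F)" "form (2 * e + 2) (adjC F)"
    "form (2 * e + 2) (adjF F)" "form (2 * e + 2) (adjG F)" "form (2 * e + 2) (adjH F)"
proof -
  have F: "form (e + 1 + 2) F" using assms by (simp add: numeral_3_eq_3)
  have m: "form (2 * e + 2) (A * B)" if "form (e + 1) A" "form (e + 1) B" for A B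
    by (rule form_mult[OF that]) simp
  show "form (2 * e + 2) (adjA F)" "form (2 * e + 2) (adjB F)" "form (2 * e + 2) (adjC F)"
    "form (2 * e + 2) (adjF F)" "form (2 * e + 2) (adjG F)" "form (2 * e + 2) (adjH F)"
    unfolding adj_defs power2_eq_square
    by (intro form_diff m form_second_partials[OF F])+
qed

lemma form_contraction:
  assumes "form m A1" "form m A2" "form m A3" "form m A4" "form m A5" "form m A6"
    and "form n B1" "form n B2" "form n B3" "form n B4" "form n B5" "form n B6"
    and "k = m + n"
  shows "form k (A1 * B1 + A2 * B2 + A3 * B3 + 2 * A4 * B4 + 2 * A5 * B5 + 2 * A6 * B6)"
  using assms by (intro form_add form_mult[of m _ n _ k] form_numeral_mult)

lemma form_Omega:
  assumes "form (e + 3) F" shows "form (5 * e + 3) (Omega F)"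
proof -
  have H: "form (3 * e + 1 + 2) (hessian F)" using form_hessian[OF assms] by (simp add: eval_nat_numeral)
  show ?thesis
    unfolding Omega_def Let_def
    by (intro form_contraction[of "2 * e + 2" _ _ _ _ _ _ "3 * e + 1"] form_adj[OF assms] form_second_partials[OF H]) simp
qed

lemma form_Psi:
  assumes "form (e + 3) F" shows "form (8 * e + 6) (Psi F)"
proof -
  have H: "form (3 * e + 2) (dx (hessian F))" "form (3 * e + 2) (dy (hessian F))" "form (3 * e + 2) (dz (hessian F))"
    using form_partial[OF form_hessian[OF assms]] by simp_all
  have m: "form (6 * e + 4) (A * B)" if "form (3 * e + 2) A" "form (3 * e + 2) B" for A B
    by (rule form_mult[OF that]) simp
  show ?thesis
    unfolding Psi_def Let_def power2_eq_square mult.assoc[of "2 * _"]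
    by (intro form_contraction[of "2 * e + 2" _ _ _ _ _ _ "6 * e + 4"] form_adj[OF assms] m H) simp
qed

lemma form_dOmega:
  assumes "form (e + 3) F"
    and D: "\<And>n A. form n A \<Longrightarrow> form (n - 1) (D A)"
  shows "form (5 * e + 2) (dOmega_H D F)" "form (5 * e + 2) (dOmega_F D F)"
proof -
  have H: "form (3 * e + 1 + 2) (hessian F)" using form_hessian[OF assms(1)] by (simp add: eval_nat_numeral)
  have D1: "form (2 * e + 1) (D A)" if "form (2 * e + 2) A" for A
    using D[OF that] by simp
  have D2: "form (3 * e) (D A)" if "form (3 * e + 1) A" for A
    using D[OF that] by simp
  show "form (5 * e + 2) (dOmega_H D F)"
    unfolding dOmega_H_def Let_def
    by (intro form_contraction[of "2 * e + 1" _ _ _ _ _ _ "3 * e + 1"] D1 form_adj[OF assms(1)] form_second_partials[OF H]) simp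
  show "form (5 * e + 2) (dOmega_F D F)"
    unfolding dOmega_F_def Let_def
    by (intro form_contraction[of "2 * e + 2" _ _ _ _ _ _ "3 * e"] D2 form_adj[OF assms(1)] form_second_partials[OF H]) simp
qed

lemma form_det:
  assumes "form l a1" "form l a2" "form l a3" "form m b1" "form m b2" "form m b3"
    and "form n c1" "form n c2" "form n c3"
  shows "form (l + m + n) (det (vector [vector [a1, a2, a3], vector [b1, b2, b3], vector [c1, c2, c3]] :: cpoly3^3^3))"
  unfolding det_3 vector_3
  by (intro form_add form_diff form_mult[OF form_mult[OF _ _ refl] _ refl] assms)

lemma form_H2:
  assumes "form (e + 3) F" shows "form (12 * e + 9) (H2 (e + 3) F)"
proof -
  note H = form_hessian[OF assms]
  have F1: "form (e + 2) (dx F)" "form (e + 2) (dy F)" "form (e + 2) (dz F)"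
    using form_partial[OF assms] by simp_all
  have H1: "form (3 * e + 2) (dx (hessian F))" "form (3 * e + 2) (dy (hessian F))" "form (3 * e + 2) (dz (hessian F))"
    using form_partial[OF H] by simp_all
  have P1: "form (8 * e + 5) (dx (Psi F))" "form (8 * e + 5) (dy (Psi F))" "form (8 * e + 5) (dz (Psi F))"
    using form_partial[OF form_Psi[OF assms]] by (simp_all add: add.commute)
  note O1 = form_dOmega[where D = dx, OF assms form_partial(1)]
    form_dOmega[where D = dy, OF assms form_partial(2)] form_dOmega[where D = dz, OF assms form_partial(3)]
  have J: "form (9 * e + 6) (Jac_Omega_H F)" "form (9 * e + 6) (Jac_Omega_F F)" "form (12 * e + 9) (Jac_Psi F)"
    using form_det[OF F1 H1 O1(1,3,5)] form_det[OF F1 H1 O1(2,4,6)] form_det[OF F1 H1 P1]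
    by (simp_all add: Jac_Omega_H_def Jac_Omega_F_def Jac_Psi_def grad_def algebra_simps del: One_nat_def add_Suc_right)
  have c: "form (12 * e + 9) (c * hessian F * A)" if "form 0 c" "form (9 * e + 6) A" for c A
    by (rule form_mult[OF form_mult[OF that(1) H refl] that(2)]) simp
  have c': "form (12 * e + 9) (c * A)" if "form 0 c" "form (12 * e + 9) A" for c A
    by (rule form_mult[OF that]) simp
  have c0: "form 0 (c * A)" if "form 0 c" "form 0 A" for c A
    by (rule form_mult[OF that]) simp
  show ?thesis
    unfolding H2_def power2_eq_square
    by (intro form_diff form_add c c' J c0 form_of_nat form_numeral)
qed

text \<open>With \<open>u = y''\<close>, Monge's differential equation of plane conics. Where
  \<open>u\<close> is a unit, this is a unit times the third derivative of \<open>u\<close> to the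
  power -2/3.\<close>

definition Monge :: "complex fps \<Rightarrow> complex fps" where
  "Monge u = 9 * u\<^sup>2 * fps_deriv (fps_deriv (fps_deriv u))
     - 45 * u * fps_deriv u * fps_deriv (fps_deriv u) + 40 * fps_deriv u ^ 3"

section \<open>The moving frame along a branch and the value of \<open>H2\<close> in it\<close>

locale curve_frame =
  fixes F :: cpoly3 and e :: nat and g b c :: "complex fps^3" and y2 :: "complex fps"
  assumes form_F: "form (e + 3) F"
    and on_curve: "ev g F = 0"
    and deriv_g: "deriv_vec g = b"
    and deriv_b: "deriv_vec b = y2 *s c"
    and deriv_c: "deriv_vec c = 0"
    and det_1: "det (vector [g, b, c] :: complex fps^3^3) = 1"
begin

abbreviation "\<phi> \<equiv> D1 g F c"
abbreviation "\<mu> \<equiv> D2 g F c c"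
abbreviation "H \<equiv> hessian F"
abbreviation "h \<equiv> ev g H"
abbreviation "U \<equiv> D1 g H c"
abbreviation (input) D where "D \<equiv> fps_deriv"

text \<open>One less than the degree of \<open>F\<close>, as a constant series: the factors from
  Euler's identity become polynomials in \<open>k\<close> that \<open>algebra\<close> can
  treat.\<close>

definition k :: "complex fps" where "k = of_nat (e + 2)"

lemma deriv_k [simp]: "D k = 0"
  by (simp add: k_def)

lemma F1: "D1 g F g = 0" "D1 g F b = 0"
  using D1_Euler[OF form_F, of g] on_curve deriv_ev[of g F] deriv_g by simp_all

lemma F2: "D2 g F g v = k * D1 g F v" "D2 g F v g = k * D1 g F v"
  using D2_Euler[OF form_F] D2_commute by (simp_all add: k_def)

text \<open>Differentiate \<open>D1 g F b = 0\<close> along the branch, where \<open>b\<close>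
  changes by \<open>y2 *s c\<close>.\<close>

lemma F2_bb: "D2 g F b b = - (\<phi> * y2)"
  using deriv_D1[of g F b] by (simp add: F1 deriv_b deriv_g D1_scale eq_neg_iff_add_eq_0 mult.commute add.commute)

lemma F2_bc: "D2 g F b c = D \<phi>" "D2 g F c b = D \<phi>"
  using deriv_D1[of g F c] by (simp_all add: deriv_c deriv_g D2_commute[of g F c])

lemma F3: "D3 g F g u v = (k - 1) * D2 g F u v"
  using D3_Euler[OF form_F] by (simp add: k_def)

lemma F3': "D3 g F u g v = (k - 1) * D2 g F u v" "D3 g F u v g = (k - 1) * D2 g F u v"
  by (simp_all only: D3_commute23[of g F u v g] D3_commute12[of g F u g] F3)

lemma F3_bcc: "D3 g F b c c = D \<mu>"
  using deriv_D2[of g F c c] by (simp add: deriv_c deriv_g)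

lemma F3_bbc: "D3 g F b b c = D (D \<phi>) - y2 * \<mu>"
  using deriv_D2[of g F b c] by (simp add: F2_bc deriv_b deriv_c deriv_g D2_scale)

text \<open>In the derivative of \<open>D2 g F b b\<close> both slots move towards \<open>c\<close>,
  whence the last term.\<close>

lemma F3_bbb: "D3 g F b b b = - (D \<phi> * y2) - \<phi> * D y2 - 2 * y2 * D \<phi>"
  using deriv_D2[of g F b b] D2_commute[of g F b "y2 *s c"]
  by (simp add: F2_bb F2_bc deriv_b deriv_g D2_scale eq_neg_iff_add_eq_0 algebra_simps)

lemma F3_c: "D3 g F c b b = D (D \<phi>) - y2 * \<mu>" "D3 g F c b c = D \<mu>"
  by (simp_all only: D3_commute12[of g F c b] D3_commute23[of g F b c b] F3_bbc F3_bcc)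

lemmas F_frame = F1 F2 F2_bb F2_bc F3 F3' F3_bcc F3_bbc F3_bbb F3_c

text \<open>In the frame the first row of the Hessian matrix is \<open>(0, 0, k * \<phi>)\<close>,
  so its determinant is minus the square of \<open>k * \<phi>\<close> times
  \<open>D2 g F b b\<close>.\<close>

lemma hessian_curve: "h = k\<^sup>2 * \<phi> ^ 3 * y2"
proof -
  have "6 * h = 6 * (k\<^sup>2 * \<phi> ^ 3 * y2)"
    unfolding hessian_mdisc hess_matrix_def
    by (subst mdisc_frame[OF det_1], unfold Let_def hess_matrix_quad mdisc_symm, simp add: F_frame) algebra
  then show ?thesis by (simp only: mult_cancel_left numeral_neq_zero simp_thms)
qed

text \<open>The entry \<open>D3 g F c c c\<close> is multiplied by the minor of the slots
  \<open>g\<close>, \<open>b\<close>, which vanishes; \<open>\<mu>\<close> is the only new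
  unknown.\<close>

lemma hessian_transversal:
  "U = k * \<phi> * ((2 * k - 1) * \<mu> * \<phi> * y2 + (k - 1) * (D \<phi>)\<^sup>2 - k * \<phi> * D (D \<phi>))"
    (is "_ = ?r")
proof -
  have "2 * U = 2 * ?r"
    unfolding D1_hessian_mdisc hess_matrix_def third_matrix_def
    by (subst mdisc_frame[OF det_1], unfold Let_def hess_matrix_quad third_matrix_quad mdisc_symm,
        simp add: F_frame) algebra
  then show ?thesis by (simp only: mult_cancel_left numeral_neq_zero simp_thms)
qed

lemma H1: "D1 g H g = 3 * (k - 1) * h" "D1 g H b = D h"
  using D1_Euler[OF form_hessian[OF form_F], of g] deriv_ev[of g H] deriv_g
  by (simp_all add: k_def algebra_simps)

lemma H2_frame:
  "D2 g H g v = (3 * k - 4) * D1 g H v"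
  "D2 g H b b = D (D h) - y2 * U"
  "D2 g H b c = D U"
  using D2_Euler[OF form_hessian[OF form_F], of g v] deriv_D1[of g H b] deriv_D1[of g H c]
  by (simp_all add: k_def deriv_g deriv_b deriv_c H1 D1_scale algebra_simps)

lemmas H_frame = H1 H2_frame

text \<open>The entry \<open>D2 g H c c\<close> drops out, because its coefficient is the same
  vanishing minor.\<close>

lemma Omega_curve:
  "ev g (Omega F) = 3 * (k - 1) * (3 * k - 4) * h * (- (\<phi> * y2) * \<mu> - (D \<phi>)\<^sup>2)
     - k\<^sup>2 * \<phi>\<^sup>2 * (D (D h) - y2 * U) + 2 * k * \<phi>\<^sup>2 * y2 * (3 * k - 4) * U
     + 2 * k * \<phi> * D \<phi> * (3 * k - 4) * D h"
    (is "_ = ?r")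
proof -
  have "2 * ev g (Omega F) = 2 * ?r"
    unfolding Omega_mdisc hess_matrix_def
    by (subst mdisc_frame[OF det_1], unfold Let_def hess_matrix_quad mdisc_symm,
        simp add: F_frame H_frame) algebra
  then show ?thesis by (simp only: mult_cancel_left numeral_neq_zero simp_thms)
qed

lemma Psi_curve:
  "ev g (Psi F) = (3 * (k - 1) * h)\<^sup>2 * (- (\<phi> * y2) * \<mu> - (D \<phi>)\<^sup>2)
     - k\<^sup>2 * \<phi>\<^sup>2 * (D h)\<^sup>2 + 2 * k * \<phi>\<^sup>2 * y2 * (3 * (k - 1) * h) * U
     + 2 * k * \<phi> * D \<phi> * (3 * (k - 1) * h) * D h"
    (is "_ = ?r")
proof -
  have "2 * ev g (Psi F) = 2 * ?r"
    unfolding Psi_mdisc hess_matrix_def square_matrix_def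
    by (subst mdisc_frame[OF det_1], unfold Let_def hess_matrix_quad square_matrix_quad mdisc_symm,
        simp add: F_frame H_frame) algebra
  then show ?thesis by (simp only: mult_cancel_left numeral_neq_zero simp_thms)
qed

text \<open>By Euler's identity for the second partials of \<open>F\<close>, the matrix
  \<open>third_matrix g F g\<close> is \<open>k - 1\<close> times the Hessian matrix.\<close>

lemma dOmega_H_g:
  "g$1 * ev g (dOmega_H dx F) + g$2 * ev g (dOmega_H dy F) + g$3 * ev g (dOmega_H dz F)
    = 2 * (k - 1) * ev g (Omega F)"
  (is "?l = ?r")
proof -
  have F: "form (e + 1 + 2) F" using form_F by (simp add: numeral_3_eq_3)
  have E: "D1 g G g = (k - 1) * ev g G" if "form (e + 1) G" for G
    using D1_Euler[OF that] by (simp add: k_def)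
  have "?l = (k - 1) * (2 * ev g (Omega F))"
    unfolding dOmega_H_mdisc Omega_mdisc hess_matrix_def third_matrix_def mdisc_symm form_second_partials[OF F, THEN E]
    by algebra
  then show ?thesis by (simp only: ac_simps)
qed

definition "\<Omega>\<^sub>H = b$1 * ev g (dOmega_H dx F) + b$2 * ev g (dOmega_H dy F) + b$3 * ev g (dOmega_H dz F)"

text \<open>The one contraction that neither Euler's identity nor differentiation along the branch
  provides. \<open>L\<close> is the value of \<open>D3 g F b b b\<close>.\<close>

lemma dOmega_H_b:
  fixes L :: "complex fps"
  defines "L \<equiv> - (D \<phi> * y2) - \<phi> * D y2 - 2 * y2 * D \<phi>"
  shows "\<Omega>\<^sub>H = (- (\<phi> * y2) * D \<mu> + \<mu> * L - 2 * D \<phi> * (D (D \<phi>) - y2 * \<mu>)) * (3 * (k - 1) * (3 * k - 4) * h)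
    - 2 * k * (k - 1) * \<phi> * D \<phi> * (D (D h) - y2 * U)
    - 2 * k * (k - 1) * \<phi>\<^sup>2 * y2 * D U
    - 2 * k * \<phi> * L * (3 * k - 4) * U
    + 2 * ((k - 1) * (D \<phi>)\<^sup>2 + k * \<phi> * (D (D \<phi>) - y2 * \<mu>) + (k - 1) * \<mu> * \<phi> * y2) * (3 * k - 4) * D h"
  unfolding \<Omega>\<^sub>H_def dOmega_H_mdisc hess_matrix_def third_matrix_def L_def
  by (subst mdisc_frame[OF det_1], unfold Let_def hess_matrix_quad third_matrix_quad mdisc_symm,
      simp only: F_frame H_frame) algebra

text \<open>Paired with the frame, the gradient of \<open>F\<close> becomes
  \<open>(0, 0, \<phi>)\<close>, so the contraction of the last row with \<open>c\<close>
  disappears.\<close>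

lemma Jac_frame:
  "det (vector [vector [ev g (dx F), ev g (dy F), ev g (dz F)],
      vector [ev g (dx H), ev g (dy H), ev g (dz H)], vector [v1, v2, v3]] :: complex fps^3^3)
    = \<phi> * (3 * (k - 1) * h * (b$1 * v1 + b$2 * v2 + b$3 * v3) - D h * (g$1 * v1 + g$2 * v2 + g$3 * v3))"
  by (subst det_frame[OF det_1], unfold Let_def D1_def[symmetric] det_3 vector_3 F1 H1) algebra

lemma Jac_Omega_H_curve: "ev g (Jac_Omega_H F) = \<phi> * (3 * (k - 1) * h * \<Omega>\<^sub>H - D h * (2 * (k - 1) * ev g (Omega F)))"
  using Jac_frame[of "ev g (dOmega_H dx F)" "ev g (dOmega_H dy F)" "ev g (dOmega_H dz F)"]
  by (simp add: Jac_Omega_H_def grad_def det_3 dOmega_H_g \<Omega>\<^sub>H_def)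

text \<open>Subtract the part \<open>dOmega_H\<close> from the gradient of \<open>Omega\<close>, a
  form of degree \<open>5 * k - 7\<close>: Euler's identity gives the first contraction,
  differentiation along the branch the second.\<close>

lemma dOmega_F_curve:
  "g$1 * ev g (dOmega_F dx F) + g$2 * ev g (dOmega_F dy F) + g$3 * ev g (dOmega_F dz F)
    = (3 * k - 5) * ev g (Omega F)"
  "b$1 * ev g (dOmega_F dx F) + b$2 * ev g (dOmega_F dy F) + b$3 * ev g (dOmega_F dz F)
    = D (ev g (Omega F)) - \<Omega>\<^sub>H"
proof -
  let ?gF = "g$1 * ev g (dOmega_F dx F) + g$2 * ev g (dOmega_F dy F) + g$3 * ev g (dOmega_F dz F)"
  let ?gH = "g$1 * ev g (dOmega_H dx F) + g$2 * ev g (dOmega_H dy F) + g$3 * ev g (dOmega_H dz F)"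
  have "?gF + ?gH = D1 g (Omega F) g"
    by (simp add: D1_def d_Omega algebra_simps)
  also have "\<dots> = (5 * k - 7) * ev g (Omega F)"
    using D1_Euler[OF form_Omega[OF form_F], of g] by (simp add: k_def)
  finally have "?gF = (5 * k - 7) * ev g (Omega F) - ?gH"
    by (simp add: eq_diff_eq)
  also have "\<dots> = (3 * k - 5) * ev g (Omega F)"
    unfolding dOmega_H_g by (simp add: algebra_simps)
  finally show "?gF = (3 * k - 5) * ev g (Omega F)" .
  show "b$1 * ev g (dOmega_F dx F) + b$2 * ev g (dOmega_F dy F) + b$3 * ev g (dOmega_F dz F)
      = D (ev g (Omega F)) - \<Omega>\<^sub>H"
    using deriv_ev[of g "Omega F"]
    by (simp add: D1_def d_Omega deriv_g \<Omega>\<^sub>H_def algebra_simps)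
qed

lemma Jac_Omega_F_curve:
  "ev g (Jac_Omega_F F) =
    \<phi> * (3 * (k - 1) * h * (D (ev g (Omega F)) - \<Omega>\<^sub>H) - D h * ((3 * k - 5) * ev g (Omega F)))"
  using Jac_frame[of "ev g (dOmega_F dx F)" "ev g (dOmega_F dy F)" "ev g (dOmega_F dz F)"]
  by (simp add: Jac_Omega_F_def grad_def det_3 dOmega_F_curve)

lemma Jac_Psi_curve:
  "ev g (Jac_Psi F) = \<phi> * (3 * (k - 1) * h * D (ev g (Psi F)) - D h * ((8 * k - 10) * ev g (Psi F)))"
proof -
  have "g$1 * ev g (dx (Psi F)) + g$2 * ev g (dy (Psi F)) + g$3 * ev g (dz (Psi F)) = (8 * k - 10) * ev g (Psi F)"
    "b$1 * ev g (dx (Psi F)) + b$2 * ev g (dy (Psi F)) + b$3 * ev g (dz (Psi F)) = D (ev g (Psi F))"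
    using D1_Euler[OF form_Psi[OF form_F], of g] deriv_ev[of g "Psi F"]
    by (simp_all add: D1_def deriv_g k_def algebra_simps)
  then show ?thesis
    using Jac_frame[of "ev g (dx (Psi F))" "ev g (dy (Psi F))" "ev g (dz (Psi F))"]
    by (simp add: Jac_Psi_def grad_def det_3)
qed

lemma H2_curve: "ev g (H2 (e + 3) F) = - (k ^ 8 * (k - 1)\<^sup>2 * (4 * k - 5) * \<phi> ^ 12 * Monge y2)"
proof -
  \<comment> \<open>The coefficients of \<open>H2\<close> rewritten by
    \<open>d = k + 1\<close>.\<close>
  have H2: "ev g (H2 (e + 3) F) = (12 * k\<^sup>2 - 30 * k + 15) * h * ev g (Jac_Omega_H F)
     + (k - 1) * (12 * k - 15) * h * ev g (Jac_Omega_F F) - 20 * (k - 1)\<^sup>2 * ev g (Jac_Psi F)"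
    by (simp add: H2_def k_def power2_eq_square algebra_simps)
  show ?thesis
    \<comment> \<open>What remains is a polynomial identity in \<open>k\<close>,
      \<open>\<phi>\<close>, \<open>\<mu>\<close>, \<open>y2\<close> and their derivatives. The
      derivatives of \<open>\<phi>\<close> cancel along with \<open>\<mu>\<close>.\<close>
    unfolding H2 Jac_Omega_H_curve Jac_Omega_F_curve Jac_Psi_curve dOmega_H_b Omega_curve Psi_curve
      hessian_curve hessian_transversal Monge_def
    by (simp add: power2_eq_square power3_eq_cube) algebra
qed

end


section \<open>Intersection multiplicities along a branch\<close>

lemma fps_X_power_dvd_iff: "fps_X ^ k dvd f \<longleftrightarrow> (\<forall>i<k. fps_nth f i = 0)"
  for f :: "'a::comm_ring_1 fps"
proof
  assume "fps_X ^ k dvd f"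
  then show "\<forall>i<k. fps_nth f i = 0"
    by (auto simp: dvd_def fps_X_power_mult_nth)
next
  assume "\<forall>i<k. fps_nth f i = 0"
  then have "f = fps_X ^ k * fps_shift k f"
    by (intro fps_ext) (simp add: fps_X_power_mult_nth)
  then show "fps_X ^ k dvd f" by (metis dvd_triv_left)
qed

lemma fps_X_power_dvd_unit_mult:
  fixes f u :: "'a::field fps"
  assumes "fps_nth u 0 \<noteq> 0" "fps_X ^ k dvd u * f"
  shows "fps_X ^ k dvd f"
proof -
  have "f = inverse u * (u * f)"
    using inverse_mult_eq_1[OF assms(1)] by (simp add: mult.assoc[symmetric])
  then show ?thesis using assms(2) by (metis dvd_mult)
qed

text \<open>Gaussian elimination, one equation at a time: an element with nonzero last coordinate
  serves as pivot and is removed, which costs one unknown for one equation.\<close>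

lemma linear_dependence:
  fixes s :: "'b \<Rightarrow> nat \<Rightarrow> 'a::field"
  assumes "finite B" "k < card B"
  shows "\<exists>c. (\<exists>b\<in>B. c b \<noteq> 0) \<and> (\<forall>i<k. (\<Sum>b\<in>B. c b * s b i) = 0)"
  using assms
proof (induction k arbitrary: B s)
  case 0
  then have "B \<noteq> {}" by auto
  then show ?case by (intro exI[of _ "\<lambda>_. 1"]) auto
next
  case (Suc k)
  show ?case
  proof (cases "\<forall>b\<in>B. s b k = 0")
    case True
    obtain c where "\<exists>b\<in>B. c b \<noteq> 0" "\<forall>i<k. (\<Sum>b\<in>B. c b * s b i) = 0"
      using Suc.IH[of B s] Suc.prems by auto
    then show ?thesis using True by (intro exI[of _ c]) (auto simp: less_Suc_eq)
  next
    case False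
    then obtain b0 where b0: "b0 \<in> B" "s b0 k \<noteq> 0" by blast
    define s' where "s' b i = s b i - s b k / s b0 k * s b0 i" for b i
    have "k < card (B - {b0})" using Suc.prems b0 by simp
    then obtain c where c: "\<exists>b\<in>B - {b0}. c b \<noteq> 0" "\<forall>i<k. (\<Sum>b\<in>B - {b0}. c b * s' b i) = 0"
      using Suc.IH[of "B - {b0}" s'] Suc.prems(1) by blast
    \<comment> \<open>The coefficient of the pivot collects the multiples of it that were subtracted
      from the other vectors.\<close>
    define c' where "c' = c(b0 := - (\<Sum>b\<in>B - {b0}. c b * (s b k / s b0 k)))"
    have "(\<Sum>b\<in>B. c' b * s b i) = (\<Sum>b\<in>B - {b0}. c b * s' b i)" for i
    proof -
      have "(\<Sum>b\<in>B. c' b * s b i) = c' b0 * s b0 i + (\<Sum>b\<in>B - {b0}. c b * s b i)"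
        using Suc.prems(1) b0(1) by (simp add: sum.remove c'_def)
      also have "\<dots> = (\<Sum>b\<in>B - {b0}. c b * s' b i)"
        by (simp add: c'_def s'_def right_diff_distrib sum_subtractf sum_distrib_right mult.assoc)
      finally show ?thesis .
    qed
    moreover have "s' b k = 0" for b using b0 by (simp add: s'_def)
    ultimately have "\<forall>i<Suc k. (\<Sum>b\<in>B. c' b * s b i) = 0"
      using c(2) by (auto simp: less_Suc_eq)
    moreover have "\<exists>b\<in>B. c' b \<noteq> 0" using c(1) by (auto simp: c'_def)
    ultimately show ?thesis by blast
  qed
qed

section \<open>Coordinates adapted to a point and arcs through it\<close>

definition const_vec :: "complex^3 \<Rightarrow> complex fps^3" where
  "const_vec u = (\<chi> i. fps_const (u $ i))"

lemma const_vec_nth [simp]: "const_vec u $ i = fps_const (u $ i)"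
  by (simp add: const_vec_def)

definition lin :: "complex \<Rightarrow> complex \<Rightarrow> complex \<Rightarrow> cpoly3" where
  "lin u v w = const3 u * X + const3 v * Y + const3 w * Z"

lemma form_lin: "form 1 (lin u v w)"
  unfolding lin_def by (intro form_add form_const3_mult form_vars)

locale frame =
  fixes a b c :: "complex^3"
  assumes det_abc: "det (vector [a, b, c] :: complex^3^3) = 1"
begin

text \<open>The dual basis of \<open>a\<close>, \<open>b\<close>, \<open>c\<close>: by Cramer's rule
  and determinant 1 the coefficients are cross products of two basis vectors.\<close>

definition "l0 = lin (b$2 * c$3 - b$3 * c$2) (b$3 * c$1 - b$1 * c$3) (b$1 * c$2 - b$2 * c$1)"
definition "l1 = lin (c$2 * a$3 - c$3 * a$2) (c$3 * a$1 - c$1 * a$3) (c$1 * a$2 - c$2 * a$1)"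
definition "l2 = lin (a$2 * b$3 - a$3 * b$2) (a$3 * b$1 - a$1 * b$3) (a$1 * b$2 - a$2 * b$1)"

lemmas l_defs = l0_def l1_def l2_def

text \<open>A graph in the chart \<open>l0 = 1\<close>, with \<open>l1\<close> as parameter and
  \<open>l2\<close> given by \<open>y\<close>.\<close>

definition arc :: "complex fps \<Rightarrow> complex fps^3" where
  "arc y = const_vec a + fps_X *s const_vec b + y *s const_vec c"

definition p :: coords where "p = (a$1, a$2, a$3)"

lemma det_expand: "a$1 * (b$2 * c$3 - b$3 * c$2) + a$2 * (b$3 * c$1 - b$1 * c$3) + a$3 * (b$1 * c$2 - b$2 * c$1) = 1"
  using det_abc unfolding det_3 by (simp add: algebra_simps)

lemma form_l: "form 1 l0" "form 1 l1" "form 1 l2"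
  unfolding l_defs by (intro form_lin)+

lemma const3_lin: "const3 k * lin u v w = lin (k * u) (k * v) (k * w)"
  by (simp add: lin_def algebra_simps)

lemma lin_add: "lin u v w + lin u' v' w' = lin (u + u') (v + v') (w + w')"
  by (simp add: lin_def algebra_simps)

lemma span_l:
  "X = const3 (a$1) * l0 + const3 (b$1) * l1 + const3 (c$1) * l2"
  "Y = const3 (a$2) * l0 + const3 (b$2) * l1 + const3 (c$2) * l2"
  "Z = const3 (a$3) * l0 + const3 (b$3) * l1 + const3 (c$3) * l2"
proof -
  have v: "X = lin 1 0 0" "Y = lin 0 1 0" "Z = lin 0 0 1" by (simp_all add: lin_def)
  show "X = const3 (a$1) * l0 + const3 (b$1) * l1 + const3 (c$1) * l2"
    "Y = const3 (a$2) * l0 + const3 (b$2) * l1 + const3 (c$2) * l2"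
    "Z = const3 (a$3) * l0 + const3 (b$3) * l1 + const3 (c$3) * l2"
    unfolding v l_defs const3_lin lin_add
    using det_expand by (intro arg_cong3[where f = lin]; simp add: algebra_simps)+
qed

lemma ev_lin: "ev (arc y) (lin u v w) =
   fps_const (u * a$1 + v * a$2 + w * a$3) + fps_X * fps_const (u * b$1 + v * b$2 + w * b$3)
   + y * fps_const (u * c$1 + v * c$2 + w * c$3)"
  by (simp add: lin_def arc_def algebra_simps flip: fps_const_add fps_const_mult)

lemma ev_l: "ev (arc y) l0 = 1" "ev (arc y) l1 = fps_X" "ev (arc y) l2 = y"
proof -
  note [simp del] = fps_const_add fps_const_sub fps_const_mult
  have 0: "u = 0 \<Longrightarrow> fps_const u = 0" and 1: "u = 1 \<Longrightarrow> fps_const u = 1" for u :: complex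
    by simp_all
  show "ev (arc y) l0 = 1" "ev (arc y) l1 = fps_X" "ev (arc y) l2 = y"
    unfolding l_defs ev_lin using det_expand
    by (subst 1, simp add: algebra_simps, subst 0, simp add: algebra_simps, subst 0, simp add: algebra_simps, simp,
        subst 0, simp add: algebra_simps, subst 1, simp add: algebra_simps, subst 0, simp add: algebra_simps, simp,
        subst 0, simp add: algebra_simps, subst 0, simp add: algebra_simps, subst 1, simp add: algebra_simps, simp)
qed

lemma eval3_p: "fps_nth y 0 = 0 \<Longrightarrow> eval3 G p = fps_nth (ev (arc y) G) 0"
  by (simp add: ev_nth_0 p_def arc_def)

lemma l_p [simp]: "eval3 l0 p = 1" "eval3 l1 p = 0" "eval3 l2 p = 0"
  by (simp_all add: eval3_p[of 0] ev_l)

lemma frame_decompose: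
  assumes "form (Suc n) G"
  obtains A B C where "form n A" "form n B" "form n C" "G = l0 * A + l1 * B + l2 * C"
proof -
  obtain G1 G2 G3 where G: "form n G1" "form n G2" "form n G3" "G = X * G1 + Y * G2 + Z * G3"
    using form_Suc_decompose[OF assms] .
  show ?thesis
  proof
    show "form n (const3 (a$1) * G1 + const3 (a$2) * G2 + const3 (a$3) * G3)"
      "form n (const3 (b$1) * G1 + const3 (b$2) * G2 + const3 (b$3) * G3)"
      "form n (const3 (c$1) * G1 + const3 (c$2) * G2 + const3 (c$3) * G3)"
      using G by (simp_all add: form_add form_const3_mult)
    show "G = l0 * (const3 (a$1) * G1 + const3 (a$2) * G2 + const3 (a$3) * G3)
      + l1 * (const3 (b$1) * G1 + const3 (b$2) * G2 + const3 (b$3) * G3)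
      + l2 * (const3 (c$1) * G1 + const3 (c$2) * G2 + const3 (c$3) * G3)"
      proof -
      have "G = (const3 (a$1) * l0 + const3 (b$1) * l1 + const3 (c$1) * l2) * G1
        + (const3 (a$2) * l0 + const3 (b$2) * l1 + const3 (c$2) * l2) * G2
        + (const3 (a$3) * l0 + const3 (b$3) * l1 + const3 (c$3) * l2) * G3"
        unfolding G(4) span_l[symmetric] ..
      then show ?thesis by (simp add: algebra_simps)
    qed
  qed
qed

lemma form_l_mult:
  "form n A \<Longrightarrow> form (Suc n) (l0 * A)" "form n A \<Longrightarrow> form (Suc n) (l1 * A)"
  "form n A \<Longrightarrow> form (Suc n) (l2 * A)"
  using form_l by (auto intro: form_mult)

text \<open>The forms \<open>l1\<close> and \<open>l2\<close> generate the ideal of the point, and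
  \<open>l0\<close> has value 1 there; so modulo that ideal a form is its value times a power of
  \<open>l0\<close>.\<close>

lemma point_decompose:
  assumes "form (Suc n) G"
  obtains A B where "form n A" "form n B" "G = const3 (eval3 G p) * l0 ^ Suc n + l1 * A + l2 * B"
proof -
  have "\<exists>A B c. form n A \<and> form n B \<and> G = const3 c * l0 ^ Suc n + l1 * A + l2 * B"
    using assms
  proof (induction n arbitrary: G)
    case 0
    obtain A B C where ABC: "form 0 A" "form 0 B" "form 0 C" "G = l0 * A + l1 * B + l2 * C"
      using frame_decompose[OF 0] .
    obtain c where "A = const3 c" using form_0_obtain_const[OF ABC(1)] .
    then have "G = const3 c * l0 ^ Suc 0 + l1 * B + l2 * C" using ABC(4) by simp
    with ABC(2,3) show ?case by (intro exI conjI)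
  next
    case (Suc n)
    obtain A B C where ABC: "form (Suc n) A" "form (Suc n) B" "form (Suc n) C" "G = l0 * A + l1 * B + l2 * C"
      using frame_decompose[OF Suc.prems] .
    obtain A' B' c where A: "form n A'" "form n B'" "A = const3 c * l0 ^ Suc n + l1 * A' + l2 * B'"
      using Suc.IH[OF ABC(1)] by blast
    have "form (Suc n) (l0 * A' + B)" "form (Suc n) (l0 * B' + C)"
      using ABC A by (simp_all add: form_add form_l_mult)
    moreover have "G = const3 c * l0 ^ Suc (Suc n) + l1 * (l0 * A' + B) + l2 * (l0 * B' + C)"
      unfolding ABC(4) A(3) by (simp add: algebra_simps)
    then show ?case using \<open>form (Suc n) (l0 * A' + B)\<close> \<open>form (Suc n) (l0 * B' + C)\<close> by (intro exI conjI)
  qed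
  then obtain A B c where AB: "form n A" "form n B" and G: "G = const3 c * l0 ^ Suc n + l1 * A + l2 * B"
    by (elim exE conjE)
  have "eval3 G p = c" by (simp add: G)
  with G have "G = const3 (eval3 G p) * l0 ^ Suc n + l1 * A + l2 * B" by (simp only:)
  with AB show ?thesis by (rule that)
qed

end

section \<open>The local ring along a branch of the curve\<close>

locale branch = frame +
  fixes F :: cpoly3 and m :: nat and y :: "complex fps"
  assumes form_F: "form (Suc m) F"
    and y_0: "fps_nth y 0 = 0"
    and on_curve: "ev (arc y) F = 0"
    and transversal: "c$1 * eval3 (dx F) p + c$2 * eval3 (dy F) p + c$3 * eval3 (dz F) p \<noteq> 0"
begin

abbreviation g :: "complex fps^3" where "g \<equiv> arc y"

lemmas eval3_p' = eval3_p[OF y_0]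

text \<open>The \<open>l0\<close>-power is absent because \<open>F\<close> vanishes at
  \<open>p\<close>. In direction \<open>c\<close> the derivative of \<open>l1\<close> is 0 and that
  of \<open>l2\<close> is 1, so the value of \<open>F2\<close> at \<open>p\<close> is the
  transversal derivative of \<open>F\<close>.\<close>

lemma F_l:
  obtains F1 F2 where "F = l1 * F1 + l2 * F2" "form m F1" "form m F2" "eval3 F2 p \<noteq> 0"
proof -
  obtain F1 F2 where F: "form m F1" "form m F2" "F = const3 (eval3 F p) * l0 ^ Suc m + l1 * F1 + l2 * F2"
    using point_decompose[OF form_F] .
  then have F': "F = l1 * F1 + l2 * F2" using on_curve by (simp add: eval3_p')
  have "c$1 * eval3 (dx F) p + c$2 * eval3 (dy F) p + c$3 * eval3 (dz F) p
     = (c$1 * eval3 (dx l1) p + c$2 * eval3 (dy l1) p + c$3 * eval3 (dz l1) p) * eval3 F1 p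
       + (c$1 * eval3 (dx l2) p + c$2 * eval3 (dy l2) p + c$3 * eval3 (dz l2) p) * eval3 F2 p"
    unfolding F' by (simp add: algebra_simps)
  also have "c$1 * eval3 (dx l1) p + c$2 * eval3 (dy l1) p + c$3 * eval3 (dz l1) p = 0"
    by (simp add: l1_def lin_def algebra_simps)
  finally have "eval3 F2 p \<noteq> 0" using transversal by auto
  then show ?thesis using that F F' by blast
qed

text \<open>Since \<open>F2\<close> is a unit at \<open>p\<close>, the relation \<open>F = l1 F1 + l2 F2\<close> eliminates \<open>l2\<close>: the local ring
  of the curve is a discrete valuation ring with uniformizer \<open>l1 / l0\<close>.\<close>

lemma uniformizer_power:
  assumes "form n A" "fps_X ^ k dvd ev g A"
  shows "\<exists>S B C s j. form s S \<and> eval3 S p \<noteq> 0 \<and> form j B \<and> j + k = s + n \<and> form (s + n) (F * C)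
    \<and> S * A = l1 ^ k * B + F * C"
proof -
  obtain F1 F2 where F_l: "F = l1 * F1 + l2 * F2" "form m F1" "form m F2" "eval3 F2 p \<noteq> 0"
    by (rule F_l)
  show ?thesis
    using assms(2)
  proof (induction k)
    case 0
    then show ?case
      using assms(1) by (intro exI[of _ 1] exI[of _ A] exI[of _ 0] exI[of _ n]) (simp add: form_1)
  next
    case (Suc k)
    then have "fps_X ^ k dvd ev g A" by (meson dvd_trans le_imp_power_dvd le_SucI order_refl)
    then obtain S B C s j where IH: "form s S" "eval3 S p \<noteq> 0" "form j B" "j + k = s + n"
        "form (s + n) (F * C)" "S * A = l1 ^ k * B + F * C"
      using Suc.IH by blast
    have "ev g S * ev g A = fps_X ^ k * ev g B"
      using arg_cong[OF IH(6), of "ev g"] by (simp add: ev_l on_curve)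
    then have "fps_X ^ k * fps_X dvd fps_X ^ k * ev g B"
      using Suc.prems by (metis dvd_mult power_Suc2)
    then have "fps_X dvd ev g B" by simp
    then have "fps_nth (ev g B) 0 = 0" by auto
    \<comment> \<open>\<open>B\<close> may have degree 0; the factor \<open>l0\<close>, a unit at
      \<open>p\<close>, makes the degree positive, as \<open>point_decompose\<close>
      requires.\<close>
    then have B0: "eval3 (l0 * B) p = 0" by (simp add: eval3_p')
    have "form (Suc j) (l0 * B)" using IH(3) by (rule form_l_mult)
    then obtain A1 A2 where A12: "form j A1" "form j A2" "l0 * B = l1 * A1 + l2 * A2"
      using point_decompose[of j "l0 * B"] B0 by (metis add_0 const3_simps(1) mult_zero_left)
    \<comment> \<open>Multiply \<open>l0 * B = l1 * A1 + l2 * A2\<close> by \<open>F2\<close> and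
      replace \<open>l2 * F2\<close> by \<open>F - l1 * F1\<close>: a further factor
      \<open>l1\<close> splits off modulo \<open>F\<close>.\<close>
    define B' where "B' = F2 * A1 - F1 * A2"
    define C' where "C' = l1 ^ k * A2 + F2 * l0 * C"
    have "F2 * l0 * S * A = F2 * l0 * (l1 ^ k * B + F * C)" by (simp add: IH(6)[symmetric] mult.assoc)
    also have "\<dots> = l1 ^ k * F2 * (l0 * B) + F2 * l0 * F * C" by (simp add: algebra_simps)
    also have "\<dots> = l1 ^ Suc k * B' + F * C'"
    proof -
      have "l1 ^ k * F2 * (l0 * B) = l1 ^ Suc k * F2 * A1 + l1 ^ k * A2 * (l2 * F2)"
        unfolding A12(3) by (simp add: algebra_simps)
      also have "l2 * F2 = F - l1 * F1" using F_l(1) by (metis add_diff_cancel_left')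
      finally show ?thesis by (simp add: B'_def C'_def algebra_simps)
    qed
    finally have eq: "F2 * l0 * S * A = l1 ^ Suc k * B' + F * C'" .
    have S': "form (m + 1 + s) (F2 * l0 * S)"
      by (rule form_mult[OF form_mult[OF F_l(3) form_l(1) refl] IH(1) refl])
    have B': "form (m + j) B'"
      unfolding B'_def by (intro form_diff form_mult[OF F_l(3) A12(1) refl] form_mult[OF F_l(2) A12(2) refl])
    have "form (m + 1 + s + n) (l1 ^ Suc k * B')"
      using form_mult[OF form_power[OF form_l(2), of "Suc k" "Suc k"] B', of "m + 1 + s + n"] IH(4) by simp
    moreover have "form (m + 1 + s + n) (F2 * l0 * S * A)"
      by (rule form_mult[OF S' assms(1) refl])
    ultimately have "form (m + 1 + s + n) (F * C')"
      using form_diff[of "m + 1 + s + n" "F2 * l0 * S * A" "l1 ^ Suc k * B'"] eq by simp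
    moreover have "eval3 (F2 * l0 * S) p \<noteq> 0" using IH(2) F_l(4) by (simp add: l_p)
    ultimately show ?case
      using S' B' eq IH(4) by (intro exI[of _ "F2 * l0 * S"] exI[of _ B'] exI[of _ C'] exI[of _ "m + 1 + s"] exI[of _ "m + j"]) simp
  qed
qed

text \<open>The power series of a rational function along the branch. The equation is cleared of the
  denominator, whose restriction is a unit.\<close>

definition expansion :: "cpoly3 fract \<Rightarrow> complex fps \<Rightarrow> bool" where
  "expansion u s \<longleftrightarrow> (\<exists>A T n. form n A \<and> form n T \<and> eval3 T p \<noteq> 0 \<and> u = Fract A T \<and> ev g A = ev g T * s)"

lemma eval3_nonzero: "eval3 T p \<noteq> 0 \<Longrightarrow> T \<noteq> 0"
  by auto

lemma expansionI:
  "form n A \<Longrightarrow> form n T \<Longrightarrow> eval3 T p \<noteq> 0 \<Longrightarrow> u = Fract A T \<Longrightarrow> ev g A = ev g T * s \<Longrightarrow> expansion u s"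
  unfolding expansion_def by blast

lemma expansionE:
  assumes "expansion u s"
  obtains A T n where "form n A" "form n T" "eval3 T p \<noteq> 0" "u = Fract A T" "ev g A = ev g T * s"
  using assms unfolding expansion_def by blast

lemma expansion_exists:
  assumes "u \<in> local_ring p" shows "\<exists>s. expansion u s"
proof -
  obtain A T n where AT: "form n A" "form n T" "eval3 T p \<noteq> 0" "u = Fract A T"
    using assms unfolding local_ring_def by blast
  have 1: "ev g T * inverse (ev g T) = 1"
    using AT(3) unfolding eval3_p' by (rule inverse_mult_eq_1')
  have "ev g A = ev g T * (inverse (ev g T) * ev g A)"
    by (simp add: mult.assoc[symmetric] 1)
  then show ?thesis using expansionI[OF AT] by blast
qed

lemma expansion_local_ring: "expansion u s \<Longrightarrow> u \<in> local_ring p"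
  unfolding expansion_def local_ring_def by blast

lemma expansion_add:
  assumes "expansion u s" "expansion v t" shows "expansion (u + v) (s + t)"
proof -
  obtain A S m B T n where *: "form m A" "form m S" "eval3 S p \<noteq> 0" "u = Fract A S" "ev g A = ev g S * s"
      "form n B" "form n T" "eval3 T p \<noteq> 0" "v = Fract B T" "ev g B = ev g T * t"
    using assms by (elim expansionE)
  show ?thesis
  proof (rule expansionI)
    show "u + v = Fract (A * T + B * S) (S * T)"
      using * eval3_nonzero by simp
    show "form (m + n) (A * T + B * S)" "form (m + n) (S * T)"
      using form_mult[OF *(1,7) refl] form_mult[OF *(6,2)] form_mult[OF *(2,7) refl]
      by (simp_all add: form_add add.commute)
    show "ev g (A * T + B * S) = ev g (S * T) * (s + t)"
      unfolding ev_simps *(5,10) by (simp add: algebra_simps)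
    show "eval3 (S * T) p \<noteq> 0" using * by simp
  qed
qed

lemma expansion_scale:
  assumes "expansion u s" shows "expansion (Fract (const3 z) 1 * u) (fps_const z * s)"
proof -
  obtain A S m where *: "form m A" "form m S" "eval3 S p \<noteq> 0" "u = Fract A S" "ev g A = ev g S * s"
    using assms by (elim expansionE)
  show ?thesis
  proof (rule expansionI[OF _ *(2,3)])
    show "Fract (const3 z) 1 * u = Fract (const3 z * A) S" using * by simp
    show "form m (const3 z * A)" using * by (simp add: form_const3_mult)
    show "ev g (const3 z * A) = ev g S * (fps_const z * s)"
      unfolding ev_simps *(5) by (simp add: mult.left_commute)
  qed
qed

lemma expansion_0: "expansion 0 0"
  unfolding expansion_def
  by (intro exI[of _ 0] exI[of _ 1] exI[of _ "0::nat"]) (simp add: form_1 Zero_fract_def)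

lemma expansion_sum:
  assumes "finite B" "\<And>b. b \<in> B \<Longrightarrow> expansion (u b) (s b)"
  shows "expansion (\<Sum>b\<in>B. u b) (\<Sum>b\<in>B. s b)"
  using assms by (induction B rule: finite_induct) (simp_all add: expansion_0 expansion_add)

definition sum_ideal :: "cpoly3 \<Rightarrow> cpoly3 fract set" where
  "sum_ideal G = {u + v | u v. u \<in> local_ideal G p \<and> v \<in> local_ideal F p}"

lemma sum_idealE:
  assumes "u \<in> sum_ideal G"
  obtains A1 S1 A2 S2 where "eval3 S1 p \<noteq> 0" "G dvd A1" "eval3 S2 p \<noteq> 0" "F dvd A2"
    "u = Fract A1 S1 + Fract A2 S2"
proof -
  obtain v w where vw: "u = v + w" "v \<in> local_ideal G p" "w \<in> local_ideal F p"
    using assms unfolding sum_ideal_def by blast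
  obtain A1 S1 where 1: "v = Fract A1 S1" "eval3 S1 p \<noteq> 0" "G dvd A1"
    using vw(2) unfolding local_ideal_def by blast
  obtain A2 S2 where 2: "w = Fract A2 S2" "eval3 S2 p \<noteq> 0" "F dvd A2"
    using vw(3) unfolding local_ideal_def by blast
  show ?thesis by (rule that[OF 1(2,3) 2(2,3)]) (simp only: vw(1) 1(1) 2(1))
qed

text \<open>Along the branch the \<open>F\<close>-part of an element of the ideal vanishes, the
  \<open>G\<close>-part inherits the order of \<open>G\<close>, and denominators are units.\<close>

lemma expansion_sum_ideal:
  assumes "expansion u s" "u \<in> sum_ideal G" "fps_X ^ k dvd ev g G"
  shows "fps_X ^ k dvd s"
proof -
  obtain A T where A: "eval3 T p \<noteq> 0" "u = Fract A T" "ev g A = ev g T * s"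
    using assms(1) by (elim expansionE)
  obtain A1 S1 A2 S2 where I: "eval3 S1 p \<noteq> 0" "G dvd A1" "eval3 S2 p \<noteq> 0" "F dvd A2"
      "u = Fract A1 S1 + Fract A2 S2"
    using assms(2) by (rule sum_idealE)
  have "A * (S1 * S2) = (A1 * S2 + A2 * S1) * T"
    using I(5) A(1) I(1,3) eval3_nonzero unfolding A(2) by (simp add: eq_fract)
  from arg_cong[OF this, of "ev g"]
  have "ev g T * (ev g S1 * ev g S2) * s = ev g T * (ev g A1 * ev g S2 + ev g A2 * ev g S1)"
    by (simp add: A(3) algebra_simps)
  moreover have "ev g A2 = 0" using I(4) on_curve by (auto simp: dvd_def)
  ultimately have "(ev g S1 * ev g S2) * s = ev g A1 * ev g S2"
    using A(1) by (auto simp: eval3_p' mult.assoc)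
  moreover have "fps_X ^ k dvd ev g A1" using I(2) assms(3) by (auto simp: dvd_def)
  ultimately have "fps_X ^ k dvd (ev g S1 * ev g S2) * s" by (simp only: dvd_mult2)
  from fps_X_power_dvd_unit_mult[OF _ this] show ?thesis
    using I(1,3) by (simp add: eval3_p')
qed

text \<open>Here \<open>k\<close> is the exact order of \<open>G\<close>, so modulo \<open>F\<close>
  the form \<open>G\<close> is \<open>l1 ^ k\<close> times a unit, up to a unit; the numerator of
  \<open>u\<close> is a multiple of \<open>l1 ^ k\<close> in the same sense, hence of
  \<open>G\<close>.\<close>

lemma in_sum_ideal:
  assumes "expansion u s" "form n G" "fps_nth (ev g G) k \<noteq> 0"
    and "fps_X ^ k dvd ev g G" "fps_X ^ k dvd s"
  shows "u \<in> sum_ideal G"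
proof -
  obtain A T a where A: "form a A" "form a T" "eval3 T p \<noteq> 0" "u = Fract A T" "ev g A = ev g T * s"
    using assms(1) by (elim expansionE)
  obtain S B C r j where G: "form r S" "eval3 S p \<noteq> 0" "form j B" "j + k = r + n" "form (r + n) (F * C)"
      "S * G = l1 ^ k * B + F * C"
    using uniformizer_power[OF assms(2,4)] by blast
  obtain S' B' C' r' j' where A': "form r' S'" "eval3 S' p \<noteq> 0" "form j' B'" "j' + k = r' + a"
      "form (r' + a) (F * C')" "S' * A = l1 ^ k * B' + F * C'"
    using uniformizer_power[OF A(1)] A(5) assms(5) by (metis dvd_mult)
  have "ev g S * ev g G = fps_X ^ k * ev g B"
    using arg_cong[OF G(6), of "ev g"] by (simp add: ev_l on_curve)
  moreover have "fps_nth (ev g S * ev g G) k = fps_nth (ev g S) 0 * fps_nth (ev g G) k"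
  proof -
    obtain w where w: "ev g G = fps_X ^ k * w" using assms(4) by (auto simp: dvd_def)
    have "ev g S * ev g G = fps_X ^ k * (ev g S * w)" by (simp add: w algebra_simps)
    then have "fps_nth (ev g S * ev g G) k = fps_nth (ev g S) 0 * fps_nth w 0"
      by (simp only: fps_X_power_mult_nth) simp
    moreover have "fps_nth (ev g G) k = fps_nth w 0"
      by (simp add: w fps_X_power_mult_nth)
    ultimately show ?thesis by simp
  qed
  ultimately have B0: "eval3 B p \<noteq> 0"
    using assms(3) G(2) by (simp add: eval3_p' fps_X_power_mult_nth)
  \<comment> \<open>Eliminates \<open>l1 ^ k\<close> between the two relations supplied by
    \<open>uniformizer_power\<close>.\<close>
  have eq: "A * (S' * B) = G * (B' * S) + F * (C' * B - B' * C)"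
  proof -
    have "A * (S' * B) = (S' * A) * B" by (simp only: ac_simps)
    also have "\<dots> = B' * (l1 ^ k * B) + F * C' * B" unfolding A'(6) by (simp add: algebra_simps)
    also have "l1 ^ k * B = S * G - F * C" by (simp add: G(6))
    finally show ?thesis by (simp add: algebra_simps)
  qed
  have T: "form (a + r' + j) (T * (S' * B))" "eval3 (T * (S' * B)) p \<noteq> 0"
    using form_mult[OF A(2) form_mult[OF A'(1) G(3) refl]] A(3) A'(2) B0 by (simp_all add: add.assoc)
  have G1: "form (a + r' + j) (G * (B' * S))"
    by (rule form_mult[OF assms(2) form_mult[OF A'(3) G(1) refl]]) (use G(4) A'(4) in simp)
  have "form (a + r' + j) (A * (S' * B))"
    using form_mult[OF A(1) form_mult[OF A'(1) G(3) refl]] by (simp add: add.assoc)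
  then have F1: "form (a + r' + j) (F * (C' * B - B' * C))"
    using form_diff[OF _ G1] eq by (metis add_diff_cancel_left')
  have "u = Fract (A * (S' * B)) (T * (S' * B))"
    using A eval3_nonzero A'(2) B0 T(2) by (simp add: eq_fract mult.assoc mult.left_commute)
  also have "\<dots> = Fract (G * (B' * S)) (T * (S' * B)) + Fract (F * (C' * B - B' * C)) (T * (S' * B))"
    using eval3_nonzero[OF T(2)] unfolding eq by (simp add: eq_fract algebra_simps)
  finally show ?thesis
    unfolding sum_ideal_def local_ideal_def using G1 F1 T by (auto intro!: exI)
qed

definition independent_mod :: "cpoly3 \<Rightarrow> cpoly3 fract set \<Rightarrow> bool" where
  "independent_mod G B \<longleftrightarrow> finite B \<and> B \<subseteq> local_ring p \<and>
     (\<forall>c. (\<Sum>b\<in>B. Fract (const3 (c b)) 1 * b) \<in> sum_ideal G \<longrightarrow> (\<forall>b\<in>B. c b = 0))"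

lemma inter_mult_Sup: "inter_mult G F p = Sup {enat (card B) | B. independent_mod G B}"
  unfolding inter_mult_def quotient_dim_def sum_ideal_def independent_mod_def ..

text \<open>The first \<open>k\<close> powers of the uniformizer expand to 1, t, ..., t^(k-1), and a
  combination of these is divisible by t^k only if it is trivial.\<close>

lemma independent_uniformizer_powers:
  assumes dvd: "fps_X ^ k dvd ev g G"
  shows "\<exists>B. independent_mod G B \<and> card B = k"
proof -
  define \<tau> where "\<tau> i = Fract (l1 ^ i) (l0 ^ i)" for i :: nat
  have \<tau>: "expansion (\<tau> i) (fps_X ^ i)" for i
    using form_power[OF form_l(1), of i i] form_power[OF form_l(2), of i i]
    by (intro expansionI[of i "l1 ^ i" "l0 ^ i"]) (simp_all add: ev_l l_p \<tau>_def)
  have inj: "inj_on \<tau> {..<k}"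
  proof (rule inj_onI)
    fix i j assume "\<tau> i = \<tau> j"
    moreover have "l0 ^ i \<noteq> 0" "l0 ^ j \<noteq> 0"
      using eval3_nonzero[of l0] by (simp_all add: l_p)
    ultimately have "l1 ^ i * l0 ^ j = l1 ^ j * l0 ^ i"
      by (simp add: \<tau>_def eq_fract)
    from arg_cong[OF this, of "ev g"] have "(fps_X :: complex fps) ^ i = fps_X ^ j" by (simp add: ev_l)
    then have "fps_nth ((fps_X :: complex fps) ^ i) i = fps_nth (fps_X ^ j) i" by simp
    then show "i = j" by (simp add: fps_X_power_nth split: if_splits)
  qed
  have "c (\<tau> i) = 0" if c: "(\<Sum>b\<in>\<tau> ` {..<k}. Fract (const3 (c b)) 1 * b) \<in> sum_ideal G" and i: "i < k" for c i
  proof -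
    have "(\<Sum>i<k. Fract (const3 (c (\<tau> i))) 1 * \<tau> i) \<in> sum_ideal G"
      using c unfolding sum.reindex[OF inj] by (simp add: o_def)
    moreover have "expansion (\<Sum>i<k. Fract (const3 (c (\<tau> i))) 1 * \<tau> i) (\<Sum>i<k. fps_const (c (\<tau> i)) * fps_X ^ i)"
      by (intro expansion_sum expansion_scale \<tau>) simp
    ultimately have "fps_X ^ k dvd (\<Sum>i<k. fps_const (c (\<tau> i)) * fps_X ^ i)"
      using expansion_sum_ideal[OF _ _ dvd] by blast
    then have "fps_nth (\<Sum>i<k. fps_const (c (\<tau> i)) * fps_X ^ i) i = 0"
      using i by (simp add: fps_X_power_dvd_iff)
    moreover have "fps_nth (\<Sum>i<k. fps_const (c (\<tau> i)) * fps_X ^ i) i = (\<Sum>j<k. if j = i then c (\<tau> j) else 0)"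
      unfolding fps_sum_nth by (intro sum.cong) (auto simp: fps_X_power_nth)
    ultimately show ?thesis using i by simp
  qed
  moreover have "\<tau> ` {..<k} \<subseteq> local_ring p" using \<tau> expansion_local_ring by blast
  ultimately have "independent_mod G (\<tau> ` {..<k})"
    unfolding independent_mod_def by blast
  then show ?thesis using card_image[OF inj] by auto
qed

text \<open>More than \<open>r\<close> elements admit a nontrivial combination whose first
  \<open>r\<close> coefficients along the branch vanish, and this combination lies in the
  ideal.\<close>

lemma card_independent_le:
  assumes "independent_mod G B" "form n G" "fps_nth (ev g G) r \<noteq> 0" "fps_X ^ r dvd ev g G"
  shows "card B \<le> r"
proof (rule ccontr)
  assume "\<not> card B \<le> r"
  moreover have B: "finite B" "B \<subseteq> local_ring p"
      "\<And>c. (\<Sum>b\<in>B. Fract (const3 (c b)) 1 * b) \<in> sum_ideal G \<Longrightarrow> \<forall>b\<in>B. c b = 0"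
    using assms(1) unfolding independent_mod_def by blast+
  have "\<forall>b\<in>B. \<exists>s. expansion b s" using B(2) expansion_exists by blast
  then obtain s where s: "\<forall>b\<in>B. expansion b (s b)"
    using bchoice[of B expansion] by blast
  ultimately obtain c where c: "\<exists>b\<in>B. c b \<noteq> 0" "\<forall>i<r. (\<Sum>b\<in>B. c b * fps_nth (s b) i) = 0"
    using linear_dependence[OF B(1), of r "\<lambda>b. fps_nth (s b)"] by auto
  have "expansion (\<Sum>b\<in>B. Fract (const3 (c b)) 1 * b) (\<Sum>b\<in>B. fps_const (c b) * s b)"
    by (rule expansion_sum[OF B(1)]) (use s expansion_scale in blast)
  moreover have "fps_X ^ r dvd (\<Sum>b\<in>B. fps_const (c b) * s b)"
    using c(2) by (simp add: fps_X_power_dvd_iff fps_sum_nth)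
  ultimately show False using in_sum_ideal[OF _ assms(2-4)] B(3) c(1) by blast
qed

text \<open>Phrased by lower bounds, so that infinite multiplicity, with \<open>ev g G = 0\<close>,
  is covered too.\<close>

lemma inter_mult_ge_iff:
  assumes "form n G"
  shows "enat k \<le> inter_mult G F p \<longleftrightarrow> fps_X ^ k dvd ev g G"
proof
  assume "fps_X ^ k dvd ev g G"
  then obtain B where "independent_mod G B" "card B = k" using independent_uniformizer_powers by blast
  then have "enat k \<in> {enat (card B) | B. independent_mod G B}" by blast
  then show "enat k \<le> inter_mult G F p" unfolding inter_mult_Sup by (rule Sup_upper)
next
  assume le: "enat k \<le> inter_mult G F p"
  show "fps_X ^ k dvd ev g G"
  proof (rule ccontr)
    assume "\<not> fps_X ^ k dvd ev g G"
    then obtain i where i: "i < k" "fps_nth (ev g G) i \<noteq> 0" unfolding fps_X_power_dvd_iff by blast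
    then obtain r where r: "fps_nth (ev g G) r \<noteq> 0" "\<forall>j<r. fps_nth (ev g G) j = 0"
      using exists_least_iff[of "\<lambda>i. fps_nth (ev g G) i \<noteq> 0"] by blast
    have "r < k" using r(2) i by (meson not_less le_less_trans)
    have dvd: "fps_X ^ r dvd ev g G" using r(2) unfolding fps_X_power_dvd_iff .
    have "inter_mult G F p \<le> enat r"
      unfolding inter_mult_Sup using card_independent_le[OF _ assms r(1) dvd]
      by (intro Sup_least) auto
    with le have "enat k \<le> enat r" by (rule order_trans)
    then show False using \<open>r < k\<close> by simp
  qed
qed

end


section \<open>Branches at smooth points\<close>

text \<open>The remainder stays unspecified: Newton iteration exploits only its factor
  \<open>s\<^sup>2\<close>.\<close>

lemma ev_Taylor: "\<exists>R. ev (g + s *s u) A = ev g A + s * D1 g A u + s\<^sup>2 * R"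
proof (induction A rule: cpoly3_induct)
  case (add A B)
  then obtain R S where "ev (g + s *s u) A = ev g A + s * D1 g A u + s\<^sup>2 * R"
    "ev (g + s *s u) B = ev g B + s * D1 g B u + s\<^sup>2 * S" by blast
  then show ?case by (intro exI[of _ "R + S"]) (simp add: D1_def algebra_simps)
next
  case (mult A B)
  then obtain R S where *: "ev (g + s *s u) A = ev g A + s * D1 g A u + s\<^sup>2 * R"
    "ev (g + s *s u) B = ev g B + s * D1 g B u + s\<^sup>2 * S" by blast
  have "D1 g (A * B) u = D1 g A u * ev g B + ev g A * D1 g B u"
    by (simp add: D1_def algebra_simps)
  then show ?case
    by (intro exI[of _ "R * ev g B + D1 g A u * D1 g B u + ev g A * S + s * (D1 g A u * S + R * D1 g B u) + s\<^sup>2 * (R * S)"])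
      (simp add: * power2_eq_square algebra_simps)
qed (auto simp: D1_def intro: exI[of _ 0])

context frame
begin

lemma arc_add: "arc (y + s) = arc y + s *s const_vec c"
  by (simp add: arc_def vec_eq_iff algebra_simps)

lemma D1_const_vec_nth_0:
  assumes "fps_nth y 0 = 0"
  shows "fps_nth (D1 (arc y) G (const_vec u)) 0
    = u$1 * eval3 (dx G) p + u$2 * eval3 (dy G) p + u$3 * eval3 (dz G) p"
  by (simp add: D1_def eval3_p[OF assms])

text \<open>Newton iteration, one coefficient at a time.\<close>

lemma arc_on_curve_exists:
  assumes "eval3 G p = 0"
    and "c$1 * eval3 (dx G) p + c$2 * eval3 (dy G) p + c$3 * eval3 (dz G) p \<noteq> 0"
  shows "\<exists>y. fps_nth y 0 = 0 \<and> ev (arc y) G = 0"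
proof -
  define \<phi> where "\<phi> = c$1 * eval3 (dx G) p + c$2 * eval3 (dy G) p + c$3 * eval3 (dz G) p"
  \<comment> \<open>By Taylor, adding a multiple of \<open>fps_X ^ Suc n\<close> to the arc changes
    coefficient \<open>Suc n\<close> of the restriction of \<open>G\<close> by \<open>\<phi>\<close>
    times that multiple and no lower one; the choice cancels this coefficient.\<close>
  define \<beta> where "\<beta> n y = - fps_nth (ev (arc y) G) (Suc n) / \<phi>" for n y
  define Y where "Y = rec_nat 0 (\<lambda>n y. y + fps_const (\<beta> n y) * fps_X ^ Suc n)"
  have Y_Suc: "Y (Suc n) = Y n + fps_const (\<beta> n (Y n)) * fps_X ^ Suc n" for n
    by (simp add: Y_def)
  have Y0: "fps_nth (Y n) 0 = 0" for n
    by (induction n) (simp_all add: Y_Suc, simp add: Y_def)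
  have vanish: "fps_nth (ev (arc (Y n)) G) i = 0" if "i \<le> n" for n i
    using that
  proof (induction n arbitrary: i)
    case 0
    then show ?case using assms(1) eval3_p[OF Y0[of 0], of G] by simp
  next
    case (Suc n)
    define \<gamma> where "\<gamma> = \<beta> n (Y n)"
    define s where "s = fps_const \<gamma> * fps_X ^ Suc n"
    obtain R where R: "ev (arc (Y n + s)) G
        = ev (arc (Y n)) G + s * D1 (arc (Y n)) G (const_vec c) + s\<^sup>2 * R"
      using ev_Taylor[of "arc (Y n)" s "const_vec c" G] unfolding arc_add by blast
    have "ev (arc (Y (Suc n))) G = ev (arc (Y n)) G
        + fps_X ^ Suc n * (fps_const \<gamma> * D1 (arc (Y n)) G (const_vec c)
          + fps_X * (fps_X ^ n * (fps_const \<gamma> ^ 2 * R)))"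
      unfolding Y_Suc \<gamma>_def[symmetric] s_def[symmetric] R unfolding s_def
      by (simp add: power2_eq_square algebra_simps)
    then have "fps_nth (ev (arc (Y (Suc n))) G) i = fps_nth (ev (arc (Y n)) G) i
        + (if i < Suc n then 0 else fps_nth (fps_const \<gamma> * D1 (arc (Y n)) G (const_vec c)
          + fps_X * (fps_X ^ n * (fps_const \<gamma> ^ 2 * R))) (i - Suc n))"
      by (simp only: fps_add_nth fps_X_power_mult_nth)
    moreover have "fps_nth (D1 (arc (Y n)) G (const_vec c)) 0 = \<phi>"
      unfolding \<phi>_def by (rule D1_const_vec_nth_0[OF Y0])
    moreover have "\<gamma> * \<phi> = - fps_nth (ev (arc (Y n)) G) (Suc n)"
      using assms(2) by (simp add: \<gamma>_def \<beta>_def \<phi>_def)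
    ultimately show ?case
      using Suc.IH[of i] Suc.prems by (cases "i = Suc n") simp_all
  qed
  \<comment> \<open>The limit of the iteration: coefficient \<open>n\<close> no longer changes after
    stage \<open>n\<close>.\<close>
  define y where "y = Abs_fps (\<lambda>n. fps_nth (Y n) n)"
  have stable: "fps_nth (Y n) i = fps_nth (Y i) i" if "i \<le> n" for n i
    using that
  proof (induction n)
    case (Suc n)
    have "fps_nth (Y (Suc n)) i = fps_nth (Y n) i" if "i \<le> n"
      unfolding Y_Suc using that by (simp add: fps_X_power_mult_right_nth mult.commute del: power_Suc)
    then show ?case using Suc by (cases "i = Suc n") simp_all
  qed simp
  have "fps_nth (ev (arc y) G) n = 0" for n
  proof -
    \<comment> \<open>The tail has order above \<open>n\<close>, so the restrictions of
      \<open>G\<close> to the arcs of \<open>y\<close> and \<open>Y n\<close> agree up to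
      coefficient \<open>n\<close>.\<close>
    define s where "s = y - Y n"
    have "fps_X ^ Suc n dvd s"
      unfolding fps_X_power_dvd_iff using stable[of _ n] by (simp add: s_def y_def less_Suc_eq_le)
    moreover obtain R where "ev (arc (Y n + s)) G
        = ev (arc (Y n)) G + s * D1 (arc (Y n)) G (const_vec c) + s\<^sup>2 * R"
      using ev_Taylor[of "arc (Y n)" s "const_vec c" G] unfolding arc_add by blast
    then have "ev (arc y) G = ev (arc (Y n)) G + s * (D1 (arc (Y n)) G (const_vec c) + s * R)"
      by (simp add: s_def power2_eq_square algebra_simps)
    ultimately have "fps_nth (ev (arc y) G - ev (arc (Y n)) G) n = 0"
      using fps_X_power_dvd_iff[of "Suc n" "s * (D1 (arc (Y n)) G (const_vec c) + s * R)"]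
      by (simp add: dvd_mult2)
    then show ?thesis using vanish[of n n] by simp
  qed
  moreover have "fps_nth y 0 = 0" using Y0[of 0] by (simp add: y_def)
  ultimately show ?thesis by (intro exI[of _ y]) (simp add: fps_eq_iff)
qed

lemma quadratic_decompose:
  assumes "form 2 Q"
  obtains q00 q01 q02 q11 q12 q22 where
    "Q = const3 q00 * l0\<^sup>2 + const3 q01 * (l0 * l1) + const3 q02 * (l0 * l2)
      + const3 q11 * l1\<^sup>2 + const3 q12 * (l1 * l2) + const3 q22 * l2\<^sup>2"
proof -
  obtain A B C where 1: "form 1 A" "form 1 B" "form 1 C" "Q = l0 * A + l1 * B + l2 * C"
    using frame_decompose[of 1 Q] assms by (auto simp: numeral_2_eq_2)
  have "\<exists>u v w. G = const3 u * l0 + const3 v * l1 + const3 w * l2" if "form 1 G" for G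
  proof -
    have "form (Suc 0) G" using that by simp
    from frame_decompose[OF this] obtain A B C where "form 0 A" "form 0 B" "form 0 C" "G = l0 * A + l1 * B + l2 * C" .
    then show ?thesis by (metis form_0_obtain_const mult.commute)
  qed
  then obtain u v w u' v' w' u'' v'' w'' where "A = const3 u * l0 + const3 v * l1 + const3 w * l2"
      "B = const3 u' * l0 + const3 v' * l1 + const3 w' * l2" "C = const3 u'' * l0 + const3 v'' * l1 + const3 w'' * l2"
    using 1(1-3) by meson
  then have "Q = const3 u * l0\<^sup>2 + const3 (v + u') * (l0 * l1) + const3 (w + u'') * (l0 * l2)
      + const3 v' * l1\<^sup>2 + const3 (w' + v'') * (l1 * l2) + const3 w'' * l2\<^sup>2"
    unfolding 1(4) by (simp add: power2_eq_square algebra_simps)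
  then show ?thesis by (rule that)
qed

end

text \<open>Complex conjugates avoid isotropic vectors: \<open>b\<close> is the cross product of
  conj(p) and n, and \<open>c\<close> is a multiple of conj(n), so the determinant involves the
  squared norms \<open>P\<close> and \<open>N\<close>, which are nonzero.\<close>

lemma cross_frame_exists:
  fixes p n :: "complex^3"
  assumes p: "p \<noteq> 0" and n: "n \<noteq> 0" and pn: "p$1 * n$1 + p$2 * n$2 + p$3 * n$3 = 0"
  obtains b c where "det (vector [p, b, c] :: complex^3^3) = 1"
    "b$1 * n$1 + b$2 * n$2 + b$3 * n$3 = 0" "c$1 * n$1 + c$2 * n$2 + c$3 * n$3 \<noteq> 0"
proof -
  define q m where "q i = cnj (p$i)" and "m i = cnj (n$i)" for i
  have nonneg: "u$1 * cnj (u$1) + u$2 * cnj (u$2) + u$3 * cnj (u$3) \<noteq> 0" if "u \<noteq> 0" for u :: "complex^3"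
  proof
    assume *: "u$1 * cnj (u$1) + u$2 * cnj (u$2) + u$3 * cnj (u$3) = 0"
    have "(cmod (u$1))\<^sup>2 + (cmod (u$2))\<^sup>2 + (cmod (u$3))\<^sup>2 = 0"
      using * unfolding complex_norm_square[symmetric] by (metis of_real_add of_real_eq_0_iff)
    then have "cmod (u$1) = 0 \<and> cmod (u$2) = 0 \<and> cmod (u$3) = 0"
      by (smt (verit) zero_le_power2 power_eq_0_iff)
    then show False using that by (simp add: vec_eq_iff forall_3)
  qed
  define P N where "P = p$1 * q 1 + p$2 * q 2 + p$3 * q 3" and "N = n$1 * m 1 + n$2 * m 2 + n$3 * m 3"
  have PN: "P \<noteq> 0" "N \<noteq> 0" using nonneg[OF p] nonneg[OF n] by (simp_all add: P_def N_def q_def m_def)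
  define b :: "complex^3" where
    "b = vector [q 2 * n$3 - q 3 * n$2, q 3 * n$1 - q 1 * n$3, q 1 * n$2 - q 2 * n$1]"
  \<comment> \<open>Since p and n are orthogonal, the determinant is \<open>- r * P * N\<close>;
    this scale makes it 1.\<close>
  define r where "r = - 1 / (P * N)"
  define c :: "complex^3" where "c = vector [r * m 1, r * m 2, r * m 3]"
  show ?thesis
  proof
    have "det (vector [p, b, c] :: complex^3^3)
        = r * ((p$1 * n$1 + p$2 * n$2 + p$3 * n$3) * (q 1 * m 1 + q 2 * m 2 + q 3 * m 3) - P * N)"
      by (simp add: det_3 b_def c_def P_def N_def algebra_simps)
    then show "det (vector [p, b, c] :: complex^3^3) = 1" using PN by (simp add: pn r_def)
    show "b$1 * n$1 + b$2 * n$2 + b$3 * n$3 = 0" by (simp add: b_def algebra_simps)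
    have "c$1 * n$1 + c$2 * n$2 + c$3 * n$3 = r * N" by (simp add: c_def N_def algebra_simps)
    then show "c$1 * n$1 + c$2 * n$2 + c$3 * n$3 \<noteq> 0" using PN by (simp add: r_def)
  qed
qed

section \<open>Inflection and sextactic points through the coefficients of the branch\<close>

locale tangent_branch = branch +
  assumes tangent_b: "b$1 * eval3 (dx F) p + b$2 * eval3 (dy F) p + b$3 * eval3 (dz F) p = 0"
begin

lemma deriv_arc: "deriv_vec g = const_vec b + fps_deriv y *s const_vec c"
  by (simp add: vec_eq_iff arc_def)

lemma y_1: "fps_nth y 1 = 0"
proof -
  have "0 = D1 g F (deriv_vec g)" using deriv_ev[of g F] on_curve by simp
  also have "\<dots> = D1 g F (const_vec b) + fps_deriv y * D1 g F (const_vec c)"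
    by (simp add: deriv_arc D1_def algebra_simps)
  finally have "fps_nth (D1 g F (const_vec b) + fps_deriv y * D1 g F (const_vec c)) 0 = 0" by simp
  then show ?thesis using transversal tangent_b by (simp add: D1_const_vec_nth_0[OF y_0])
qed

text \<open>The gradient at \<open>p\<close> annihilates \<open>a\<close> by Euler's identity and
  \<open>b\<close> by tangency, so it is proportional to the cross product of \<open>a\<close> and
  \<open>b\<close>, the coefficient vector of \<open>l2\<close>; pairing with \<open>c\<close> gives
  the factor.\<close>

lemma tangent_line_eq:
  "tangent_line F p = const3 (c$1 * eval3 (dx F) p + c$2 * eval3 (dy F) p + c$3 * eval3 (dz F) p) * l2"
proof -
  define n1 n2 n3 where "n1 = eval3 (dx F) p" and "n2 = eval3 (dy F) p" and "n3 = eval3 (dz F) p"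
  have "X * dx F + Y * dy F + Z * dz F = of_nat (Suc m) * F" by (rule Euler[OF form_F])
  from arg_cong[OF this, of "\<lambda>G. eval3 G p"]
  have "a$1 * n1 + a$2 * n2 + a$3 * n3 = eval3 (of_nat (Suc m)) p * eval3 F p"
    by (simp add: n1_def n2_def n3_def p_def)
  then have a: "a$1 * n1 + a$2 * n2 + a$3 * n3 = 0"
    using on_curve by (simp add: eval3_p')
  have b: "b$1 * n1 + b$2 * n2 + b$3 * n3 = 0" using tangent_b by (simp add: n1_def n2_def n3_def)
  define k where "k = c$1 * n1 + c$2 * n2 + c$3 * n3"
  have "k * (a$2 * b$3 - a$3 * b$2) = n1" "k * (a$3 * b$1 - a$1 * b$3) = n2" "k * (a$1 * b$2 - a$2 * b$1) = n3"
    using a b det_expand unfolding k_def by algebra+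
  then show ?thesis
    unfolding tangent_line_def l2_def const3_lin
    by (simp add: lin_def k_def n1_def n2_def n3_def)
qed

lemma curve_frame:
  assumes "m = e + 2"
  shows "curve_frame F e g (const_vec b + fps_deriv y *s const_vec c) (const_vec c) (fps_deriv (fps_deriv y))"
proof
  show "form (e + 3) F" using form_F assms by (simp add: eval_nat_numeral)
  show "ev g F = 0" by (rule on_curve)
  show "deriv_vec g = const_vec b + fps_deriv y *s const_vec c" by (rule deriv_arc)
  show "deriv_vec (const_vec b + fps_deriv y *s const_vec c) = fps_deriv (fps_deriv y) *s const_vec c"
    by (simp add: vec_eq_iff)
  show "deriv_vec (const_vec c) = 0" by (simp add: vec_eq_iff)
  have "det (vector [const_vec a, const_vec b, const_vec c] :: complex fps^3^3)
      = fps_const (det (vector [a, b, c] :: complex^3^3))"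
    by (simp add: det_3)
  then have "det (vector [const_vec a, const_vec b, const_vec c] :: complex fps^3^3) = 1"
    using det_abc by simp
  then show "det (vector [g, const_vec b + fps_deriv y *s const_vec c, const_vec c] :: complex fps^3^3) = 1"
    unfolding det_3 arc_def
    by (simp add: algebra_simps del: fps_const_add fps_const_sub fps_const_mult)
qed

lemma H2_arc:
  assumes "m = e + 2"
  obtains C where "C \<noteq> 0" "ev g (H2 (Suc m) F) = fps_const C * D1 g F (const_vec c) ^ 12 * Monge (fps_deriv (fps_deriv y))"
proof -
  interpret curve_frame F e g "const_vec b + fps_deriv y *s const_vec c" "const_vec c" "fps_deriv (fps_deriv y)"
    by (rule curve_frame[OF assms])
  define K :: complex where "K = of_nat (e + 2)"
  define C where "C = - (K ^ 8 * (K - 1)\<^sup>2 * (4 * K - 5))"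
  \<comment> \<open>Written through \<open>e\<close>, both factors are positive natural numbers;
    this uses that the degree is at least 3.\<close>
  have "K - 1 = of_nat (e + 1)" "4 * K - 5 = of_nat (4 * e + 3)" by (simp_all add: K_def)
  then have "K \<noteq> 0" "K - 1 \<noteq> 0" "4 * K - 5 \<noteq> 0"
    unfolding K_def by (simp_all only: of_nat_eq_0_iff)
  then have "C \<noteq> 0" by (simp add: C_def)
  moreover have "k = fps_const K" by (simp only: k_def K_def fps_of_nat)
  then have "k ^ 8 * (k - 1)\<^sup>2 * (4 * k - 5) = - fps_const C"
    by (simp only: C_def fps_const_neg[symmetric] fps_const_mult[symmetric] fps_const_power[symmetric]
        fps_const_sub[symmetric] fps_const_1_eq_1 numeral_fps_const minus_minus)
  then have "ev g (H2 (e + 3) F) = fps_const C * D1 g F (const_vec c) ^ 12 * Monge (fps_deriv (fps_deriv y))"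
    by (simp only: H2_curve minus_mult_left minus_minus)
  ultimately show ?thesis using that assms by (simp add: eval_nat_numeral)
qed

lemma smooth: "p \<in> smooth_points F"
proof -
  have "a$1 \<noteq> 0 \<or> a$2 \<noteq> 0 \<or> a$3 \<noteq> 0" using det_expand by auto
  then show ?thesis
    using transversal on_curve eval3_p'[of F]
    by (auto simp: smooth_points_def singular_points_def V_def p_def)
qed

text \<open>Up to a nonzero scalar the tangent line is \<open>l2\<close>, and \<open>l2\<close>
  restricts to \<open>y\<close>.\<close>

lemma tangent_mult_ge_iff: "enat k \<le> tangent_mult F p \<longleftrightarrow> (\<forall>i<k. fps_nth y i = 0)"
proof -
  define k0 where "k0 = c$1 * eval3 (dx F) p + c$2 * eval3 (dy F) p + c$3 * eval3 (dz F) p"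
  have t: "tangent_line F p = const3 k0 * l2" unfolding k0_def by (rule tangent_line_eq)
  have "form 1 (tangent_line F p)"
    unfolding t by (intro form_const3_mult form_l)
  then show ?thesis
    unfolding tangent_mult_def using transversal
    by (subst inter_mult_ge_iff) (simp_all add: t ev_l fps_X_power_dvd_iff flip: k0_def)
qed

lemma inflection_iff: "p \<in> inflection_points F \<longleftrightarrow> fps_nth y 2 = 0"
proof -
  have "2 < tangent_mult F p \<longleftrightarrow> enat 3 \<le> tangent_mult F p"
    using Suc_ile_eq[of 2] by (simp add: numeral_eq_enat eval_nat_numeral)
  also have "\<dots> \<longleftrightarrow> fps_nth y 2 = 0"
    unfolding tangent_mult_ge_iff using y_0 y_1 by (auto simp: less_Suc_eq eval_nat_numeral)
  finally show ?thesis using smooth by (simp add: inflection_points_def)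
qed

lemma higher_order_inflection_iff:
  "p \<in> higher_order_inflection_points F \<longleftrightarrow> fps_nth y 2 = 0 \<and> fps_nth y 3 = 0"
proof -
  have "2 \<le> x - 2 \<longleftrightarrow> enat 4 \<le> x" for x :: enat
    by (cases x) (auto simp: numeral_eq_enat)
  then have "2 \<le> inflection_order F p \<longleftrightarrow> enat 4 \<le> tangent_mult F p"
    by (simp add: inflection_order_def)
  also have "\<dots> \<longleftrightarrow> fps_nth y 2 = 0 \<and> fps_nth y 3 = 0"
    unfolding tangent_mult_ge_iff using y_0 y_1 by (auto simp: less_Suc_eq eval_nat_numeral)
  finally show ?thesis by (auto simp: higher_order_inflection_points_def inflection_iff)
qed

abbreviation "\<alpha> \<equiv> fps_nth y 2"
abbreviation "\<beta> \<equiv> fps_nth y 3"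
abbreviation "\<gamma> \<equiv> fps_nth y 4"
abbreviation "\<delta> \<equiv> fps_nth y 5"

text \<open>At 0 the series \<open>y''\<close> and its first three derivatives are
  \<open>2 * \<alpha>\<close>, \<open>6 * \<beta>\<close>, \<open>24 * \<gamma>\<close> and
  \<open>120 * \<delta>\<close>; 4320 is the common factor.\<close>

lemma Monge_nth_0: "fps_nth (Monge (fps_deriv (fps_deriv y))) 0 = 4320 * (\<alpha>\<^sup>2 * \<delta> - 3 * \<alpha> * \<beta> * \<gamma> + 2 * \<beta> ^ 3)"
  by (simp add: Monge_def fps_nth_power_0 eval_nat_numeral algebra_simps)

text \<open>The forms \<open>l0\<close>, \<open>l1\<close>, \<open>l2\<close> restrict to 1, t, y,
  so the six conditions are the coefficients of t^0 to t^5.\<close>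

lemma conic_dvd_iff:
  assumes "Q = const3 q00 * l0\<^sup>2 + const3 q01 * (l0 * l1) + const3 q02 * (l0 * l2)
      + const3 q11 * l1\<^sup>2 + const3 q12 * (l1 * l2) + const3 q22 * l2\<^sup>2"
  shows "fps_X ^ 6 dvd ev g Q \<longleftrightarrow> q00 = 0 \<and> q01 = 0 \<and> q02 * \<alpha> + q11 = 0 \<and> q02 * \<beta> + q12 * \<alpha> = 0
    \<and> q02 * \<gamma> + q12 * \<beta> + q22 * \<alpha>\<^sup>2 = 0 \<and> q02 * \<delta> + q12 * \<gamma> + 2 * q22 * \<alpha> * \<beta> = 0"
proof -
  \<comment> \<open>\<open>y\<close> has order at least 2; splitting off t^2 turns coefficients 2 to
    5 of the restriction into coefficients 0 to 3 of \<open>u\<close>.\<close>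
  define w where "w = fps_shift 2 y"
  have y: "y = fps_X ^ 2 * w"
  proof (rule fps_ext)
    fix n :: nat
    have "n = 0 \<or> n = 1 \<or> \<not> n < 2 \<and> n - 2 + 2 = n" by arith
    then show "fps_nth y n = fps_nth (fps_X ^ 2 * w) n"
      using y_0 y_1 by (elim disjE) (simp_all add: w_def fps_X_power_mult_nth del: add_2_eq_Suc')
  qed
  define u where "u = fps_const q02 * w + fps_const q11 + fps_const q12 * (fps_X * w) + fps_const q22 * (fps_X ^ 2 * (w * w))"
  have "ev g Q = fps_const q00 + fps_const q01 * fps_X + fps_X ^ 2 * u"
    unfolding assms u_def by (simp add: ev_l) (simp add: y power2_eq_square algebra_simps)
  then have Q: "fps_nth (ev g Q) i = (if i = 0 then q00 else 0) + (if i = 1 then q01 else 0)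
      + (if i < 2 then 0 else fps_nth u (i - 2))" for i
    by (simp add: fps_X_power_mult_nth)
  have u: "fps_nth u 0 = q02 * fps_nth w 0 + q11" "fps_nth u 1 = q02 * fps_nth w 1 + q12 * fps_nth w 0"
    "fps_nth u 2 = q02 * fps_nth w 2 + q12 * fps_nth w 1 + q22 * (fps_nth w 0)\<^sup>2"
    "fps_nth u 3 = q02 * fps_nth w 3 + q12 * fps_nth w 2 + 2 * q22 * fps_nth w 0 * fps_nth w 1"
    by (simp_all add: u_def fps_X_power_mult_nth power2_eq_square fps_mult_nth_1 algebra_simps)
  have w: "\<alpha> = fps_nth w 0" "\<beta> = fps_nth w 1" "\<gamma> = fps_nth w 2" "\<delta> = fps_nth w 3"
    by (simp_all add: w_def eval_nat_numeral)
  have "i < 6 \<longleftrightarrow> i = 0 \<or> i = 1 \<or> i = 2 \<or> i = 3 \<or> i = 4 \<or> i = 5" for i :: nat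
    by arith
  then have "(\<forall>i<6. fps_nth (ev g Q) i = 0) \<longleftrightarrow> fps_nth (ev g Q) 0 = 0 \<and> fps_nth (ev g Q) 1 = 0
      \<and> fps_nth (ev g Q) 2 = 0 \<and> fps_nth (ev g Q) 3 = 0 \<and> fps_nth (ev g Q) 4 = 0 \<and> fps_nth (ev g Q) 5 = 0"
    by auto
  then show ?thesis
    unfolding fps_X_power_dvd_iff Q w using u by simp
qed

text \<open>As \<open>\<alpha>\<close> is nonzero, the first five conditions determine the conic up
  to scale and force \<open>q02\<close> to be nonzero; multiplied by
  \<open>\<alpha>\<^sup>2\<close>, the sixth becomes the stated equation.\<close>

lemma sextactic_iff:
  assumes "\<alpha> \<noteq> 0"
  shows "p \<in> sextactic_points F \<longleftrightarrow> \<alpha>\<^sup>2 * \<delta> - 3 * \<alpha> * \<beta> * \<gamma> + 2 * \<beta> ^ 3 = 0"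
proof -
  have "p \<in> sextactic_points F \<longleftrightarrow> (\<exists>Q. plane_curve 2 Q \<and> enat 5 \<le> inter_mult Q F p \<and> enat 6 \<le> inter_mult Q F p)"
    using smooth assms
    by (auto simp: sextactic_points_def osculating_conic_def inflection_iff numeral_eq_enat)
  also have "\<dots> \<longleftrightarrow> (\<exists>Q. form 2 Q \<and> Q \<noteq> 0 \<and> fps_X ^ 6 dvd ev g Q)"
  proof -
    have "plane_curve 2 Q \<and> enat 5 \<le> inter_mult Q F p \<and> enat 6 \<le> inter_mult Q F p
        \<longleftrightarrow> form 2 Q \<and> Q \<noteq> 0 \<and> fps_X ^ 6 dvd ev g Q" for Q
    proof (cases "form 2 Q")
      case True
      have "fps_X ^ 6 dvd ev g Q \<Longrightarrow> fps_X ^ 5 dvd ev g Q" using power_le_dvd[of _ 6 _ 5] by simp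
      then show ?thesis unfolding plane_curve_def inter_mult_ge_iff[OF True] by blast
    qed (simp add: plane_curve_def)
    then show ?thesis by simp
  qed
  also have "\<dots> \<longleftrightarrow> \<alpha>\<^sup>2 * \<delta> - 3 * \<alpha> * \<beta> * \<gamma> + 2 * \<beta> ^ 3 = 0" (is "?L \<longleftrightarrow> ?R")
  proof
    assume ?L
    then obtain Q where Q: "form 2 Q" "Q \<noteq> 0" "fps_X ^ 6 dvd ev g Q" by blast
    obtain q00 q01 q02 q11 q12 q22 where q: "Q = const3 q00 * l0\<^sup>2 + const3 q01 * (l0 * l1) + const3 q02 * (l0 * l2)
      + const3 q11 * l1\<^sup>2 + const3 q12 * (l1 * l2) + const3 q22 * l2\<^sup>2"
      using quadratic_decompose[OF Q(1)] .
    have eqs: "q00 = 0" "q01 = 0" "q02 * \<alpha> + q11 = 0" "q02 * \<beta> + q12 * \<alpha> = 0"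
      "q02 * \<gamma> + q12 * \<beta> + q22 * \<alpha>\<^sup>2 = 0" "q02 * \<delta> + q12 * \<gamma> + 2 * q22 * \<alpha> * \<beta> = 0"
      using Q(3) unfolding conic_dvd_iff[OF q] by blast+
    have "q02 \<noteq> 0"
    proof
      assume "q02 = 0"
      moreover from this have "q11 = 0" "q12 = 0" using eqs assms by auto
      moreover from this have "q22 = 0" using eqs assms \<open>q02 = 0\<close> by auto
      ultimately show False using Q(2) q eqs by simp
    qed
    moreover have "q02 * (\<alpha>\<^sup>2 * \<delta> - 3 * \<alpha> * \<beta> * \<gamma> + 2 * \<beta> ^ 3) = 0"
      using eqs(4-6) by algebra
    ultimately show ?R by simp
  next
    assume R: ?R
    \<comment> \<open>Solves the conditions of \<open>conic_dvd_iff\<close> successively under the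
      normalisation \<open>q02 = 1\<close>, which gives \<open>q11 = - \<alpha>\<close>.\<close>
    define q12 where "q12 = - \<beta> / \<alpha>"
    define q22 where "q22 = - (\<gamma> + q12 * \<beta>) / \<alpha>\<^sup>2"
    define Q where "Q = const3 0 * l0\<^sup>2 + const3 0 * (l0 * l1) + const3 1 * (l0 * l2)
      + const3 (- \<alpha>) * l1\<^sup>2 + const3 q12 * (l1 * l2) + const3 q22 * l2\<^sup>2"
    have q: "\<beta> + q12 * \<alpha> = 0" "\<gamma> + q12 * \<beta> + q22 * \<alpha>\<^sup>2 = 0"
      using assms by (simp_all add: q12_def q22_def)
    have "\<alpha>\<^sup>2 * (\<delta> + q12 * \<gamma> + 2 * q22 * \<alpha> * \<beta>) = 0"
      using q R by algebra
    then have "fps_X ^ 6 dvd ev g Q"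
      unfolding conic_dvd_iff[OF Q_def] using q assms by simp
    moreover have "form 2 Q"
      unfolding Q_def power2_eq_square by (intro form_add form_const3_mult form_mult[of 1 _ 1] form_l) simp_all
    \<comment> \<open>The tangent line \<open>arc 0\<close> kills all terms with \<open>l2\<close>;
      the surviving \<open>l1\<^sup>2\<close> term shows that \<open>Q\<close> is nonzero.\<close>
    moreover have "ev (arc 0) Q = fps_const (- \<alpha>) * fps_X ^ 2"
      by (simp add: Q_def ev_l flip: fps_const_neg)
    then have "Q \<noteq> 0" using assms by auto
    ultimately show ?L by blast
  qed
  finally show ?thesis .
qed

lemma H2_zero_iff:
  assumes "m = e + 2"
  shows "eval3 (H2 (Suc m) F) p = 0 \<longleftrightarrow> p \<in> higher_order_inflection_points F \<union> sextactic_points F"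
proof -
  obtain C where C: "C \<noteq> 0" "ev g (H2 (Suc m) F) = fps_const C * D1 g F (const_vec c) ^ 12 * Monge (fps_deriv (fps_deriv y))"
    using H2_arc[OF assms] .
  define T where "T = \<alpha>\<^sup>2 * \<delta> - 3 * \<alpha> * \<beta> * \<gamma> + 2 * \<beta> ^ 3"
  have "fps_nth (Monge (fps_deriv (fps_deriv y))) 0 = 4320 * T"
    unfolding T_def by (rule Monge_nth_0)
  then have "eval3 (H2 (Suc m) F) p = 0 \<longleftrightarrow> T = 0"
    using C(1) transversal
    by (simp add: eval3_p' C(2) fps_nth_power_0 D1_const_vec_nth_0[OF y_0])
  also have "\<dots> \<longleftrightarrow> (\<alpha> = 0 \<and> \<beta> = 0) \<or> (\<alpha> \<noteq> 0 \<and> p \<in> sextactic_points F)"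
    by (cases "\<alpha> = 0") (simp_all add: sextactic_iff T_def)
  also have "p \<in> sextactic_points F \<Longrightarrow> \<alpha> \<noteq> 0"
    by (simp add: sextactic_points_def inflection_iff)
  then have "(\<alpha> = 0 \<and> \<beta> = 0) \<or> (\<alpha> \<noteq> 0 \<and> p \<in> sextactic_points F)
     \<longleftrightarrow> p \<in> higher_order_inflection_points F \<union> sextactic_points F"
    using higher_order_inflection_iff by blast
  finally show ?thesis .
qed

end

lemma tangent_branch_exists:
  assumes "form (Suc m) F" "q \<in> smooth_points F"
  obtains a b c y where "tangent_branch a b c F m y" "frame.p a = q"
proof -
  obtain q1 q2 q3 where q: "q = (q1, q2, q3)" by (cases q)
  define a :: "complex^3" where "a = vector [q1, q2, q3]"
  define n :: "complex^3" where "n = vector [eval3 (dx F) q, eval3 (dy F) q, eval3 (dz F) q]"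
  have a: "a$1 = q1" "a$2 = q2" "a$3 = q3" by (simp_all add: a_def)
  have F: "eval3 F q = 0" "a \<noteq> 0" "n \<noteq> 0"
    using assms(2) q by (auto simp: smooth_points_def singular_points_def V_def vec_eq_iff forall_3 a n_def)
  from arg_cong[OF Euler[OF assms(1)], of "\<lambda>G. eval3 G q"] F(1)
  have "a$1 * n$1 + a$2 * n$2 + a$3 * n$3 = 0" by (simp add: a n_def q)
  from cross_frame_exists[OF F(2,3) this] obtain b c where bc: "det (vector [a, b, c] :: complex^3^3) = 1"
    "b$1 * n$1 + b$2 * n$2 + b$3 * n$3 = 0" "c$1 * n$1 + c$2 * n$2 + c$3 * n$3 \<noteq> 0" .
  interpret frame a b c by unfold_locales (rule bc(1))
  have p: "p = q" by (simp add: p_def a q)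
  obtain y where y: "fps_nth y 0 = 0" "ev (arc y) F = 0"
    using arc_on_curve_exists[of F] F(1) bc(3) by (auto simp: p n_def)
  have "tangent_branch a b c F m y"
    by unfold_locales (use y bc assms(1) in \<open>simp_all add: p n_def\<close>)
  then show ?thesis using that p by blast
qed


section \<open>Existence of smooth points\<close>

text \<open>Take a nonzero element \<open>w\<close> of least degree in the ideal of \<open>f\<close>
  and \<open>h\<close>. Pseudo-division shows that it divides a nonzero scalar multiple of
  \<open>f\<close>; primality of \<open>f\<close> then forces \<open>w\<close> to be
  constant.\<close>

lemma prime_elem_ideal_constant:
  fixes f h :: "'a::idom poly"
  assumes "prime_elem f" "h \<noteq> 0" "degree h < degree f"
  obtains U V r where "r \<noteq> 0" "U * f + V * h = [:r:]"
proof -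
  define I where "I w \<longleftrightarrow> (\<exists>U V. w = U * f + V * h)" for w
  have I_f: "I f" unfolding I_def by (rule exI[of _ 1], rule exI[of _ 0]) simp
  have I_h: "I h" unfolding I_def by (rule exI[of _ 0], rule exI[of _ 1]) simp
  have I_mod: "I (smult c v - w * q)" if vw: "I v" "I w" for c v w q
  proof -
    obtain U U' V V' where *: "v = U * f + V * h" "w = U' * f + V' * h"
      using vw unfolding I_def by (elim exE) (rule that)
    have "smult c v - w * q = (smult c U - U' * q) * f + (smult c V - V' * q) * h"
      unfolding * by (simp add: algebra_simps smult_add_right)
    then show ?thesis unfolding I_def by (intro exI)
  qed
  have "\<exists>n w. w \<noteq> 0 \<and> degree w = n \<and> I w" using assms(2) I_h by blast
  then obtain n where "\<exists>w. w \<noteq> 0 \<and> degree w = n \<and> I w"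
      and least: "\<forall>k<n. \<not> (\<exists>w. w \<noteq> 0 \<and> degree w = k \<and> I w)"
    using exists_least_iff[of "\<lambda>n. \<exists>w. w \<noteq> 0 \<and> degree w = n \<and> I w"] by blast
  then obtain w where w: "w \<noteq> 0" "degree w = n" "I w" by blast
  have "n < degree f"
  proof -
    have "\<not> degree h < n" using least assms(2) I_h by blast
    then show ?thesis using assms(3) by simp
  qed
  obtain c q where cq: "c \<noteq> 0" "smult c f = w * q + pseudo_mod f w"
    using pseudo_mod(1)[OF w(1), of f] by blast
  have "I (pseudo_mod f w)"
    using I_mod[OF I_f w(3), of c q] cq(2) by simp
  \<comment> \<open>The pseudo-remainder lies in the ideal and has degree below
    \<open>w\<close>.\<close>
  then have "pseudo_mod f w = 0"
    using pseudo_mod(2)[OF w(1), of f] least w(2) by blast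
  with cq have eq: "smult c f = w * q" by simp
  then have "f dvd w * q" by (metis dvd_smult dvd_refl)
  then consider "f dvd w" | "f dvd q" using prime_elem_dvd_multD[OF assms(1)] by blast
  then have "n = 0"
  proof cases
    case 1
    then show ?thesis using dvd_imp_degree_le[OF 1 w(1)] w(2) \<open>n < degree f\<close> by simp
  next
    case 2
    then obtain s where "q = f * s" by (auto simp: dvd_def)
    then have "f * [:c:] = f * (w * s)" using eq by (simp add: algebra_simps)
    moreover have "f \<noteq> 0" using assms(1) by auto
    ultimately have "[:c:] = w * s" by (simp only: mult_cancel_left simp_thms)
    moreover from this have "s \<noteq> 0" using cq(1) by auto
    ultimately show ?thesis using w by (metis add_is_0 degree_mult_eq degree_pCons_0)
  qed
  then obtain r where r: "w = [:r:]" using w(2) by (metis degree_eq_zeroE)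
  obtain U W where "w = U * f + W * h" using w(3) unfolding I_def by (elim exE)
  then have "U * f + W * h = [:r:]" by (simp only: r)
  moreover have "r \<noteq> 0" using w(1) r by simp
  ultimately show ?thesis by (rule that[rotated])
qed

text \<open>Where the constant of the Bezout identity and the leading coefficient survive
  specialisation, the specialised \<open>f\<close> still has a root, and the identity prevents its
  derivative from vanishing there.\<close>

lemma prime_elem_simple_root:
  fixes f :: "'a::{idom,ring_char_0} poly"
  assumes "prime_elem f" "degree f > 0"
  obtains g where "g \<noteq> 0"
    "\<And>h :: 'a \<Rightarrow> complex. (\<And>a b. h (a + b) = h a + h b) \<Longrightarrow> (\<And>a b. h (a * b) = h a * h b) \<Longrightarrow> h 0 = 0 \<Longrightarrow>
       h g \<noteq> 0 \<Longrightarrow> \<exists>u. hom_poly h u f = 0 \<and> hom_poly h u (pderiv f) \<noteq> 0"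
proof -
  have "pderiv f \<noteq> 0" "degree (pderiv f) < degree f"
    using assms(2) by (auto simp: pderiv_eq_0_iff degree_pderiv)
  then obtain U W r where r: "r \<noteq> 0" "U * f + W * pderiv f = [:r:]"
    by (rule prime_elem_ideal_constant[OF assms(1)])
  show ?thesis
  proof (rule that[of "r * lead_coeff f"])
    show "r * lead_coeff f \<noteq> 0" using r(1) assms(2) by auto
    fix h :: "'a \<Rightarrow> complex"
    assume add: "\<And>a b. h (a + b) = h a + h b" and mult: "\<And>a b. h (a * b) = h a * h b" and 0: "h 0 = 0"
      and g: "h (r * lead_coeff f) \<noteq> 0"
    have "coeff (map_poly h f) (degree f) \<noteq> 0"
      using g by (simp add: mult coeff_map_poly 0)
    then have "degree (map_poly h f) \<noteq> 0"
      using le_degree assms(2) by fastforce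
    then obtain u where u: "hom_poly h u f = 0"
      using fundamental_theorem_of_algebra[of "map_poly h f"] by (auto simp: hom_poly_def constant_degree)
    have "hom_poly h u (U * f + W * pderiv f) = h r"
      unfolding r(2) by (simp add: hom_poly_def map_poly_pCons 0)
    then have "hom_poly h u W * hom_poly h u (pderiv f) = h r"
      by (simp add: hom_poly_add[OF add 0] hom_poly_mult[OF add 0 mult] u)
    then show "\<exists>u. hom_poly h u f = 0 \<and> hom_poly h u (pderiv f) \<noteq> 0"
      using u g by (auto simp: mult)
  qed
qed

lemma hom_poly_eval:
  assumes "\<And>a b. h (a + b) = h a + h b" "\<And>a b. h (a * b) = h a * h b" "h 0 = 0" "h c = u"
  shows "hom_poly h u p = h (poly p c)"
  by (induction p) (simp_all add: hom_poly_pCons assms, simp add: hom_poly_def)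

text \<open>The nonzero coordinate guarantees that the triple built from it represents a projective
  point.\<close>

lemma nonzero_value:
  fixes h :: "complex poly"
  assumes "h \<noteq> 0" obtains w where "w \<noteq> 0" "poly h w \<noteq> 0"
proof -
  have "finite ({w. poly h w = 0} \<union> {0})" using poly_roots_finite[OF assms] by simp
  then have "{w. poly h w = 0} \<union> {0} \<noteq> UNIV" using infinite_UNIV_char_0[where 'a = complex] by metis
  then show ?thesis using that by blast
qed

lemma nonzero_value2:
  fixes h :: "complex poly poly"
  assumes "h \<noteq> 0" obtains v w where "w \<noteq> 0" "poly (poly h [:v:]) w \<noteq> 0"
proof -
  have "infinite (range (\<lambda>v::complex. [:v:]))"
    using infinite_UNIV_char_0[where 'a = complex] by (simp add: finite_image_iff inj_on_def)
  then have "\<not> range (\<lambda>v::complex. [:v:]) \<subseteq> {s. poly h s = 0}"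
    using poly_roots_finite[OF assms] finite_subset by blast
  then obtain v where "poly h [:v:] \<noteq> 0" by blast
  then show ?thesis using that nonzero_value by metis
qed

lemma irreducible_form_no_factor:
  assumes "irreducible F" "form d F" "form j Q" "Q dvd F" "0 < j" "j < d"
  shows False
proof -
  obtain A where A: "F = Q * A" using assms(4) by (auto simp: dvd_def)
  have "F \<noteq> 0" using assms(1) by auto
  have "\<not> Q dvd 1"
  proof
    assume "Q dvd 1"
    then obtain B where "1 = Q * B" by (auto simp: dvd_def)
    \<comment> \<open>A divisor of 1 is nonzero at the origin, where forms of positive degree
      vanish.\<close>
    from arg_cong[OF this, of "\<lambda>G. eval3 G (0, 0, 0)"] have "eval3 Q (0, 0, 0) \<noteq> 0" by auto
    moreover obtain i where "j = Suc i" using assms(5) by (cases j) auto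
    then obtain A B C where "Q = X * A + Y * B + Z * C" using form_Suc_decompose assms(3) by metis
    ultimately show False by simp
  qed
  then have "A dvd 1" using irreducibleD[OF assms(1) A] by blast
  then obtain c where "A = const3 c"
    by (auto simp: is_unit_poly_iff const3_def)
  then have "form j F" using assms(3) A by (metis form_const3_mult mult.commute)
  then show False using form_degree_unique[OF assms(2) _ \<open>F \<noteq> 0\<close>] assms(6) by blast
qed

text \<open>If x occurs in \<open>F\<close>, a suitable value of (y, z) leaves a simple root in x;
  if only y and z occur, the same works in y. A form in z alone is divisible by \<open>Z\<close>,
  which irreducibility excludes from degree 2 on.\<close>

lemma smooth_point_exists:
  assumes "irreducible F" "form d F" "2 \<le> d"
  shows "smooth_points F \<noteq> {}"
proof -
  have prime: "prime_elem F" using assms(1) by (rule irreducible_imp_prime_poly)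
  have smoothI: "q \<in> smooth_points F"
    if "q \<noteq> (0, 0, 0)" "eval3 F q = 0" "eval3 (dx F) q \<noteq> 0 \<or> eval3 (dy F) q \<noteq> 0" for q
    using that by (auto simp: smooth_points_def singular_points_def V_def)
  show ?thesis
  proof (cases "degree F = 0")
    case False
    then obtain g where g: "g \<noteq> 0"
      "\<And>h :: complex poly poly \<Rightarrow> complex. (\<And>a b. h (a + b) = h a + h b) \<Longrightarrow> (\<And>a b. h (a * b) = h a * h b) \<Longrightarrow> h 0 = 0 \<Longrightarrow>
       h g \<noteq> 0 \<Longrightarrow> \<exists>u. hom_poly h u F = 0 \<and> hom_poly h u (pderiv F) \<noteq> 0"
      using prime_elem_simple_root[OF prime] by auto
    obtain v w where vw: "w \<noteq> 0" "poly (poly g [:v:]) w \<noteq> 0" using nonzero_value2[OF g(1)] .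
    define h where "h q = poly (poly q [:v:]) w" for q
    have h: "\<And>a b. h (a + b) = h a + h b" "\<And>a b. h (a * b) = h a * h b" "h 0 = 0" "h g \<noteq> 0"
      using vw by (simp_all add: h_def)
    have ev: "hom_poly h u G = eval3 G (u, v, w)" for u G
    proof -
      have "hom_poly h u G = h (poly G [:[:u:]:])" by (rule hom_poly_eval[OF h(1-3)]) (simp add: h_def)
      then show ?thesis by (simp only: h_def eval3.simps)
    qed
    obtain u where "eval3 F (u, v, w) = 0" "eval3 (dx F) (u, v, w) \<noteq> 0"
      using g(2)[OF h] unfolding ev dx_def by blast
    then show ?thesis using smoothI[of "(u, v, w)"] vw(1) by auto
  next
    case True
    then obtain f where f: "F = [:f:]" by (rule degree_eq_zeroE)
    show ?thesis
    proof (cases "degree f = 0")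
      case False
      have "prime_elem f" using prime by (simp add: f prime_elem_const_poly_iff)
      then obtain g where g: "g \<noteq> 0"
        "\<And>h :: complex poly \<Rightarrow> complex. (\<And>a b. h (a + b) = h a + h b) \<Longrightarrow> (\<And>a b. h (a * b) = h a * h b) \<Longrightarrow> h 0 = 0 \<Longrightarrow>
         h g \<noteq> 0 \<Longrightarrow> \<exists>u. hom_poly h u f = 0 \<and> hom_poly h u (pderiv f) \<noteq> 0"
        using prime_elem_simple_root[of f] False by auto
      obtain w where w: "w \<noteq> 0" "poly g w \<noteq> 0" using nonzero_value[OF g(1)] .
      define h where "h q = poly q w" for q
      have h: "\<And>a b. h (a + b) = h a + h b" "\<And>a b. h (a * b) = h a * h b" "h 0 = 0" "h g \<noteq> 0"
        using w by (simp_all add: h_def)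
      have ev: "hom_poly h v G = eval3 [:G:] (0, v, w)" for v G
      proof -
        have "hom_poly h v G = h (poly G [:v:])" by (rule hom_poly_eval[OF h(1-3)]) (simp add: h_def)
        then show ?thesis by (simp add: h_def eval3.simps)
      qed
      obtain v where "eval3 F (0, v, w) = 0" "eval3 (dy F) (0, v, w) \<noteq> 0"
        using g(2)[OF h] unfolding ev by (auto simp: f dy_def map_poly_pCons)
      then show ?thesis using smoothI[of "(0, v, w)"] w(1) by auto
    next
      case True
      then obtain h where h: "f = [:h:]" by (rule degree_eq_zeroE)
      have "d = Suc (d - 1)" using assms(3) by simp
      then obtain A B C where "F = X * A + Y * B + Z * C" using form_Suc_decompose assms(2) by metis
      have "poly h 0 = 0"
        using assms(2,3) unfolding form_def f h poly_0_coeff_0 by (metis coeff_pCons_0 add_0 not_numeral_le_zero)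
      then obtain h' where "h = [:0, 1:] * h'"
        by (metis poly_eq_0_iff_dvd dvd_def minus_zero)
      then have "F = Z * [:[:h':]:]" by (simp add: f h Z_def)
      then have "Z dvd F" by (rule dvdI)
      then show ?thesis using irreducible_form_no_factor[OF assms(1,2) form_vars(3)] assms(3) by simp
    qed
  qed
qed


section \<open>Branches on which the Monge expression vanishes\<close>

lemma fps_X_mult_deriv_power: "fps_X * fps_deriv (fps_X ^ n) = (of_nat n * fps_X ^ n :: 'a::comm_ring_1 fps)"
proof (induction n)
  case (Suc n)
  have "fps_X * fps_deriv (fps_X ^ Suc n) = fps_X * (fps_X * fps_deriv (fps_X ^ n)) + fps_X * (fps_X ^ n :: 'a fps)"
    by (simp add: distrib_left)
  then show ?case unfolding Suc.IH by (simp add: algebra_simps)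
qed simp

text \<open>If u has order n, the coefficient of t^(3n-3) in the Monge expression is n(4n^2 + 18n +
  18) times the cube of the leading coefficient; for n > 0 this is nonzero.\<close>

lemma Monge_0_unit:
  fixes u :: "complex fps"
  assumes "Monge u = 0" "u \<noteq> 0"
  shows "fps_nth u 0 \<noteq> 0"
proof (cases "subdegree u")
  case 0
  then show ?thesis using assms(2) by (metis nth_subdegree_nonzero)
next
  case (Suc j)
  define k :: "complex fps" where "k = of_nat (subdegree u)"
  define w where "w = fps_shift (subdegree u) u"
  define x :: "complex fps" where "x = fps_X ^ subdegree u"
  have u: "u = x * w" unfolding x_def w_def by (metis subdegree_decompose mult.commute)
  have w0: "fps_nth w 0 \<noteq> 0" using assms(2) by (simp add: w_def)
  have x: "fps_X * fps_deriv x = k * x"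
    unfolding x_def k_def by (rule fps_X_mult_deriv_power)
  have [simp]: "fps_deriv k = 0" by (simp add: k_def)
  \<comment> \<open>With \<open>u = x * w\<close>, the product \<open>fps_X ^ i\<close> times the
    i-th derivative of \<open>u\<close> is \<open>x\<close> times \<open>vi\<close>. Working with t
    d/dt treats orders 1 and 2 like all others.\<close>
  define v1 where "v1 = k * w + fps_X * fps_deriv w"
  define v2 where "v2 = (k - 1) * v1 + fps_X * fps_deriv v1"
  define v3 where "v3 = (k - 2) * v2 + fps_X * fps_deriv v2"
  have theta: "fps_X * fps_deriv (x * v) = x * (k * v + fps_X * fps_deriv v)" for v
    using x by (simp add: algebra_simps)
  have 1: "fps_X * fps_deriv u = x * v1"
    unfolding u theta v1_def ..
  have 2: "fps_X\<^sup>2 * fps_deriv (fps_deriv u) = x * v2"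
  proof -
    have "fps_X\<^sup>2 * fps_deriv (fps_deriv u) = fps_X * fps_deriv (fps_X * fps_deriv u) - fps_X * fps_deriv u"
      by (simp add: power2_eq_square algebra_simps)
    also have "\<dots> = x * v2"
      unfolding 1 theta v2_def by (simp add: algebra_simps)
    finally show ?thesis .
  qed
  have 3: "fps_X ^ 3 * fps_deriv (fps_deriv (fps_deriv u)) = x * v3"
  proof -
    have "fps_X ^ 3 * fps_deriv (fps_deriv (fps_deriv u))
        = fps_X * fps_deriv (fps_X\<^sup>2 * fps_deriv (fps_deriv u)) - 2 * (fps_X\<^sup>2 * fps_deriv (fps_deriv u))"
      by (simp add: power2_eq_square power3_eq_cube algebra_simps)
    also have "\<dots> = x * v3"
      unfolding 2 theta v3_def by (simp add: algebra_simps)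
    finally show ?thesis .
  qed
  have "fps_X ^ 3 * Monge u = 9 * u\<^sup>2 * (fps_X ^ 3 * fps_deriv (fps_deriv (fps_deriv u)))
     - 45 * u * (fps_X * fps_deriv u) * (fps_X\<^sup>2 * fps_deriv (fps_deriv u)) + 40 * (fps_X * fps_deriv u) ^ 3"
    by (simp add: Monge_def power2_eq_square power3_eq_cube algebra_simps)
  also have "\<dots> = x ^ 3 * (9 * w\<^sup>2 * v3 - 45 * w * v1 * v2 + 40 * v1 ^ 3)"
    unfolding 1 2 3 unfolding u by (simp add: power2_eq_square power3_eq_cube algebra_simps)
  finally have "x ^ 3 * (9 * w\<^sup>2 * v3 - 45 * w * v1 * v2 + 40 * v1 ^ 3) = 0"
    using assms(1) by simp
  moreover have "x \<noteq> 0" by (simp add: x_def)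
  ultimately have "9 * w\<^sup>2 * v3 - 45 * w * v1 * v2 + 40 * v1 ^ 3 = 0" by simp
  then have "fps_nth (9 * w\<^sup>2 * v3 - 45 * w * v1 * v2 + 40 * v1 ^ 3) 0 = 0" by simp
  define \<kappa> :: complex where "\<kappa> = of_nat (subdegree u)"
  have k0: "fps_nth k 0 = \<kappa>" by (simp add: k_def \<kappa>_def)
  have "fps_nth v1 0 = \<kappa> * fps_nth w 0" "fps_nth v2 0 = (\<kappa> - 1) * \<kappa> * fps_nth w 0"
    "fps_nth v3 0 = (\<kappa> - 2) * (\<kappa> - 1) * \<kappa> * fps_nth w 0"
    by (simp_all add: v1_def v2_def v3_def k0)
  with \<open>fps_nth _ 0 = 0\<close> have "\<kappa> * (4 * \<kappa>\<^sup>2 + 18 * \<kappa> + 18) * fps_nth w 0 ^ 3 = 0"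
    by (simp add: fps_nth_power_0 power2_eq_square power3_eq_cube algebra_simps)
  moreover have "\<kappa> * (4 * \<kappa>\<^sup>2 + 18 * \<kappa> + 18)
      = of_nat (subdegree u * (4 * (subdegree u)\<^sup>2 + 18 * subdegree u + 18))"
    by (simp add: \<kappa>_def)
  ultimately have "subdegree u * (4 * (subdegree u)\<^sup>2 + 18 * subdegree u + 18) = 0"
    using w0 by (metis mult_eq_0_iff of_nat_eq_0_iff power_eq_0_iff)
  then show ?thesis using Suc by simp
qed

lemma fps_linear_ode:
  fixes h :: "complex fps"
  obtains B where "fps_deriv B = h * B" "fps_nth B 0 = 1"
proof
  show "fps_deriv (fps_exp 1 oo fps_integral0 h) = h * (fps_exp 1 oo fps_integral0 h)"
    by (simp add: fps_compose_deriv fps_deriv_fps_integral mult.commute)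
  show "fps_nth (fps_exp 1 oo fps_integral0 h) 0 = 1" by simp
qed

text \<open>On a conic, \<open>u = y''\<close> satisfies \<open>B^3 u = const\<close> for an affine function \<open>B\<close> of \<open>t\<close> and \<open>y\<close>. So let
  \<open>B = u^(-1/3)\<close>, up to a factor; the Monge equation says that \<open>B'' / u\<close> is constant.\<close>

lemma Monge_0_conic:
  fixes y :: "complex fps"
  defines "u \<equiv> fps_deriv (fps_deriv y)"
  assumes "Monge u = 0" "fps_nth u 0 \<noteq> 0" and y0: "fps_nth y 0 = 0" "fps_nth y 1 = 0"
  obtains \<beta> \<kappa> where
    "(1 + fps_const \<beta> * fps_X + fps_const \<kappa> * y) * y = fps_const (fps_nth y 2) * fps_X\<^sup>2"
proof -
  let ?D = fps_deriv
  have u_inv: "u * inverse u = 1" using assms(3) by (rule inverse_mult_eq_1')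
  \<comment> \<open>The logarithmic derivative of u^(-1/3); the normalisation
    \<open>B(0) = 1\<close> avoids choosing a cube root.\<close>
  obtain B where B: "?D B = (- ?D u * inverse u * fps_const (1/3)) * B" "fps_nth B 0 = 1"
    by (rule fps_linear_ode)
  have E1: "3 * u * ?D B + ?D u * B = 0"
  proof -
    have "3 * u * ?D B = - ((3 * fps_const (1/3)) * (u * inverse u) * (?D u * B))"
      unfolding B(1) by (simp add: algebra_simps)
    also have "3 * fps_const (1/3) = (1 :: complex fps)" by (simp add: numeral_fps_const)
    finally show ?thesis by (simp add: u_inv)
  qed
  from arg_cong[OF E1, of ?D]
  have E2: "4 * ?D u * ?D B + 3 * u * ?D (?D B) + ?D (?D u) * B = 0"
    by (simp add: algebra_simps)
  from arg_cong[OF E2, of ?D]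
  have E3: "5 * ?D (?D u) * ?D B + 7 * ?D u * ?D (?D B) + 3 * u * ?D (?D (?D B)) + ?D (?D (?D u)) * B = 0"
    by (simp add: algebra_simps)
  define K where "K = ?D (?D B) * inverse u"
  have K: "K * u = ?D (?D B)" using u_inv by (simp add: K_def mult.assoc mult.commute[of _ u])
  from arg_cong[OF K, of ?D] have K': "?D K * u + K * ?D u = ?D (?D (?D B))" by (simp add: algebra_simps)
  have M: "9 * u\<^sup>2 * ?D (?D (?D u)) - 45 * u * ?D u * ?D (?D u) + 40 * ?D u ^ 3 = 0"
    using assms(2) by (simp add: Monge_def)
  \<comment> \<open>Eliminating the derivatives of \<open>B\<close> by \<open>E1\<close>,
    \<open>E2\<close>, \<open>E3\<close> leaves \<open>B\<close> times the Monge expression.\<close>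
  have "27 * u ^ 4 * ?D K = - B * (9 * u\<^sup>2 * ?D (?D (?D u)) - 45 * u * ?D u * ?D (?D u) + 40 * ?D u ^ 3)"
    using E1 E2 E3 K K' by algebra
  moreover have "u \<noteq> 0" using assms(3) by auto
  ultimately have "?D K = 0" unfolding M by simp
  then obtain k where k: "K = fps_const k" by (metis fps_deriv_eq_0_iff)
  have "?D (?D (B - fps_const k * y)) = 0"
    using K by (simp add: k u_def)
  then obtain \<beta> where \<beta>: "?D (B - fps_const k * y) = fps_const \<beta>" by (metis fps_deriv_eq_0_iff)
  then have "?D (B - fps_const k * y - fps_const \<beta> * fps_X) = 0" by simp
  then have "B - fps_const k * y - fps_const \<beta> * fps_X = fps_const (fps_nth (B - fps_const k * y - fps_const \<beta> * fps_X) 0)"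
    by (simp only: fps_deriv_eq_0_iff)
  then have B': "B = 1 + fps_const \<beta> * fps_X + fps_const k * y"
    using B(2) y0 by (simp add: algebra_simps)
  \<comment> \<open>The coefficient \<open>k/2\<close> makes the third derivative of
    \<open>2 * G\<close> twice the left side of \<open>E1\<close>, so \<open>G\<close> is a
    polynomial in t of degree at most 2.\<close>
  define G where "G = (1 + fps_const \<beta> * fps_X + fps_const (k/2) * y) * y"
  have DB: "?D B = fps_const \<beta> + fps_const k * ?D y" by (simp add: B')
  have G: "2 * G = (B + 1 + fps_const \<beta> * fps_X) * y"
  proof -
    have "2 * fps_const (k/2) = fps_const k" by (simp add: numeral_fps_const)
    then have "2 * G = (2 + 2 * (fps_const \<beta> * fps_X) + fps_const k * y) * y"
      unfolding G_def by (simp add: distrib_right distrib_left mult.assoc[symmetric])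
    then show ?thesis by (simp add: B' algebra_simps)
  qed
  have "?D (?D (?D (2 * G))) = 2 * (3 * u * ?D B + ?D u * B)"
    unfolding G u_def by (simp add: DB B' algebra_simps)
  then have "?D (?D (?D G)) = 0" using E1 by simp
  then have *: "fps_nth (?D (?D (?D G))) n = 0" for n by simp
  have "fps_nth G (n + 3) = 0" for n
    using *[of n] by (auto simp: eval_nat_numeral simp del: of_nat_Suc)
  moreover have "fps_nth G 0 = 0" "fps_nth G 1 = 0" "fps_nth G 2 = fps_nth y 2"
    using y0 by (simp_all add: G_def fps_mult_nth eval_nat_numeral)
  ultimately have "G = fps_const (fps_nth y 2) * fps_X\<^sup>2"
  proof (intro fps_ext)
    fix n :: nat
    assume G: "\<And>n. fps_nth G (n + 3) = 0" "fps_nth G 0 = 0" "fps_nth G 1 = 0" "fps_nth G 2 = fps_nth y 2"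
    have "n = 0 \<or> n = 1 \<or> n = 2 \<or> n - 3 + 3 = n \<and> n \<noteq> 2" by arith
    then show "fps_nth G n = fps_nth (fps_const (fps_nth y 2) * fps_X\<^sup>2) n"
      using G(1)[of "n - 3"] G(2-4) by (auto simp: fps_X_power_nth)
  qed
  then show ?thesis using that unfolding G_def by blast
qed

text \<open>The powers of \<open>y\<close> have distinct orders, so the first nonzero coefficient
  decides.\<close>

lemma series_subdegree:
  fixes y :: "complex fps"
  assumes y: "y \<noteq> 0" "fps_nth y 0 = 0" and i: "i \<le> n" "r i \<noteq> 0" "\<forall>j<i. r j = 0"
  defines "S \<equiv> \<Sum>j\<le>n. fps_const (r j) * y ^ j"
  shows "S \<noteq> 0 \<and> subdegree S = i * subdegree y"
proof -
  define T where "T = (\<Sum>j\<le>n. if j < i then 0 else fps_const (r j) * y ^ (j - i))"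
  have "fps_const (r j) * y ^ j = y ^ i * (if j < i then 0 else fps_const (r j) * y ^ (j - i))" for j
    using i(3) by (auto simp: not_less simp flip: power_add)
  then have S: "S = y ^ i * T" by (simp add: S_def T_def sum_distrib_left)
  have "fps_nth T 0 = (\<Sum>j\<le>n. if j = i then r j else 0)"
    unfolding T_def fps_sum_nth
    by (intro sum.cong) (auto simp: fps_nth_power_0 y(2) power_0_left)
  then have "fps_nth T 0 \<noteq> 0" using i by simp
  then have "T \<noteq> 0" "subdegree T = 0" by (auto simp: subdegree_eq_0_iff)
  then show ?thesis using y(1) by (simp add: S)
qed

section \<open>Normal forms modulo a line and modulo a conic\<close>

definition binary_forms :: "cpoly3 \<Rightarrow> cpoly3 \<Rightarrow> nat \<Rightarrow> cpoly3 set" where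
  "binary_forms u v n = range (\<lambda>r. \<Sum>i\<le>n. const3 (r i) * (u ^ (n - i) * v ^ i))"

lemma binary_formsI: "A = (\<Sum>i\<le>n. const3 (r i) * (u ^ (n - i) * v ^ i)) \<Longrightarrow> A \<in> binary_forms u v n"
  unfolding binary_forms_def by blast

lemma binary_forms_const: "const3 k \<in> binary_forms u v 0"
  unfolding binary_forms_def by (rule range_eqI[of _ _ "\<lambda>_. k"]) simp

lemma binary_forms_add:
  assumes "A \<in> binary_forms u v n" "B \<in> binary_forms u v n" shows "A + B \<in> binary_forms u v n"
proof -
  obtain r s where "A = (\<Sum>i\<le>n. const3 (r i) * (u ^ (n - i) * v ^ i))" "B = (\<Sum>i\<le>n. const3 (s i) * (u ^ (n - i) * v ^ i))"
    using assms unfolding binary_forms_def by blast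
  then have "A + B = (\<Sum>i\<le>n. const3 (r i + s i) * (u ^ (n - i) * v ^ i))"
    by (simp add: sum.distrib distrib_right)
  then show ?thesis by (rule binary_formsI)
qed

lemma binary_forms_scale:
  assumes "A \<in> binary_forms u v n" shows "const3 k * A \<in> binary_forms u v n"
proof -
  obtain r where "A = (\<Sum>i\<le>n. const3 (r i) * (u ^ (n - i) * v ^ i))"
    using assms unfolding binary_forms_def by blast
  then have "const3 k * A = (\<Sum>i\<le>n. const3 (k * r i) * (u ^ (n - i) * v ^ i))"
    by (simp add: sum_distrib_left mult.assoc)
  then show ?thesis by (rule binary_formsI)
qed

lemma binary_forms_mult_left:
  assumes "A \<in> binary_forms u v n" shows "u * A \<in> binary_forms u v (Suc n)"
proof -
  obtain r where A: "A = (\<Sum>i\<le>n. const3 (r i) * (u ^ (n - i) * v ^ i))"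
    using assms unfolding binary_forms_def by blast
  define s where "s i = (if i \<le> n then r i else 0)" for i
  have "(\<Sum>i\<le>Suc n. const3 (s i) * (u ^ (Suc n - i) * v ^ i)) = (\<Sum>i\<le>n. const3 (s i) * (u ^ (Suc n - i) * v ^ i))"
    by (simp add: s_def)
  also have "\<dots> = (\<Sum>i\<le>n. u * (const3 (r i) * (u ^ (n - i) * v ^ i)))"
    by (intro sum.cong) (auto simp: s_def Suc_diff_le algebra_simps)
  finally have "u * A = (\<Sum>i\<le>Suc n. const3 (s i) * (u ^ (Suc n - i) * v ^ i))"
    by (simp add: A sum_distrib_left)
  then show ?thesis by (rule binary_formsI)
qed

lemma binary_forms_mult_right:
  assumes "A \<in> binary_forms u v n" shows "v * A \<in> binary_forms u v (Suc n)"
proof -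
  obtain r where A: "A = (\<Sum>i\<le>n. const3 (r i) * (u ^ (n - i) * v ^ i))"
    using assms unfolding binary_forms_def by blast
  have "(\<Sum>i\<le>Suc n. const3 (case_nat 0 r i) * (u ^ (Suc n - i) * v ^ i))
      = (\<Sum>i\<le>n. v * (const3 (r i) * (u ^ (n - i) * v ^ i)))"
    by (subst sum.atMost_Suc_shift) (simp add: algebra_simps)
  then have "v * A = (\<Sum>i\<le>Suc n. const3 (case_nat 0 r i) * (u ^ (Suc n - i) * v ^ i))"
    by (simp add: A sum_distrib_left)
  then show ?thesis by (rule binary_formsI)
qed

text \<open>After \<open>u\<close> becomes 1, a binary form is a polynomial in \<open>y\<close>, so
  its order is a multiple of that of \<open>y\<close>. This makes restriction injective on
  remainders and supplies the parity used for conics.\<close>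

lemma ev_binary_form:
  assumes "A \<in> binary_forms u v n" "ev g u = 1" "ev g v = y" "y \<noteq> 0" "fps_nth y 0 = 0" "A \<noteq> 0"
  shows "ev g A \<noteq> 0 \<and> subdegree y dvd subdegree (ev g A)"
proof -
  obtain r where A: "A = (\<Sum>i\<le>n. const3 (r i) * (u ^ (n - i) * v ^ i))"
    using assms(1) unfolding binary_forms_def by blast
  have "\<exists>i. i \<le> n \<and> r i \<noteq> 0"
  proof (rule ccontr)
    assume "\<nexists>i. i \<le> n \<and> r i \<noteq> 0"
    then have "A = 0" unfolding A by (intro sum.neutral) auto
    then show False using assms(6) by simp
  qed
  then obtain i where i: "i \<le> n" "r i \<noteq> 0" "\<forall>j<i. r j = 0"
    using exists_least_iff[of "\<lambda>i. i \<le> n \<and> r i \<noteq> 0"] by (meson less_imp_le_nat order_trans)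
  have "ev g A = (\<Sum>j\<le>n. fps_const (r j) * y ^ j)"
    by (simp add: A ev_sum assms(2,3))
  with series_subdegree[of y, OF assms(4,5) i] show ?thesis by simp
qed

context frame
begin

lemma decompose_mod_line:
  "form n G \<Longrightarrow> \<exists>A B. B \<in> binary_forms l0 l1 n \<and> G = l2 * A + B"
proof (induction n arbitrary: G)
  case 0
  then obtain k where "G = const3 k" by (rule form_0_obtain_const)
  then show ?case using binary_forms_const by (intro exI[of _ 0] exI[of _ G]) simp
next
  case (Suc n)
  obtain G0 G1 G2 where G: "form n G0" "form n G1" "form n G2" "G = l0 * G0 + l1 * G1 + l2 * G2"
    using frame_decompose[OF Suc.prems] .
  obtain A B where 0: "B \<in> binary_forms l0 l1 n" "G0 = l2 * A + B" using Suc.IH[OF G(1)] by blast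
  obtain A' B' where 1: "B' \<in> binary_forms l0 l1 n" "G1 = l2 * A' + B'" using Suc.IH[OF G(2)] by blast
  have "G = l2 * (l0 * A + l1 * A' + G2) + (l0 * B + l1 * B')"
    unfolding G(4) 0(2) 1(2) by (simp add: algebra_simps)
  moreover have "l0 * B + l1 * B' \<in> binary_forms l0 l1 (Suc n)"
    using 0(1) 1(1) by (intro binary_forms_add binary_forms_mult_left binary_forms_mult_right)
  ultimately show ?case by blast
qed

text \<open>On \<open>arc 0\<close> the forms \<open>l0\<close> and \<open>l1\<close> become 1 and
  t, so a remainder free of \<open>l2\<close> that vanishes there is zero.\<close>

lemma line_dvd:
  assumes "form n G" "ev (arc 0) G = 0" shows "l2 dvd G"
proof -
  obtain A B where B: "B \<in> binary_forms l0 l1 n" "G = l2 * A + B"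
    using decompose_mod_line[OF assms(1)] by blast
  have "ev (arc 0) B = 0" using assms(2) by (simp add: B(2) ev_l)
  then have "B = 0" using ev_binary_form[OF B(1) ev_l(1,2)[of 0]] by auto
  then show ?thesis by (simp add: B(2))
qed

text \<open>The homogenisation of the equation produced by \<open>Monge_0_conic\<close>.\<close>

definition conic :: "complex \<Rightarrow> complex \<Rightarrow> complex \<Rightarrow> cpoly3" where
  "conic \<alpha> \<beta> \<kappa> = l2 * (l0 + const3 \<beta> * l1 + const3 \<kappa> * l2) - const3 \<alpha> * (l1 * l1)"

text \<open>As \<open>\<alpha>\<close> is invertible, the conic rewrites \<open>l1 * l1\<close> by
  terms of lower degree in \<open>l1\<close>, so remainders are at most linear in
  \<open>l1\<close>.\<close>

lemma decompose_mod_conic: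
  assumes "\<alpha> \<noteq> 0"
  shows "form (Suc n) G \<Longrightarrow> \<exists>A B C. B \<in> binary_forms l0 l2 (Suc n) \<and> C \<in> binary_forms l0 l2 n
    \<and> G = conic \<alpha> \<beta> \<kappa> * A + B + l1 * C"
proof (induction n arbitrary: G)
  case 0
  obtain G0 G1 G2 where G: "form 0 G0" "form 0 G1" "form 0 G2" "G = l0 * G0 + l1 * G1 + l2 * G2"
    using frame_decompose[OF 0] .
  have c: "H \<in> binary_forms l0 l2 0" if "form 0 H" for H
    using form_0_obtain_const[OF that] binary_forms_const by metis
  have "l0 * G0 + l2 * G2 \<in> binary_forms l0 l2 (Suc 0)"
    using G(1,3) by (intro binary_forms_add binary_forms_mult_left binary_forms_mult_right c)
  moreover have "G = conic \<alpha> \<beta> \<kappa> * 0 + (l0 * G0 + l2 * G2) + l1 * G1"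
    by (simp add: G(4))
  ultimately show ?case using c[OF G(2)] by blast
next
  case (Suc n)
  let ?Q = "conic \<alpha> \<beta> \<kappa>"
  obtain G0 G1 G2 where G: "form (Suc n) G0" "form (Suc n) G1" "form (Suc n) G2" "G = l0 * G0 + l1 * G1 + l2 * G2"
    using frame_decompose[OF Suc.prems] .
  obtain A0 B0 C0 where 0: "B0 \<in> binary_forms l0 l2 (Suc n)" "C0 \<in> binary_forms l0 l2 n" "G0 = ?Q * A0 + B0 + l1 * C0"
    using Suc.IH[OF G(1)] by blast
  obtain A1 B1 C1 where 1: "B1 \<in> binary_forms l0 l2 (Suc n)" "C1 \<in> binary_forms l0 l2 n" "G1 = ?Q * A1 + B1 + l1 * C1"
    using Suc.IH[OF G(2)] by blast
  obtain A2 B2 C2 where 2: "B2 \<in> binary_forms l0 l2 (Suc n)" "C2 \<in> binary_forms l0 l2 n" "G2 = ?Q * A2 + B2 + l1 * C2"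
    using Suc.IH[OF G(3)] by blast
  define i where "i = const3 (1 / \<alpha>)"
  have "i * const3 \<alpha> = 1"
    using assms by (simp add: i_def flip: const3_simps(2,6))
  then have l1: "l1 * l1 = i * (l2 * (l0 + const3 \<beta> * l1 + const3 \<kappa> * l2) - ?Q)"
    by (simp add: conic_def mult.assoc[symmetric])
  define A where "A = l0 * A0 + l1 * A1 + l2 * A2 - i * C1"
  define B where "B = l0 * B0 + l2 * B2 + i * (l2 * (l0 * C1 + const3 \<kappa> * (l2 * C1)))"
  define C where "C = l0 * C0 + B1 + l2 * C2 + i * (const3 \<beta> * (l2 * C1))"
  have "G = ?Q * (l0 * A0 + l1 * A1 + l2 * A2) + l0 * B0 + l2 * B2
      + l1 * (l0 * C0 + B1 + l2 * C2) + l1 * l1 * C1"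
    unfolding G(4) 0(3) 1(3) 2(3) by (simp add: algebra_simps)
  also have "\<dots> = ?Q * A + B + l1 * C"
    unfolding l1 A_def B_def C_def by (simp add: algebra_simps)
  finally have "G = ?Q * A + B + l1 * C" .
  moreover have "B \<in> binary_forms l0 l2 (Suc (Suc n))" "C \<in> binary_forms l0 l2 (Suc n)"
    unfolding B_def C_def i_def using 0 1 2
    by (intro binary_forms_add binary_forms_scale binary_forms_mult_left binary_forms_mult_right; simp)+
  ultimately show ?case by blast
qed

text \<open>The remainder has order \<open>2i\<close> from \<open>B\<close> and \<open>2j + 1\<close> from \<open>l1 C\<close>, so both vanish.\<close>

lemma conic_dvd:
  assumes "\<alpha> \<noteq> 0" "subdegree y = 2" and "ev (arc y) (conic \<alpha> \<beta> \<kappa>) = 0"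
    and "form (Suc n) G" "ev (arc y) G = 0"
  shows "conic \<alpha> \<beta> \<kappa> dvd G"
proof -
  obtain A B C where BC: "B \<in> binary_forms l0 l2 (Suc n)" "C \<in> binary_forms l0 l2 n" "G = conic \<alpha> \<beta> \<kappa> * A + B + l1 * C"
    using decompose_mod_conic[OF assms(1,4)] by blast
  have eq: "ev (arc y) B = - (fps_X * ev (arc y) C)"
    using assms(3,5) by (simp add: BC(3) ev_l eq_neg_iff_add_eq_0)
  have y: "y \<noteq> 0" "fps_nth y 0 = 0"
    using assms(2) by (auto intro: nth_less_subdegree_zero)
  note even = ev_binary_form[OF _ ev_l(1,3) y, unfolded assms(2)]
  have "B = 0 \<and> C = 0"
  proof (rule ccontr)
    assume "\<not> (B = 0 \<and> C = 0)"
    then have "B \<noteq> 0" "C \<noteq> 0"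
      using eq even[OF BC(1)] even[OF BC(2)] by auto
    then have "ev (arc y) C \<noteq> 0" "even (subdegree (ev (arc y) B))" "even (subdegree (ev (arc y) C))"
      using even BC(1,2) by auto
    moreover from this(1) have "subdegree (ev (arc y) B) = Suc (subdegree (ev (arc y) C))"
      unfolding eq by simp
    ultimately show False by simp
  qed
  then show ?thesis by (simp add: BC(3))
qed

end

section \<open>Exclusion of branches lying on lines and conics\<close>

context tangent_branch
begin

text \<open>The degree \<open>Suc m\<close> is at least 3, so a line or a conic containing the
  branch would be a proper factor of \<open>F\<close>.\<close>

lemma Monge_nonzero:
  assumes "irreducible F" "2 \<le> m"
  shows "Monge (fps_deriv (fps_deriv y)) \<noteq> 0"
proof
  assume M: "Monge (fps_deriv (fps_deriv y)) = 0"
  have F: "form (Suc m) F" by (rule form_F)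
  show False
  proof (cases "fps_deriv (fps_deriv y) = 0")
    case True
    then have "fps_deriv y = fps_const (fps_nth (fps_deriv y) 0)" by (simp only: fps_deriv_eq_0_iff)
    then have "fps_deriv y = 0" using y_1 by simp
    then have "y = fps_const (fps_nth y 0)" by (simp only: fps_deriv_eq_0_iff)
    then have "y = 0" using y_0 by simp
    then have "l2 dvd F" using line_dvd[OF F] on_curve by simp
    then show False using irreducible_form_no_factor[OF assms(1) F form_l(3)] assms(2) by simp
  next
    case False
    then have u: "fps_nth (fps_deriv (fps_deriv y)) 0 \<noteq> 0" using M by (intro Monge_0_unit)
    then have \<alpha>: "\<alpha> \<noteq> 0" by (simp add: eval_nat_numeral)
    have "subdegree y = 2"
      using \<alpha> y_0 y_1 by (intro subdegreeI) (auto simp: less_2_cases_iff)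
    obtain \<beta>' \<kappa> where eq: "(1 + fps_const \<beta>' * fps_X + fps_const \<kappa> * y) * y = fps_const \<alpha> * fps_X\<^sup>2"
      using Monge_0_conic[OF M u y_0 y_1] .
    have "ev g (conic \<alpha> \<beta>' \<kappa>) = 0"
      using eq by (simp add: conic_def ev_l power2_eq_square mult.commute)
    then have "conic \<alpha> \<beta>' \<kappa> dvd F"
      using conic_dvd[OF \<alpha> \<open>subdegree y = 2\<close> _ F on_curve] by blast
    moreover have "form 2 (conic \<alpha> \<beta>' \<kappa>)"
      unfolding conic_def
      by (intro form_diff form_mult[of 1 _ 1] form_add form_const3_mult form_l) simp_all
    ultimately show False using irreducible_form_no_factor[OF assms(1) F, of 2 "conic \<alpha> \<beta>' \<kappa>"] assms(2) by simp
  qed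
qed

end

theorem theorem1p1:
  fixes F :: "complex poly poly poly" and d :: nat
  assumes "d \<ge> 3" and "form d F" and "irreducible F"
  shows "plane_curve (12 * d - 27) (H2 d F) \<and>
         V F \<inter> V (H2 d F) =
           singular_points F \<union> higher_order_inflection_points F \<union> sextactic_points F"
proof
  define e where "e = d - 3"
  define m where "m = e + 2"
  have d: "d = e + 3" "d = Suc m" using assms(1) by (simp_all add: e_def m_def)
  have F: "form (e + 3) F" "form (Suc m) F" using assms(2) unfolding d(1) m_def by (simp_all add: numeral_3_eq_3)
  have zero_iff: "eval3 (H2 d F) q = 0 \<longleftrightarrow> q \<in> higher_order_inflection_points F \<union> sextactic_points F"
    if q: "q \<in> smooth_points F" for q
  proof -
    obtain a b c y where "tangent_branch a b c F m y" "frame.p a = q"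
      using tangent_branch_exists[OF F(2) q] .
    then show ?thesis using tangent_branch.H2_zero_iff[OF _ m_def] d(2) by metis
  qed
  show "plane_curve (12 * d - 27) (H2 d F)"
    unfolding plane_curve_def
  proof
    show "form (12 * d - 27) (H2 d F)" using form_H2[OF F(1)] by (simp add: d(1) add.commute)
    show "H2 d F \<noteq> 0"
    proof
      assume H2: "H2 d F = 0"
      obtain q where q: "q \<in> smooth_points F" using smooth_point_exists[OF assms(3,2)] assms(1) by auto
      obtain a b c y where "tangent_branch a b c F m y"
        using tangent_branch_exists[OF F(2) q] .
      then interpret tangent_branch a b c F m y .
      obtain C where C: "C \<noteq> 0" "ev g (H2 (Suc m) F) = fps_const C * D1 g F (const_vec c) ^ 12 * Monge (fps_deriv (fps_deriv y))"
        using H2_arc[OF m_def] .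
      have "fps_nth (D1 g F (const_vec c)) 0 \<noteq> 0"
        using transversal by (simp add: D1_const_vec_nth_0[OF y_0])
      then have "D1 g F (const_vec c) \<noteq> 0" by auto
      then have "Monge (fps_deriv (fps_deriv y)) = 0" using C H2 d(2) by simp
      then show False using Monge_nonzero[OF assms(3)] by (simp add: m_def)
    qed
  qed
  \<comment> \<open>At a singular point the first row of every Jacobian determinant in
    \<open>H2\<close> vanishes.\<close>
  have sing: "eval3 (H2 d F) q = 0" if "q \<in> singular_points F" for q
    using that by (simp add: singular_points_def H2_def Jac_Omega_H_def Jac_Omega_F_def Jac_Psi_def grad_def det_3)
  have "V F = singular_points F \<union> smooth_points F"
    by (auto simp: smooth_points_def singular_points_def)
  moreover have "higher_order_inflection_points F \<subseteq> smooth_points F" "sextactic_points F \<subseteq> smooth_points F"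
    by (auto simp: higher_order_inflection_points_def inflection_points_def sextactic_points_def)
  moreover have "q \<in> V (H2 d F) \<longleftrightarrow> eval3 (H2 d F) q = 0" if "q \<in> V F" for q
    using that by (simp add: V_def)
  ultimately show "V F \<inter> V (H2 d F) =
      singular_points F \<union> higher_order_inflection_points F \<union> sextactic_points F"
    using zero_iff sing by blast
qed

end
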